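(* Let $n\ge 1$. The degree of the Lagrangian Grassmannian $LG(n)$ is $$\deg(LG(n))=\frac{\left(\frac{n(n+1)}{2}\right)!}{\prod_{i=1}^n(2i-1)!}\prod_{1\le i<j\le n}(2j-2i).$$
   Context: $LG(n)$ is the Lagrangian Grassmannian of Lagrangian (maximal isotropic, $n$-dimensional) subspaces of a $2n$-dimensional complex symplectic vector space; it is smooth projective of dimension $\frac{n(n+1)}{2}$. It is regarded as a subvariety of a projective space via the Plücker embedding (restricted from the Grassmannian $G(n,2n)$). The degree of a subvariety of a projective space is the number of its intersection points with a generic linear subspace of complementary dimension; here $\deg(LG(n))=\int_{LG(n)}\sigma_1^{n(n+1)/2}$, where $\sigma_1=c_1(\mathcal S^\vee)$ and $\mathcal S$ is the tautological sub-bundle (fiber over a point is the corresponding subspace). *)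

theory Defs
  imports "Jordan_Normal_Form.DL_Submatrix" "Jordan_Normal_Form.VS_Connect" Complex_Main
begin

text \<open>
  For a finite index set \<open>K\<close>, the projective space of \<open>\<complex>\<^sup>K\<close> is the set of lines through the origin
  in the space of complex functions that vanish outside \<open>K\<close>.
\<close>

definition line_through :: "('i \<Rightarrow> complex) \<Rightarrow> ('i \<Rightarrow> complex) set" where
  "line_through x = range (\<lambda>c i. c * x i)"

definition proj_space :: "'i set \<Rightarrow> ('i \<Rightarrow> complex) set set" where
  "proj_space K = line_through ` {x. (\<forall>i. i \<notin> K \<longrightarrow> x i = 0) \<and> x \<noteq> (\<lambda>i. 0)}"

text \<open>
  A family of \<open>r\<close> linear forms on \<open>\<complex>\<^sup>K\<close> is given by its coefficients \<open>A (j, i)\<close>, \<open>j < r\<close>, \<open>i \<in> K\<close>.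
  The linear subspaces of codimension \<open>r\<close> are the common zero sets of \<open>r\<close> independent forms.
\<close>

definition independent_forms :: "'i set \<Rightarrow> nat \<Rightarrow> (nat \<times> 'i \<Rightarrow> complex) \<Rightarrow> bool" where
  "independent_forms K r A \<longleftrightarrow>
     (\<forall>c :: nat \<Rightarrow> complex. (\<forall>i\<in>K. (\<Sum>j<r. c j * A (j, i)) = 0) \<longrightarrow> (\<forall>j<r. c j = 0))"

definition linear_zeros ::
  "'i set \<Rightarrow> nat \<Rightarrow> (nat \<times> 'i \<Rightarrow> complex) \<Rightarrow> ('i \<Rightarrow> complex) set set" where
  "linear_zeros K r A =
     {p \<in> proj_space K. \<forall>x\<in>p. \<forall>j<r. (\<Sum>i\<in>K. A (j, i) * x i) = 0}"

inductive_set polynomial_functions :: "'v set \<Rightarrow> (('v \<Rightarrow> complex) \<Rightarrow> complex) set"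
  for V :: "'v set" where
  const: "(\<lambda>a. c) \<in> polynomial_functions V"
| coord: "v \<in> V \<Longrightarrow> (\<lambda>a. a v) \<in> polynomial_functions V"
| add: "F \<in> polynomial_functions V \<Longrightarrow> G \<in> polynomial_functions V \<Longrightarrow>
          (\<lambda>a. F a + G a) \<in> polynomial_functions V"
| mult: "F \<in> polynomial_functions V \<Longrightarrow> G \<in> polynomial_functions V \<Longrightarrow>
          (\<lambda>a. F a * G a) \<in> polynomial_functions V"

text \<open>
  A property holds for a generic linear subspace of codimension \<open>r\<close> if it holds on a nonempty
  Zariski-open set of them. Open sets are taken in the space of coefficients of \<open>r\<close> linear forms,
  which maps openly onto the Grassmannian of codimension-\<open>r\<close> subspaces where the forms are
  independent. Independence is part of what has to hold, so that the notion is never vacuous.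
\<close>

definition for_generic_linear ::
  "'i set \<Rightarrow> nat \<Rightarrow> (('i \<Rightarrow> complex) set set \<Rightarrow> bool) \<Rightarrow> bool" where
  "for_generic_linear K r P \<longleftrightarrow>
     (\<exists>F \<in> polynomial_functions ({..<r} \<times> K).
        (\<exists>A. F A \<noteq> 0) \<and>
        (\<forall>A. F A \<noteq> 0 \<longrightarrow> independent_forms K r A \<and> P (linear_zeros K r A)))"

text \<open>
  The dimension of a projective variety is the codimension in which generic linear subspaces meet
  it in a finite nonempty set of points (in smaller codimension they meet it in infinitely many
  points, in larger codimension not at all).
\<close>

definition proj_dim :: "'i set \<Rightarrow> ('i \<Rightarrow> complex) set set \<Rightarrow> nat" where
  "proj_dim K X = (THE r. for_generic_linear K r (\<lambda>L. finite (X \<inter> L) \<and> X \<inter> L \<noteq> {}))"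

definition proj_degree :: "'i set \<Rightarrow> ('i \<Rightarrow> complex) set set \<Rightarrow> nat" where
  "proj_degree K X =
     (THE d. for_generic_linear K (proj_dim K X) (\<lambda>L. finite (X \<inter> L) \<and> card (X \<inter> L) = d))"

definition symplectic_form :: "nat \<Rightarrow> (complex vec \<Rightarrow> complex vec \<Rightarrow> complex) \<Rightarrow> bool" where
  "symplectic_form m \<omega> \<longleftrightarrow>
     (\<forall>u\<in>carrier_vec m. \<forall>v\<in>carrier_vec m. \<forall>w\<in>carrier_vec m. \<forall>c.
        \<omega> (u + v) w = \<omega> u w + \<omega> v w \<and> \<omega> (c \<cdot>\<^sub>v u) w = c * \<omega> u w \<and>
        \<omega> w (u + v) = \<omega> w u + \<omega> w v \<and> \<omega> w (c \<cdot>\<^sub>v u) = c * \<omega> w u) \<and>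
     (\<forall>v\<in>carrier_vec m. \<omega> v v = 0) \<and>
     (\<forall>v\<in>carrier_vec m. (\<forall>w\<in>carrier_vec m. \<omega> v w = 0) \<longrightarrow> v = 0\<^sub>v m)"

definition grassmannian :: "nat \<Rightarrow> nat \<Rightarrow> complex vec set set" where
  "grassmannian k m =
     {L. subspace class_ring L (module_vec TYPE(complex) m) \<and>
         vectorspace.dim class_ring (module_vec TYPE(complex) m\<lparr>carrier := L\<rparr>) = k}"

definition lagrangian_grassmannian ::
  "nat \<Rightarrow> (complex vec \<Rightarrow> complex vec \<Rightarrow> complex) \<Rightarrow> complex vec set set" where
  "lagrangian_grassmannian n \<omega> =
     {L \<in> grassmannian n (2 * n). \<forall>u\<in>L. \<forall>v\<in>L. \<omega> u v = 0}"

definition pluecker_index :: "nat \<Rightarrow> nat \<Rightarrow> nat set set" where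
  "pluecker_index k m = {I. I \<subseteq> {..<m} \<and> card I = k}"

text \<open>The coordinates of \<open>b\<^sub>1 \<and> \<dots> \<and> b\<^sub>k\<close>, where the \<open>b\<^sub>j\<close> are the columns of \<open>B\<close>: its maximal minors.\<close>

definition pluecker_coords :: "nat \<Rightarrow> nat \<Rightarrow> complex mat \<Rightarrow> nat set \<Rightarrow> complex" where
  "pluecker_coords k m B I =
     (if I \<in> pluecker_index k m then det (submatrix B I UNIV) else 0)"

text \<open>
  For a \<open>k\<close>-dimensional \<open>L\<close>, all wedge products of \<open>k\<close> vectors of \<open>L\<close> are multiples of the wedge
  product of a basis, so the following set is the line \<open>\<Lambda>\<^sup>k L\<close> in \<open>\<Lambda>\<^sup>k \<complex>\<^sup>m\<close>.
\<close>

definition pluecker :: "nat \<Rightarrow> nat \<Rightarrow> complex vec set \<Rightarrow> (nat set \<Rightarrow> complex) set" where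
  "pluecker k m L =
     \<Union> {line_through (pluecker_coords k m B) | B. B \<in> carrier_mat m k \<and> set (cols B) \<subseteq> L}"

end

theory Submission
  imports "HOL-Analysis.Function_Topology" "HOL-Analysis.Path_Connected" "Jordan_Normal_Form.DL_Rank" Defs
begin

text \<open>
  Conservation of number: for a system of equations whose coefficients are parameters, the number of
  solutions is locally constant where the solutions stay bounded and nondegenerate, and the parameters
  for which this fails lie in a hypersurface, whose complement is connected along complex lines. So the
  number of solutions can be computed from one good system. This is used twice.

  In the main affine chart \<open>LG(n)\<close> is the space of symmetric matrices \<open>x\<close>, and a linear section of
  codimension \<open>N = n (n + 1) / 2\<close> is given by \<open>N\<close> equations in the minors of \<open>x\<close>. A good special
  section uses for the \<open>e\<close>-th equation the sum of the principal Pluecker coordinates of rank \<open>e + 1\<close> in the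
  Bruhat order, which is weighted homogeneous of degree \<open>2 e + 2\<close> if \<open>x\<^sub>i\<^sub>k\<close> has weight \<open>i + k + 2\<close>
  (indices from \<open>0\<close>). These sums have no common zero at the boundary of the chart by the symmetric exchange
  property of isotropic matrices. Substituting \<open>x\<^sub>i\<^sub>k = y\<^sub>i\<^sub>k\<^bsup>i + k + 2\<^esup>\<close>, conservation of number along a
  deformation to the system \<open>y\<^sub>e\<^bsup>2 e + 2\<^esup> = 1\<close> gives Bezout's count, hence
  \<open>deg LG(n) \<cdot> \<Prod>\<^bsub>i \<le> k < n\<^esub> (i + k + 2) = \<Prod>\<^bsub>e < N\<^esub> (2 e + 2)\<close>.
\<close>

subsection \<open>Polynomial functions\<close>

text \<open>The definition of degree asks for a single nonzero polynomial in the coefficients that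
  detects every bad section, whereas the bad sections are given as the projection of an incidence
  variety. Elimination is replaced by a dimension count. It applies because in every chart of the
  compactification each equation has a term that is constant and nonzero, so that its coefficient
  can be solved for. The weights come from the torus: scaling row and column \<open>i\<close> of
  \<open>x\<close> by \<open>l ^ (i + 1)\<close> multiplies the principal minor on \<open>I\<close>
  by \<open>l ^ (2 * weight I)\<close>. The weights of the nonempty subsets of \<open>{..<n}\<close>
  lie between \<open>1\<close> and \<open>N\<close>, so grouping by weight gives exactly
  \<open>N\<close> equations. Without perturbation these equations meet only in the origin of the
  main chart, where the whole degree sits as a multiplicity. Linear terms with a factor \<epsilon>
  provide a nondegenerate zero, and general right hand sides \<open>c\<close> make all zeros
  nondegenerate and keep them off the coordinate hyperplanes, where the substitution by powers
  ramifies. A general symplectic form is treated by a symplectic basis, which acts linearly on the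
  Pluecker coordinates.\<close>

lemmas PF_intros = polynomial_functions.intros

lemma PF_cong:
  assumes "F \<in> polynomial_functions V" and "\<And>v. v \<in> V \<Longrightarrow> a v = b v"
  shows "F a = F b"
  using assms by induction auto

lemma PF_cmult: "F \<in> polynomial_functions V \<Longrightarrow> (\<lambda>a. c * F a) \<in> polynomial_functions V"
  by (intro PF_intros)

lemma PF_diff:
  assumes "F \<in> polynomial_functions V" "G \<in> polynomial_functions V"
  shows "(\<lambda>a. F a - G a) \<in> polynomial_functions V"
proof -
  have "(\<lambda>a. F a + (-1) * G a) \<in> polynomial_functions V"
    using assms by (intro PF_intros)
  thus ?thesis by simp
qed

lemma PF_uminus: "F \<in> polynomial_functions V \<Longrightarrow> (\<lambda>a. - F a) \<in> polynomial_functions V"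
  using PF_cmult[of F V "-1"] by simp

lemma PF_sum:
  assumes "\<And>i. i \<in> I \<Longrightarrow> F i \<in> polynomial_functions V"
  shows "(\<lambda>a. \<Sum>i\<in>I. F i a) \<in> polynomial_functions V"
  using assms by (induction I rule: infinite_finite_induct) (auto intro: PF_intros)

lemma PF_prod:
  assumes "\<And>i. i \<in> I \<Longrightarrow> F i \<in> polynomial_functions V"
  shows "(\<lambda>a. \<Prod>i\<in>I. F i a) \<in> polynomial_functions V"
  using assms by (induction I rule: infinite_finite_induct) (auto intro: PF_intros)

lemma PF_power: "F \<in> polynomial_functions V \<Longrightarrow> (\<lambda>a. F a ^ k) \<in> polynomial_functions V"
  by (induction k) (auto intro: PF_intros)

lemma PF_subst:
  assumes "F \<in> polynomial_functions V" and "\<And>v. v \<in> V \<Longrightarrow> g v \<in> polynomial_functions U"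
  shows "(\<lambda>a. F (\<lambda>v. g v a)) \<in> polynomial_functions U"
  using assms by induction (auto intro: PF_intros)

lemma PF_det:
  assumes "\<And>i j. i < n \<Longrightarrow> j < n \<Longrightarrow> M i j \<in> polynomial_functions V"
  shows "(\<lambda>a. det (mat n n (\<lambda>(i, j). M i j a))) \<in> polynomial_functions V"
proof -
  have "(\<lambda>a. \<Sum>p | p permutes {0..<n}. of_int (sign p) * (\<Prod>i = 0..<n. M i (p i) a))
      \<in> polynomial_functions V"
    using assms
    by (intro PF_sum PF_cmult PF_prod) (auto dest: permutes_in_image)
  also have "(\<lambda>a. \<Sum>p | p permutes {0..<n}. of_int (sign p) * (\<Prod>i = 0..<n. M i (p i) a)) =
     (\<lambda>a. det (mat n n (\<lambda>(i, j). M i j a)))"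
    by (intro ext, subst det_def'[where n=n])
      (auto intro!: sum.cong prod.cong simp: permutes_in_image)
  finally show ?thesis .
qed

lemma PF_line:
  assumes "F \<in> polynomial_functions V"
  shows "\<exists>p. \<forall>t. F (\<lambda>v. a v + t * b v) = poly p t"
  using assms
proof induction
  case (const c)
  show ?case by (intro exI[of _ "[:c:]"]) simp
next
  case (coord v)
  show ?case by (intro exI[of _ "[:a v, b v:]"]) simp
next
  case (add F G)
  then obtain p q where "\<forall>t. F (\<lambda>v. a v + t * b v) = poly p t" "\<forall>t. G (\<lambda>v. a v + t * b v) = poly q t"
    by blast
  thus ?case by (intro exI[of _ "p + q"]) simp
next
  case (mult F G)
  then obtain p q where "\<forall>t. F (\<lambda>v. a v + t * b v) = poly p t" "\<forall>t. G (\<lambda>v. a v + t * b v) = poly q t"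
    by blast
  thus ?case by (intro exI[of _ "p * q"]) simp
qed

lemma PF_line_finite_zeros:
  assumes "F \<in> polynomial_functions V" "F (\<lambda>v. a v + t0 * b v) \<noteq> 0"
  shows "finite {t. F (\<lambda>v. a v + t * b v) = 0}"
proof -
  obtain p where p: "\<And>t. F (\<lambda>v. a v + t * b v) = poly p t"
    using PF_line[OF assms(1)] by blast
  have "p \<noteq> 0" using assms(2) p by auto
  thus ?thesis using poly_roots_finite[of p] p by simp
qed

text \<open>On the line through \<open>a\<close> and \<open>b\<close> both functions become
  polynomials in one variable that are not identically zero, so some point of the line avoids all
  their zeros. This is the irreducibility of affine space; it lets generic conditions be
  combined.\<close>

lemma PF_domain:
  assumes F: "F \<in> polynomial_functions V" "F a \<noteq> 0" and G: "G \<in> polynomial_functions W" "G b \<noteq> 0"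
  shows "\<exists>c. F c \<noteq> 0 \<and> G c \<noteq> 0"
proof -
  let ?l = "\<lambda>t v. a v + t * (b v - a v)"
  have "finite ({t. F (?l t) = 0} \<union> {t. G (?l t) = 0})"
    using PF_line_finite_zeros[OF F(1), of a 0 "\<lambda>v. b v - a v"]
      PF_line_finite_zeros[OF G(1), of a 1 "\<lambda>v. b v - a v"] F(2) G(2) by simp
  then obtain t where "t \<notin> {t. F (?l t) = 0} \<union> {t. G (?l t) = 0}"
    using ex_new_if_finite infinite_UNIV_char_0 by blast
  thus ?thesis by auto
qed

lemma PF_prod_nonzero:
  assumes "finite I" "\<And>i. i \<in> I \<Longrightarrow> F i \<in> polynomial_functions V" "\<And>i. i \<in> I \<Longrightarrow> \<exists>a. F i a \<noteq> 0"
  shows "\<exists>a. (\<Prod>i\<in>I. F i a) \<noteq> 0"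
  using assms
proof (induction I)
  case (insert i I)
  have "\<exists>a. F i a \<noteq> 0" "\<exists>a. (\<Prod>i\<in>I. F i a) \<noteq> 0" using insert by auto
  then obtain a b where ab: "F i a \<noteq> 0" "(\<Prod>i\<in>I. F i b) \<noteq> 0" by blast
  have P: "(\<lambda>a. \<Prod>i\<in>I. F i a) \<in> polynomial_functions V" using insert.prems by (intro PF_prod) auto
  have "F i \<in> polynomial_functions V" using insert.prems by auto
  from PF_domain[where F="F i", OF this ab(1) P ab(2)] insert.hyps show ?case by auto
qed auto

section \<open>Continuity and neighbourhoods in the space of coefficients\<close>

lemma PF_continuous: "F \<in> polynomial_functions V \<Longrightarrow> continuous_on S F"
proof (induction rule: polynomial_functions.induct)
  case (coord v)
  show ?case by (rule continuous_on_subset[OF continuous_on_product_coordinates]) simp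
qed (auto intro: continuous_intros)

lemma PF_tendsto: "F \<in> polynomial_functions V \<Longrightarrow> (F \<longlongrightarrow> F a) (nhds a)"
  using PF_continuous[of F V UNIV]
    tendsto_at_iff_tendsto_nhds[of F a]
  by (simp add: continuous_on_def)

text \<open>A neighbourhood in the product topology may constrain coordinates outside
  \<open>V\<close>. Resetting those to \<open>a\<close>, as in \<open>b'\<close>, is harmless
  because \<open>P\<close> depends on the coordinates in \<open>V\<close> alone, so a box in these
  coordinates remains.\<close>

lemma nhds_coordinatewise:
  fixes a :: "'v \<Rightarrow> complex"
  assumes ev: "\<forall>\<^sub>F b in nhds a. P b" and fin: "finite V"
    and dep: "\<And>b b'. (\<forall>v\<in>V. b v = b' v) \<Longrightarrow> P b \<Longrightarrow> P b'"
  shows "\<exists>e>0. \<forall>b. (\<forall>v\<in>V. cmod (b v - a v) \<le> e) \<longrightarrow> P b"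
proof -
  obtain U where U: "open U" "a \<in> U" "\<And>b. b \<in> U \<Longrightarrow> P b"
    using ev by (auto simp: eventually_nhds)
  from product_topology_open_contains_basis[of "\<lambda>_. euclidean" UNIV U a] U(1,2)
  obtain X where X: "a \<in> Pi\<^sub>E UNIV X" "\<And>i. open (X i)" "Pi\<^sub>E UNIV X \<subseteq> U"
    by (auto simp: euclidean_product_topology open_openin[symmetric])
  have "\<exists>e>0. cball (a v) e \<subseteq> X v" for v
    using X(1,2) open_contains_cball[of "X v"] by (auto simp: PiE_iff)
  then obtain e where e: "\<And>v. e v > 0" "\<And>v. cball (a v) (e v) \<subseteq> X v" by metis
  define d where "d = Min (insert 1 (e ` V))"
  have d: "d > 0" "\<And>v. v \<in> V \<Longrightarrow> d \<le> e v" using fin e(1) by (auto simp: d_def)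
  show ?thesis
  proof (intro exI[of _ d] conjI allI impI d(1))
    fix b assume b: "\<forall>v\<in>V. cmod (b v - a v) \<le> d"
    define b' where "b' = (\<lambda>v. if v \<in> V then b v else a v)"
    have "b' v \<in> X v" for v
    proof (cases "v \<in> V")
      case True
      hence "b v \<in> cball (a v) (e v)" using b d(2)[OF True] by (force simp: dist_norm norm_minus_commute)
      thus ?thesis using e(2)[of v] True unfolding b'_def by auto
    qed (use X(1) in \<open>auto simp: b'_def\<close>)
    hence "b' \<in> U" using X(3) by (auto simp: PiE_iff)
    thus "P b" using U(3) dep[of b' b] by (auto simp: b'_def)
  qed
qed

lemma eventually_nhds_coordinates:
  fixes a :: "'v \<Rightarrow> complex"
  assumes "finite V" "e > 0"
  shows "\<forall>\<^sub>F b in nhds a. \<forall>v\<in>V. cmod (b v - a v) < e"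
proof -
  have "\<forall>\<^sub>F b in nhds a. cmod (b v - a v) < e" if "v \<in> V" for v
    using PF_tendsto[OF coord[OF that], of a] \<open>e > 0\<close> by (auto simp: tendsto_iff dist_norm)
  thus ?thesis using assms(1) by (auto intro: eventually_ball_finite)
qed

lemma tendsto_line:
  fixes a b :: "'v \<Rightarrow> complex"
  shows "((\<lambda>t v. a v + t * b v) \<longlongrightarrow> (\<lambda>v. a v + t0 * b v)) (nhds t0)"
proof -
  have "continuous_on UNIV (\<lambda>t v. a v + t * b v)"
    by (intro continuous_on_coordinatewise_then_product continuous_intros)
  thus ?thesis
    using tendsto_at_iff_tendsto_nhds[of "\<lambda>t v. a v + t * b v" t0]
    by (simp add: continuous_on_eq_continuous_at isCont_def)
qed

text \<open>Hadamard's lemma with polynomial coefficients, by the product rule for differences. On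
  the diagonal the coefficients are the partial derivatives; off the diagonal they replace the mean
  value theorem in the contraction estimate of \<open>unique_zero_near\<close>.\<close>

lemma PF_hadamard:
  assumes "finite V" "F \<in> polynomial_functions V"
  shows "\<exists>Q. (\<forall>v. Q v \<in> polynomial_functions (Inl ` V \<union> Inr ` V)) \<and>
    (\<forall>a b. F a - F b = (\<Sum>v\<in>V. Q v (case_sum a b) * (a v - b v)))"
  using assms(2)
proof induction
  case (const c)
  show ?case by (intro exI[of _ "\<lambda>v a. 0"]) (auto intro: PF_intros)
next
  case (coord v)
  show ?case
    using coord assms(1)
    by (intro exI[of _ "\<lambda>w a. if w = v then 1 else 0"]) (auto intro: PF_intros simp: if_distrib[of "\<lambda>x. x * _"] cong: if_cong)
next
  case (add F G)
  then obtain Q R where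
    "\<forall>v. Q v \<in> polynomial_functions (Inl ` V \<union> Inr ` V)" "\<forall>a b. F a - F b = (\<Sum>v\<in>V. Q v (case_sum a b) * (a v - b v))"
    "\<forall>v. R v \<in> polynomial_functions (Inl ` V \<union> Inr ` V)" "\<forall>a b. G a - G b = (\<Sum>v\<in>V. R v (case_sum a b) * (a v - b v))"
    by blast
  thus ?case
    by (intro exI[of _ "\<lambda>v a. Q v a + R v a"])
      (auto intro!: PF_intros simp: distrib_right sum.distrib add_diff_add)
next
  case (mult F G)
  then obtain Q R where
    QR: "\<forall>v. Q v \<in> polynomial_functions (Inl ` V \<union> Inr ` V)" "\<forall>a b. F a - F b = (\<Sum>v\<in>V. Q v (case_sum a b) * (a v - b v))"
    "\<forall>v. R v \<in> polynomial_functions (Inl ` V \<union> Inr ` V)" "\<forall>a b. G a - G b = (\<Sum>v\<in>V. R v (case_sum a b) * (a v - b v))"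
    by blast
  have L: "(\<lambda>c. F (\<lambda>v. c (Inl v))) \<in> polynomial_functions (Inl ` V \<union> Inr ` V)"
    by (intro PF_subst[OF mult(1)] coord) auto
  have R: "(\<lambda>c. G (\<lambda>v. c (Inr v))) \<in> polynomial_functions (Inl ` V \<union> Inr ` V)"
    by (intro PF_subst[OF mult(2)] coord) auto
  show ?case
  proof (intro exI[of _ "\<lambda>v c. F (\<lambda>v. c (Inl v)) * R v c + G (\<lambda>v. c (Inr v)) * Q v c"] conjI allI)
    fix a b
    have "F a * G a - F b * G b = F a * (G a - G b) + G b * (F a - F b)" by (simp add: algebra_simps)
    also have "\<dots> = F a * (\<Sum>v\<in>V. R v (case_sum a b) * (a v - b v)) + G b * (\<Sum>v\<in>V. Q v (case_sum a b) * (a v - b v))"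
      using QR by simp
    finally show "F a * G a - F b * G b = (\<Sum>v\<in>V. (F (\<lambda>v. case_sum a b (Inl v)) * R v (case_sum a b) +
          G (\<lambda>v. case_sum a b (Inr v)) * Q v (case_sum a b)) * (a v - b v))"
      by (simp add: sum_distrib_left sum.distrib distrib_right mult.assoc)
  qed (use QR L R in \<open>auto intro!: PF_intros\<close>)
qed

text \<open>The derivative is taken analytically, because a member of
  \<open>polynomial_functions\<close> is a mere function without a chosen expression to
  differentiate.\<close>

definition pd :: "'v \<Rightarrow> (('v \<Rightarrow> complex) \<Rightarrow> complex) \<Rightarrow> ('v \<Rightarrow> complex) \<Rightarrow> complex" where
  "pd v F c = (THE D. ((\<lambda>t. F (c(v := t))) has_field_derivative D) (at (c v)))"

lemma hadamard_deriv:
  assumes "finite V" "v \<in> V" "Q v \<in> polynomial_functions W"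
    and "\<And>a b. F a - F b = (\<Sum>v\<in>V. Q v (case_sum a b) * (a v - b v))"
  shows "((\<lambda>t. F (c(v := t))) has_field_derivative Q v (case_sum c c)) (at (c v))"
    and "pd v F c = Q v (case_sum c c)"
proof -
  let ?g = "\<lambda>t. Q v (case_sum (c(v := t)) c)"
  have "F (c(v := t)) - F c = ?g t * (t - c v)" for t
  proof -
    have "F (c(v := t)) - F c = (\<Sum>w\<in>V. if w = v then ?g t * (t - c v) else 0)"
      by (subst assms(4)) (auto intro!: sum.cong)
    thus ?thesis using assms(1,2) by simp
  qed
  moreover have "continuous_on UNIV (\<lambda>t::complex. case_sum (c(v := t)) c)"
  proof (intro continuous_on_coordinatewise_then_product)
    fix i show "continuous_on UNIV (\<lambda>x. case_sum (c(v := x)) c i)"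
      by (cases i; cases "i = Inl v") (auto intro!: continuous_intros)
  qed
  hence "continuous_on UNIV ?g"
    by (intro continuous_on_compose2[OF PF_continuous[OF assms(3), of UNIV]]) auto
  hence "isCont ?g (c v)" by (simp add: continuous_on_eq_continuous_at)
  ultimately show D: "((\<lambda>t. F (c(v := t))) has_field_derivative Q v (case_sum c c)) (at (c v))"
    by (subst CARAT_DERIV) (intro exI[of _ ?g], auto)
  thus "pd v F c = Q v (case_sum c c)"
    unfolding pd_def by (blast intro: DERIV_unique)
qed

lemma PF_has_deriv:
  assumes "finite V" "v \<in> V" "F \<in> polynomial_functions V"
  shows "((\<lambda>t. F (c(v := t))) has_field_derivative pd v F c) (at (c v))"
proof -
  obtain Q where Q: "\<And>v. Q v \<in> polynomial_functions (Inl ` V \<union> Inr ` V)"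
    "\<And>a b. F a - F b = (\<Sum>v\<in>V. Q v (case_sum a b) * (a v - b v))"
    using PF_hadamard[OF assms(1,3)] by blast
  show ?thesis using hadamard_deriv[OF assms(1,2) Q(1) Q(2)] by metis
qed

lemma PF_pd:
  assumes "finite V" "v \<in> V" "F \<in> polynomial_functions V"
  shows "pd v F \<in> polynomial_functions V"
proof -
  obtain Q where Q: "\<And>v. Q v \<in> polynomial_functions (Inl ` V \<union> Inr ` V)"
    "\<And>a b. F a - F b = (\<Sum>v\<in>V. Q v (case_sum a b) * (a v - b v))"
    using PF_hadamard[OF assms(1,3)] by blast
  have "(\<lambda>c. Q v (\<lambda>w. case_sum c c w)) \<in> polynomial_functions V"
  proof (rule PF_subst[OF Q(1)])
    fix w :: "'a + 'a" assume "w \<in> Inl ` V \<union> Inr ` V"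
    thus "(\<lambda>c. case_sum c c w) \<in> polynomial_functions V" by (auto intro: coord)
  qed
  also have "(\<lambda>c. Q v (\<lambda>w. case_sum c c w)) = pd v F"
    using hadamard_deriv(2)[OF assms(1,2) Q(1) Q(2)] by auto
  finally show ?thesis .
qed

text \<open>Gaussian elimination: an equation with a nonzero coefficient at \<open>w\<close> is
  solved for the unknown \<open>w\<close>, and \<open>M'\<close> is what the other equations
  become.\<close>

lemma exists_nonzero_kernel:
  fixes M :: "'e \<Rightarrow> 'u \<Rightarrow> 'a::field"
  assumes "finite E" "finite U" "card E < card U"
  shows "\<exists>x. (\<exists>u\<in>U. x u \<noteq> 0) \<and> (\<forall>u. u \<notin> U \<longrightarrow> x u = 0) \<and> (\<forall>e\<in>E. (\<Sum>u\<in>U. M e u * x u) = 0)"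
  using assms
proof (induction E arbitrary: U M rule: finite_induct)
  case empty
  then obtain u where u: "u \<in> U" by fastforce
  show ?case by (intro exI[of _ "\<lambda>v. if v = u then 1 else 0"]) (use u in auto)
next
  case (insert e E)
  show ?case
  proof (cases "\<forall>u\<in>U. M e u = 0")
    case True
    have "card E < card U" using insert by simp
    from insert.IH[OF insert.prems(1) this, of M] obtain x where
      "\<exists>u\<in>U. x u \<noteq> 0" "\<forall>u. u \<notin> U \<longrightarrow> x u = 0" "\<forall>e\<in>E. (\<Sum>u\<in>U. M e u * x u) = 0"
      by (elim exE conjE) (rule that)
    moreover have "(\<Sum>u\<in>U. M e u * x u) = 0" using True by simp
    ultimately show ?thesis by (intro exI[of _ x]) simp
  next
    case False
    then obtain w where w: "w \<in> U" "M e w \<noteq> 0" by blast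
    define M' where "M' = (\<lambda>e' u. M e' u - M e' w * M e u / M e w)"
    have "card E < card (U - {w})" using insert w by simp
    from insert.IH[OF finite_Diff[OF insert.prems(1)] this, of M'] obtain x where
      x: "\<exists>u\<in>U - {w}. x u \<noteq> 0" "\<forall>u. u \<notin> U - {w} \<longrightarrow> x u = 0"
        "\<forall>e\<in>E. (\<Sum>u\<in>U - {w}. M' e u * x u) = 0" by (elim exE conjE) (rule that)
    define s where "s = (\<Sum>u\<in>U - {w}. M e u * x u)"
    define y where "y = x(w := - s / M e w)"
    have sum_y: "(\<Sum>u\<in>U. M e' u * y u) = (\<Sum>u\<in>U - {w}. M e' u * x u) - M e' w * s / M e w" for e'
      using insert.prems(1) w(1) by (subst sum.remove[of U w]) (auto simp: y_def intro!: sum.cong)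
    show ?thesis
    proof (intro exI[of _ y] conjI ballI allI impI)
      show "\<exists>u\<in>U. y u \<noteq> 0" using x(1) by (auto simp: y_def)
      show "y u = 0" if "u \<notin> U" for u using that w x(2) by (auto simp: y_def)
      fix e' assume e': "e' \<in> insert e E"
      show "(\<Sum>u\<in>U. M e' u * y u) = 0"
      proof (cases "e' = e")
        case True
        thus ?thesis using w(2) by (simp add: sum_y s_def[symmetric])
      next
        case False
        have "(\<Sum>u\<in>U - {w}. M' e' u * x u) = (\<Sum>u\<in>U - {w}. M e' u * x u) - M e' w * s / M e w"
          by (simp add: M'_def s_def left_diff_distrib sum_subtractf sum_distrib_left sum_divide_distrib mult.assoc)
        thus ?thesis using x(3) e' False by (simp add: sum_y)
      qed
    qed
  qed
qed

section \<open>Counting monomials of bounded degree\<close>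

definition monomial_fun :: "'v set \<Rightarrow> ('v \<Rightarrow> nat) \<Rightarrow> ('v \<Rightarrow> complex) \<Rightarrow> complex" where
  "monomial_fun V m a = (\<Prod>v\<in>V. a v ^ m v)"

abbreviation exponents :: "'v set \<Rightarrow> nat \<Rightarrow> ('v \<Rightarrow> nat) set" where
  "exponents V d \<equiv> V \<rightarrow>\<^sub>E {..d}"

text \<open>The degree is bounded in each variable separately, so that the exponents form a box with
  \<open>(d + 1) ^ card V\<close> elements. For the dimension count only the order of growth in
  \<open>d\<close> matters.\<close>

definition bounded_degree :: "'v set \<Rightarrow> nat \<Rightarrow> (('v \<Rightarrow> complex) \<Rightarrow> complex) set" where
  "bounded_degree V d = {F. \<exists>c. F = (\<lambda>a. \<Sum>m\<in>exponents V d. c m * monomial_fun V m a)}"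

lemma finite_exponents: "finite V \<Longrightarrow> finite (exponents V d)"
  by (auto intro: finite_PiE)

lemma card_exponents: "finite V \<Longrightarrow> card (exponents V d) = (d + 1) ^ card V"
  by (simp add: card_PiE)

lemma monomial_fun_PF: "monomial_fun V m \<in> polynomial_functions V"
  unfolding monomial_fun_def by (intro PF_prod PF_power coord)

lemma monomial_fun_mult:
  "monomial_fun V m a * monomial_fun V m' a = monomial_fun V (restrict (\<lambda>v. m v + m' v) V) a"
  unfolding monomial_fun_def prod.distrib[symmetric] by (rule prod.cong) (simp_all add: power_add)

lemma bounded_degree_monomial:
  assumes "finite V" "m \<in> exponents V d"
  shows "(\<lambda>a. c * monomial_fun V m a) \<in> bounded_degree V d"
proof -
  have "(\<lambda>a. c * monomial_fun V m a) = (\<lambda>a. \<Sum>m'\<in>exponents V d. (if m' = m then c else 0) * monomial_fun V m' a)"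
    using finite_exponents[OF assms(1), of d] assms(2)
    by (auto simp: if_distrib[of "\<lambda>x. x * _"] cong: if_cong)
  thus ?thesis unfolding bounded_degree_def by (intro CollectI exI)
qed

lemma bounded_degree_add:
  assumes "F \<in> bounded_degree V d" "G \<in> bounded_degree V d"
  shows "(\<lambda>a. F a + G a) \<in> bounded_degree V d"
proof -
  obtain b c where "F = (\<lambda>a. \<Sum>m\<in>exponents V d. b m * monomial_fun V m a)"
    "G = (\<lambda>a. \<Sum>m\<in>exponents V d. c m * monomial_fun V m a)"
    using assms by (auto simp: bounded_degree_def)
  hence "(\<lambda>a. F a + G a) = (\<lambda>a. \<Sum>m\<in>exponents V d. (b m + c m) * monomial_fun V m a)"
    by (simp add: distrib_right sum.distrib)
  thus ?thesis unfolding bounded_degree_def by (intro CollectI exI)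
qed

lemma bounded_degree_zero: "(\<lambda>a. 0) \<in> bounded_degree V d"
  unfolding bounded_degree_def by (intro CollectI exI[of _ "\<lambda>m. 0"]) simp

lemma bounded_degree_sum:
  assumes "\<And>i. i \<in> I \<Longrightarrow> F i \<in> bounded_degree V d"
  shows "(\<lambda>a. \<Sum>i\<in>I. F i a) \<in> bounded_degree V d"
  using assms
  by (induction I rule: infinite_finite_induct) (auto intro: bounded_degree_add bounded_degree_zero)

lemma bounded_degree_mono:
  assumes "finite V" "F \<in> bounded_degree V d" "d \<le> d'"
  shows "F \<in> bounded_degree V d'"
proof -
  obtain c where F: "F = (\<lambda>a. \<Sum>m\<in>exponents V d. c m * monomial_fun V m a)"
    using assms(2) by (auto simp: bounded_degree_def)
  have "m \<in> exponents V d'" if "m \<in> exponents V d" for m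
    using that assms(3) PiE_mono[of V "\<lambda>_. {..d}" "\<lambda>_. {..d'}"] by (simp add: subset_iff)
  thus ?thesis unfolding F by (intro bounded_degree_sum bounded_degree_monomial assms(1))
qed

lemma bounded_degree_mult:
  assumes "finite V" "F \<in> bounded_degree V d" "G \<in> bounded_degree V d'"
  shows "(\<lambda>a. F a * G a) \<in> bounded_degree V (d + d')"
proof -
  obtain b c where F: "F = (\<lambda>a. \<Sum>m\<in>exponents V d. b m * monomial_fun V m a)"
    and G: "G = (\<lambda>a. \<Sum>m\<in>exponents V d'. c m * monomial_fun V m a)"
    using assms by (auto simp: bounded_degree_def)
  have "(\<lambda>a. F a * G a) = (\<lambda>a. \<Sum>m\<in>exponents V d. \<Sum>m'\<in>exponents V d'.
      (b m * c m') * monomial_fun V (restrict (\<lambda>v. m v + m' v) V) a)"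
    by (simp add: F G sum_product monomial_fun_mult[symmetric] mult.assoc mult.left_commute)
  also have "\<dots> \<in> bounded_degree V (d + d')"
  proof (intro bounded_degree_sum bounded_degree_monomial assms(1))
    fix m m' assume m: "m \<in> exponents V d" "m' \<in> exponents V d'"
    have "m v + m' v \<le> d + d'" if "v \<in> V" for v
      using PiE_mem[OF m(1) that] PiE_mem[OF m(2) that] by simp
    thus "(\<lambda>v\<in>V. m v + m' v) \<in> exponents V (d + d')" by (intro restrict_PiE_iff[THEN iffD2]) simp
  qed
  finally show ?thesis .
qed

lemma bounded_degree_const: "finite V \<Longrightarrow> (\<lambda>a. c) \<in> bounded_degree V d"
  using bounded_degree_monomial[of V "restrict (\<lambda>_. 0) V" d c] by (auto simp: monomial_fun_def)

lemma bounded_degree_power: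
  assumes "finite V" "F \<in> bounded_degree V d"
  shows "(\<lambda>a. F a ^ k) \<in> bounded_degree V (k * d)"
  by (induction k) (auto intro: bounded_degree_const bounded_degree_mult assms)

lemma bounded_degree_prod:
  assumes "finite V" "finite I" "\<And>i. i \<in> I \<Longrightarrow> F i \<in> bounded_degree V d"
  shows "(\<lambda>a. \<Prod>i\<in>I. F i a) \<in> bounded_degree V (card I * d)"
  using assms(2,3)
  by (induction I rule: finite_induct) (auto intro: bounded_degree_const bounded_degree_mult assms(1))

lemma PF_bounded_degree:
  assumes "finite V" "F \<in> polynomial_functions V"
  shows "\<exists>d. F \<in> bounded_degree V d"
  using assms(2)
proof induction
  case (const c)
  show ?case using bounded_degree_const[OF assms(1)] by blast
next
  case (coord v)
  have "(\<lambda>a. a v) = monomial_fun V (restrict (\<lambda>w. if w = v then 1 else 0) V)"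
    using coord assms(1) by (auto simp: monomial_fun_def if_distrib[of "\<lambda>k. _ ^ k"] prod.If_cases Int_absorb1 cong: if_cong)
  thus ?case using bounded_degree_monomial[OF assms(1), of "restrict (\<lambda>w. if w = v then 1 else 0) V" 1 1] by auto
next
  case (add F G)
  then obtain d d' where "F \<in> bounded_degree V d" "G \<in> bounded_degree V d'" by blast
  hence "(\<lambda>a. F a + G a) \<in> bounded_degree V (max d d')"
    using bounded_degree_mono[OF assms(1), of F d "max d d'"] bounded_degree_mono[OF assms(1), of G d' "max d d'"]
    by (intro bounded_degree_add) simp_all
  thus ?case by blast
next
  case (mult F G)
  thus ?case using bounded_degree_mult[OF assms(1)] by blast
qed

text \<open>For fixed values of the other variables the function is a polynomial in one variable
  that vanishes everywhere; its coefficients are polynomial functions of the remaining variables, to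
  which the induction applies.\<close>

lemma zero_polynomial_coefficients:
  assumes "finite V" "\<And>a. (\<Sum>m\<in>exponents V d. c m * monomial_fun V m a) = 0" "m \<in> exponents V d"
  shows "c m = 0"
  using assms
proof (induction V arbitrary: c m rule: finite_induct)
  case empty
  thus ?case by (simp add: monomial_fun_def)
next
  case (insert v V)
  have inj: "inj_on (\<lambda>(k, m). m(v := k)) ({..d} \<times> exponents V d)"
    using inj_combinator[OF insert.hyps(2), of "\<lambda>_. {..d}"] .
  have mono: "monomial_fun (insert v V) (m(v := k)) a = a v ^ k * monomial_fun V m a" for m k a
  proof -
    have "(\<Prod>x\<in>V. a x ^ (m(v := k)) x) = (\<Prod>x\<in>V. a x ^ m x)"
      using insert.hyps(2) by (intro prod.cong) auto
    thus ?thesis unfolding monomial_fun_def using insert.hyps by simp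
  qed
  have *: "(\<Sum>k\<le>d. (\<Sum>m\<in>exponents V d. c (m(v := k)) * monomial_fun V m a) * a v ^ k) = 0" for a
  proof -
    have "(\<Sum>m\<in>exponents (insert v V) d. c m * monomial_fun (insert v V) m a) =
      (\<Sum>(k, m)\<in>{..d} \<times> exponents V d. c (m(v := k)) * (a v ^ k * monomial_fun V m a))"
    proof -
      have "exponents (insert v V) d = (\<lambda>(k, m). m(v := k)) ` ({..d} \<times> exponents V d)"
        by (simp add: PiE_insert_eq)
      thus ?thesis using sum.reindex[OF inj, of "\<lambda>m. c m * monomial_fun (insert v V) m a"]
        by (simp add: case_prod_unfold mono)
    qed
    also have "\<dots> = (\<Sum>k\<le>d. \<Sum>m\<in>exponents V d. c (m(v := k)) * (a v ^ k * monomial_fun V m a))"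
      by (rule sum.cartesian_product[symmetric])
    also have "\<dots> = (\<Sum>k\<le>d. (\<Sum>m\<in>exponents V d. c (m(v := k)) * monomial_fun V m a) * a v ^ k)"
      by (simp add: sum_distrib_right mult.assoc mult.commute[of "a v ^ _"])
    finally show ?thesis using insert.prems(1)[of a] by simp
  qed
  have **: "(\<Sum>m\<in>exponents V d. c (m(v := k)) * monomial_fun V m a) = 0" if "k \<le> d" for k a
  proof -
    have "monomial_fun V m (a(v := w)) = monomial_fun V m a" for m w
      using insert.hyps(2) by (auto simp: monomial_fun_def intro!: prod.cong)
    hence "(\<Sum>k\<le>d. (\<Sum>m\<in>exponents V d. c (m(v := k)) * monomial_fun V m a) * w ^ k) = 0" for w
      using *[of "a(v := w)"] by simp
    thus ?thesis by (rule zero_polynom_imp_zero_coeffs) (use that in auto)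
  qed
  obtain k m' where m: "m = m'(v := k)" "k \<le> d" "m' \<in> exponents V d"
    using insert.prems(2) by (auto simp: PiE_insert_eq)
  from insert.IH[OF **[OF m(2)] m(3)] m(1) show ?case by simp
qed

text \<open>
  The number of monomials in \<open>card P + 1\<close> functions grows faster than the dimension of the space
  of polynomials in \<open>card V \<le> card P\<close> variables that contains their values, so \<open>h\<close> and the
  \<open>\<Phi> p\<close> satisfy a polynomial relation. Cancelling powers of \<open>h\<close> makes the relation nontrivial at \<open>h = 0\<close>.
\<close>

lemma image_of_hypersurface:
  assumes V: "finite V" and P: "finite P" and card: "card V \<le> card P"
    and \<Phi>: "\<And>p. p \<in> P \<Longrightarrow> \<Phi> p \<in> polynomial_functions V"
    and h: "h \<in> polynomial_functions V" "h w0 \<noteq> 0"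
  shows "\<exists>F\<in>polynomial_functions P. (\<exists>a. F a \<noteq> 0) \<and> (\<forall>w. h w = 0 \<longrightarrow> F (\<lambda>p. \<Phi> p w) = 0)"
proof -
  have "\<forall>p\<in>P. \<exists>d. \<Phi> p \<in> bounded_degree V d"
    using PF_bounded_degree[OF V \<Phi>] by simp
  from bchoice[OF this] obtain \<delta> where \<delta>: "\<forall>p\<in>P. \<Phi> p \<in> bounded_degree V (\<delta> p)" ..
  from PF_bounded_degree[OF V h(1)] obtain d2 where d2: "h \<in> bounded_degree V d2" ..
  define d where "d = d2 + sum \<delta> P"
  have d\<Phi>: "\<Phi> p \<in> bounded_degree V d" if "p \<in> P" for p
  proof (rule bounded_degree_mono[OF V])
    show "\<Phi> p \<in> bounded_degree V (\<delta> p)" using \<delta> that by (rule bspec)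
    show "\<delta> p \<le> d" using member_le_sum[OF that _ P, of \<delta>] by (simp add: d_def)
  qed
  have dh: "h \<in> bounded_degree V d"
    by (rule bounded_degree_mono[OF V d2]) (simp add: d_def)
  obtain q where q: "q = card P" by simp
  \<comment> \<open>A product of at most \<open>D\<close> factors \<open>h\<close> and at most
    \<open>D\<close> factors of each of the \<open>q\<close> functions \<open>\<Phi> p\<close> has
    degree at most \<open>D * d + q * D * d = c0 * D\<close>. The choice
    \<open>D = \<kappa> ^ q\<close> makes the number of such products exceed the number of
    monomials: \<open>(e + 1) ^ q \<le> \<kappa> ^ q * (D + 1) ^ q = D * (D + 1) ^ q < (D + 1) ^ (q
    + 1)\<close>.\<close>
  obtain c0 where c0: "c0 = (q + 1) * d" by simp
  define \<kappa> where "\<kappa> = c0 + 1"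
  obtain D where D: "D = \<kappa> ^ q" by simp
  define e where "e = c0 * D"
  define U where "U = {..D} \<times> exponents P D"
  define G where "G = (\<lambda>(k, m) w. h w ^ k * monomial_fun P m (\<lambda>p. \<Phi> p w))"
  have "(e + 1) ^ card V \<le> (\<kappa> * (D + 1)) ^ q"
  proof -
    have "e + 1 \<le> \<kappa> * (D + 1)" by (simp add: e_def \<kappa>_def algebra_simps)
    hence "(e + 1) ^ card V \<le> (\<kappa> * (D + 1)) ^ card V" by (rule power_mono) simp
    also have "\<dots> \<le> (\<kappa> * (D + 1)) ^ q"
      by (rule power_increasing) (use card in \<open>auto simp: q \<kappa>_def\<close>)
    finally show ?thesis .
  qed
  also have "\<dots> = D * (D + 1) ^ q" by (simp only: power_mult_distrib D)
  also have "\<dots> < (D + 1) * (D + 1) ^ q" by (rule mult_strict_right_mono) auto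
  also have "\<dots> = card U" by (simp add: U_def card_exponents[OF P] q card_cartesian_product)
  finally have card_less: "card (exponents V e) < card U" using V by (simp add: card_exponents)
  have finU: "finite U" using P by (simp add: U_def finite_exponents)
  have G_deg: "G u \<in> bounded_degree V e" if "u \<in> U" for u
  proof -
    obtain k m where u: "u = (k, m)" "k \<le> D" "m \<in> exponents P D" using \<open>u \<in> U\<close> by (auto simp: U_def)
    have "(\<lambda>w. \<Phi> p w ^ m p) \<in> bounded_degree V (D * d)" if p: "p \<in> P" for p
    proof (rule bounded_degree_mono[OF V bounded_degree_power[OF V d\<Phi>[OF p], of "m p"]])
      have "m p \<le> D" using PiE_mem[OF u(3) p] by simp
      thus "m p * d \<le> D * d" by simp
    qed
    from bounded_degree_prod[OF V P, of "\<lambda>p w. \<Phi> p w ^ m p", OF this]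
    have \<Phi>m: "(\<lambda>w. \<Prod>p\<in>P. \<Phi> p w ^ m p) \<in> bounded_degree V (card P * (D * d))" .
    have hk: "(\<lambda>w. h w ^ k) \<in> bounded_degree V (D * d)"
      by (rule bounded_degree_mono[OF V bounded_degree_power[OF V dh, of k]]) (use u(2) in simp)
    from bounded_degree_mult[OF V hk \<Phi>m]
    have "(\<lambda>w. h w ^ k * (\<Prod>p\<in>P. \<Phi> p w ^ m p)) \<in> bounded_degree V (D * d + card P * (D * d))" .
    moreover have "D * d + card P * (D * d) = e" by (simp add: e_def c0 q algebra_simps)
    ultimately show ?thesis by (simp add: G_def u monomial_fun_def)
  qed

  have "\<exists>c. \<forall>w. G u w = (\<Sum>m\<in>exponents V e. c m * monomial_fun V m w)" if u: "u \<in> U" for u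
  proof -
    from G_deg[OF u] obtain c where "G u = (\<lambda>w. \<Sum>m\<in>exponents V e. c m * monomial_fun V m w)"
      unfolding bounded_degree_def mem_Collect_eq ..
    thus ?thesis by auto
  qed
  hence "\<forall>u\<in>U. \<exists>c. \<forall>w. G u w = (\<Sum>m\<in>exponents V e. c m * monomial_fun V m w)" by blast
  from bchoice[OF this]
  obtain c where c: "\<forall>u\<in>U. \<forall>w. G u w = (\<Sum>m\<in>exponents V e. c u m * monomial_fun V m w)" ..
  from exists_nonzero_kernel[OF finite_exponents[OF V] finU card_less, of "\<lambda>m u. c u m"]
  obtain x where x: "\<exists>u\<in>U. x u \<noteq> 0" "\<forall>m\<in>exponents V e. (\<Sum>u\<in>U. c u m * x u) = 0"
    by (elim exE conjE) (rule that)
  define F where "F = (\<lambda>k a. \<Sum>m\<in>exponents P D. x (k, m) * monomial_fun P m a)"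
  have F_PF: "F k \<in> polynomial_functions P" for k
    unfolding F_def by (intro PF_sum PF_cmult monomial_fun_PF)
  have rel: "(\<Sum>k\<le>D. h w ^ k * F k (\<lambda>p. \<Phi> p w)) = 0" for w
  proof -
    have "(\<Sum>k\<le>D. h w ^ k * F k (\<lambda>p. \<Phi> p w)) = (\<Sum>(k, m)\<in>U. G (k, m) w * x (k, m))"
      unfolding U_def F_def G_def
      by (subst sum.cartesian_product[symmetric]) (simp add: sum_distrib_left mult_ac)
    also have "\<dots> = (\<Sum>u\<in>U. \<Sum>m\<in>exponents V e. c u m * x u * monomial_fun V m w)"
      by (rule sum.cong) (auto simp: c sum_distrib_left mult_ac)
    also have "\<dots> = (\<Sum>m\<in>exponents V e. (\<Sum>u\<in>U. c u m * x u) * monomial_fun V m w)"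
      by (subst sum.swap) (simp add: sum_distrib_right)
    also have "\<dots> = 0" using x(2) by simp
    finally show ?thesis .
  qed
  define nz where "nz = (\<lambda>k. k \<le> D \<and> (\<exists>m\<in>exponents P D. x (k, m) \<noteq> 0))"
  have "\<exists>k. nz k" using x(1) by (auto simp: nz_def U_def)
  define k0 where "k0 = (LEAST k. nz k)"
  have k0: "nz k0" "\<And>k. k < k0 \<Longrightarrow> \<not> nz k"
    using \<open>\<exists>k. nz k\<close> by (auto simp: k0_def intro: LeastI dest: not_less_Least)
  have F0: "\<exists>a. F k0 a \<noteq> 0"
  proof (rule ccontr)
    assume "\<nexists>a. F k0 a \<noteq> 0"
    hence "(\<Sum>m\<in>exponents P D. x (k0, m) * monomial_fun P m a) = 0" for a by (simp add: F_def)
    hence "x (k0, m) = 0" if "m \<in> exponents P D" for m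
      using zero_polynomial_coefficients[OF P _ that, of "\<lambda>m. x (k0, m)"] by blast
    thus False using k0(1) by (auto simp: nz_def)
  qed
  define R where "R = (\<lambda>w. \<Sum>k\<in>{k0..D}. h w ^ (k - k0) * F k (\<lambda>p. \<Phi> p w))"
  have hR: "h w ^ k0 * R w = 0" for w
  proof -
    have "F k a = 0" if "k \<le> D" "k < k0" for k a
      unfolding F_def by (rule sum.neutral) (use k0(2)[OF that(2)] that(1) in \<open>auto simp: nz_def\<close>)
    hence "(\<Sum>k\<le>D. h w ^ k * F k (\<lambda>p. \<Phi> p w)) = (\<Sum>k\<in>{k0..D}. h w ^ k * F k (\<lambda>p. \<Phi> p w))"
      by (intro sum.mono_neutral_right) auto
    also have "\<dots> = h w ^ k0 * R w"
      by (auto simp: R_def sum_distrib_left mult.assoc[symmetric] power_add[symmetric] intro!: sum.cong)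
    finally show ?thesis using rel by simp
  qed
  have R_PF: "R \<in> polynomial_functions V"
    unfolding R_def by (intro PF_sum mult PF_power h(1) PF_subst[OF F_PF] \<Phi>)
  \<comment> \<open>\<open>h ^ k0 * R\<close> vanishes identically and \<open>h\<close> does not, so
    \<open>R\<close> vanishes identically. At a zero of \<open>h\<close> only the term
    \<open>k0\<close> of \<open>R\<close> is left.\<close>
  have R0: "R w = 0" for w
  proof (rule ccontr)
    assume "R w \<noteq> 0"
    then obtain w' where "h w' \<noteq> 0" "R w' \<noteq> 0" using PF_domain[OF h R_PF] by blast
    thus False using hR[of w'] by simp
  qed
  have "F k0 (\<lambda>p. \<Phi> p w) = 0" if "h w = 0" for w
  proof -
    have "R w = (\<Sum>k\<in>{k0..D}. if k = k0 then F k0 (\<lambda>p. \<Phi> p w) else 0)"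
      unfolding R_def by (rule sum.cong) (auto simp: that)
    also have "\<dots> = F k0 (\<lambda>p. \<Phi> p w)" using k0(1) by (simp add: nz_def)
    finally show ?thesis using R0 by simp
  qed
  thus ?thesis using F0 F_PF by blast
qed

subsection \<open>Systems of equations that are linear in their parameters\<close>

lemma pd_eqI: "((\<lambda>t. F (c(v := t))) has_field_derivative D) (at (c v)) \<Longrightarrow> pd v F c = D"
  unfolding pd_def by (rule the_equality) (auto intro: DERIV_unique)

lemma compact_product:
  fixes C :: "nat \<Rightarrow> 'b::topological_space set"
  assumes "\<And>i. compact (C i)"
  shows "compact {x. \<forall>i. x i \<in> C i}"
proof -
  have "compactin (product_topology (\<lambda>_. euclidean) UNIV) (Pi\<^sub>E UNIV C)"
    by (subst compactin_PiE) (use assms in simp)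
  hence "compact (Pi\<^sub>E UNIV C)"
    by (simp add: euclidean_product_topology)
  also have "Pi\<^sub>E UNIV C = {x. \<forall>i. x i \<in> C i}" by (auto simp: PiE_iff)
  finally show ?thesis .
qed

lemma det_nonzero_inverse:
  fixes A :: "complex mat"
  assumes A: "A \<in> carrier_mat n n" and "det A \<noteq> 0"
  shows "\<exists>B\<in>carrier_mat n n. B * A = 1\<^sub>m n \<and> A * B = 1\<^sub>m n"
proof -
  have "A \<in> Units (ring_mat TYPE(complex) n ())"
    by (rule det_non_zero_imp_unit[OF A assms(2)])
  thus ?thesis unfolding Units_def by (auto simp: ring_mat_def)
qed

lemma det_nonzero_inverse_fun:
  fixes J :: "nat \<Rightarrow> nat \<Rightarrow> complex"
  assumes "det (mat n n (\<lambda>(i, j). J i j)) \<noteq> 0"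
  shows "\<exists>M. (\<forall>i<n. \<forall>j<n. (\<Sum>k<n. M i k * J k j) = (if i = j then 1 else 0)) \<and>
             (\<forall>i<n. \<forall>j<n. (\<Sum>k<n. J i k * M k j) = (if i = j then 1 else 0))"
proof -
  let ?A = "mat n n (\<lambda>(i, j). J i j)"
  obtain B where B: "B \<in> carrier_mat n n" "B * ?A = 1\<^sub>m n" "?A * B = 1\<^sub>m n"
    using det_nonzero_inverse[of ?A n] assms by auto
  have "(\<Sum>k<n. B $$ (i, k) * J k j) = (if i = j then 1 else 0)" if "i < n" "j < n" for i j
  proof -
    have "(B * ?A) $$ (i, j) = (\<Sum>k<n. B $$ (i, k) * J k j)"
      using that B(1) by (auto simp: scalar_prod_def atLeast0LessThan intro!: sum.cong)
    thus ?thesis using that B(2) by simp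
  qed
  moreover have "(\<Sum>k<n. J i k * B $$ (k, j)) = (if i = j then 1 else 0)" if "i < n" "j < n" for i j
  proof -
    have "(?A * B) $$ (i, j) = (\<Sum>k<n. J i k * B $$ (k, j))"
      using that B(1) by (auto simp: scalar_prod_def atLeast0LessThan intro!: sum.cong)
    thus ?thesis using that B(3) by simp
  qed
  ultimately show ?thesis by (intro exI[of _ "\<lambda>i k. B $$ (i, k)"]) simp
qed

text \<open>The points range over an arbitrary type, so that the same coefficients \<open>a\<close>
  can be evaluated on affine space, on a compact set of representatives and in boundary charts, just
  by changing the family of functions.\<close>

definition lin_sys ::
  "(nat \<Rightarrow> 'i set) \<Rightarrow> (nat \<Rightarrow> 'i \<Rightarrow> 'c \<Rightarrow> complex) \<Rightarrow> (nat \<times> 'i \<Rightarrow> complex) \<Rightarrow> nat \<Rightarrow> 'c \<Rightarrow> complex" where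
  "lin_sys K \<phi> a e x = (\<Sum>i\<in>K e. a (e, i) * \<phi> e i x)"

text \<open>
  Every equation can be solved for the coefficient of its constant term, so the incidence variety is
  an affine space of the same dimension as the parameter space, and \<open>image_of_hypersurface\<close> applies.
\<close>

lemma incidence_hypersurface:
  fixes K :: "nat \<Rightarrow> 'i set" and \<psi> :: "nat \<Rightarrow> 'i \<Rightarrow> (nat \<Rightarrow> complex) \<Rightarrow> complex" and N :: nat
  defines "P \<equiv> Sigma {..<N} K"
  assumes fin: "\<And>e. e < N \<Longrightarrow> finite (K e)"
    and \<psi>: "\<And>e i. e < N \<Longrightarrow> i \<in> K e \<Longrightarrow> \<psi> e i \<in> polynomial_functions {..<N}"
    and i0: "\<And>e. e < N \<Longrightarrow> i0 e \<in> K e" "\<And>e x. e < N \<Longrightarrow> \<psi> e (i0 e) x = \<kappa> e" "\<And>e. e < N \<Longrightarrow> \<kappa> e \<noteq> 0"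
    and h: "h \<in> polynomial_functions (Inl ` {..<N} \<union> Inr ` P)"
    and nz: "\<And>e. e < N \<Longrightarrow> lin_sys K \<psi> a1 e x1 = 0" "h (case_sum x1 a1) \<noteq> 0"
  shows "\<exists>F\<in>polynomial_functions P. (\<exists>a. F a \<noteq> 0) \<and>
     (\<forall>x a. (\<forall>e<N. lin_sys K \<psi> a e x = 0) \<longrightarrow> h (case_sum x a) = 0 \<longrightarrow> F a = 0)"
proof -
  have finP: "finite P" unfolding P_def using fin by auto
  define P0 where "P0 = (\<lambda>e. (e, i0 e)) ` {..<N}"
  have P0: "P0 \<subseteq> P" "card P0 = N" "finite P0"
    using i0(1) by (auto simp: P0_def P_def card_image inj_on_def)
  define V :: "(nat + nat \<times> 'i) set" where "V = Inl ` {..<N} \<union> Inr ` (P - P0)"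
  have finV: "finite V" using finP by (simp add: V_def)
  have "card V = card (Inl ` {..<N} :: (nat + nat \<times> 'i) set) + card (Inr ` (P - P0) :: (nat + nat \<times> 'i) set)"
    unfolding V_def using finP by (intro card_Un_disjoint) auto
  also have "\<dots> = N + (card P - N)"
    using P0 finP by (simp add: card_image card_Diff_subset)
  also have "N \<le> card P" using card_mono[OF finP P0(1)] P0(2) by simp
  hence "N + (card P - N) = card P" by simp
  finally have cardV: "card V \<le> card P" by simp
  \<comment> \<open>\<open>\<Phi>\<close> parametrizes the incidence variety by the point and all
    coefficients except those at \<open>i0\<close>; the missing coefficient of equation
    \<open>e\<close> is recovered by solving that equation. Both sides of the projection then have
    \<open>card P\<close> variables.\<close>
  define rest where "rest = (\<lambda>e w. \<Sum>i\<in>K e - {i0 e}. w (Inr (e, i)) * \<psi> e i (\<lambda>u. w (Inl u)))"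
  define \<Phi> where "\<Phi> = (\<lambda>(e, i) w. if i = i0 e then (- 1 / \<kappa> e) * rest e w else w (Inr (e, i)))"
  have rest_PF: "rest e \<in> polynomial_functions V" if "e < N" for e
    unfolding rest_def
  proof (intro PF_sum PF_intros(4) PF_subst[OF \<psi>[OF that]])
    fix i assume "i \<in> K e - {i0 e}"
    thus "(\<lambda>w. w (Inr (e, i))) \<in> polynomial_functions V" "i \<in> K e"
      using that by (auto intro!: coord simp: V_def P_def P0_def)
  next
    fix u assume "u \<in> {..<N}"
    thus "(\<lambda>w. w (Inl u)) \<in> polynomial_functions V" by (auto intro!: coord simp: V_def)
  qed
  have \<Phi>_PF: "\<Phi> p \<in> polynomial_functions V" if "p \<in> P" for p
  proof -
    obtain e i where p: "p = (e, i)" "e < N" "i \<in> K e" using \<open>p \<in> P\<close> by (auto simp: P_def)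
    show ?thesis
    proof (cases "i = i0 e")
      case True
      thus ?thesis using PF_cmult[OF rest_PF[OF p(2)], of "- 1 / \<kappa> e"] by (simp add: \<Phi>_def p)
    next
      case False
      hence "Inr p \<in> V" using p by (auto simp: V_def P0_def P_def)
      from coord[OF this] show ?thesis using False by (simp add: \<Phi>_def p)
    qed
  qed
  define h' where "h' = (\<lambda>w. h (\<lambda>q. case q of Inl u \<Rightarrow> w (Inl u) | Inr p \<Rightarrow> \<Phi> p w))"
  have h'_PF: "h' \<in> polynomial_functions V"
    unfolding h'_def
  proof (rule PF_subst[OF h])
    fix q assume "q \<in> Inl ` {..<N} \<union> Inr ` P"
    thus "(\<lambda>w. case q of Inl u \<Rightarrow> w (Inl u) | Inr p \<Rightarrow> \<Phi> p w) \<in> polynomial_functions V"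
    proof (elim UnE imageE)
      fix u assume "q = Inl u" "u \<in> {..<N}"
      thus ?thesis using coord[of "Inl u" V] by (simp add: V_def)
    next
      fix p assume "q = Inr p" "p \<in> P"
      thus ?thesis using \<Phi>_PF[of p] by simp
    qed
  qed
  have \<Phi>_sol: "\<Phi> p (case_sum x a) = a p"
    if "\<forall>e<N. lin_sys K \<psi> a e x = 0" "p \<in> P" for x a p
  proof -
    obtain e i where p: "p = (e, i)" "e < N" "i \<in> K e" using \<open>p \<in> P\<close> by (auto simp: P_def)
    have "lin_sys K \<psi> a e x = a (e, i0 e) * \<kappa> e + rest e (case_sum x a)"
      unfolding lin_sys_def rest_def using fin[OF p(2)] i0(1,2)[OF p(2)]
      by (subst sum.remove[of _ "i0 e"]) auto
    hence "a (e, i0 e) = (- 1 / \<kappa> e) * rest e (case_sum x a)"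
      using that(1) p(2) i0(3)[OF p(2)] by (simp add: field_simps add_eq_0_iff)
    thus ?thesis by (simp add: \<Phi>_def p)
  qed
  have h'_sol: "h' (case_sum x a) = h (case_sum x a)" if "\<forall>e<N. lin_sys K \<psi> a e x = 0" for x a
    unfolding h'_def
  proof (rule PF_cong[OF h])
    fix v :: "nat + nat \<times> 'i" assume v: "v \<in> Inl ` {..<N} \<union> Inr ` P"
    show "(case v of Inl u \<Rightarrow> case_sum x a (Inl u) | Inr p \<Rightarrow> \<Phi> p (case_sum x a)) = case_sum x a v"
      using v \<Phi>_sol[OF that] by (cases v) (simp_all add: image_iff)
  qed
  have "\<forall>e<N. lin_sys K \<psi> a1 e x1 = 0" using nz(1) by blast
  from h'_sol[OF this] nz(2) have "h' (case_sum x1 a1) \<noteq> 0" by metis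
  from image_of_hypersurface[where \<Phi>=\<Phi> and h=h' and ?w0.0="case_sum x1 a1", OF finV finP cardV \<Phi>_PF h'_PF this, simplified]
  obtain F where F: "F \<in> polynomial_functions P" "\<exists>a. F a \<noteq> 0"
    "\<forall>w. h' w = 0 \<longrightarrow> F (\<lambda>p. \<Phi> p w) = 0" by (elim bexE conjE) (rule that)
  show ?thesis
  proof (intro bexI[OF _ F(1)] conjI allI impI F(2))
    fix x a assume sol: "\<forall>e<N. lin_sys K \<psi> a e x = 0" and "h (case_sum x a) = 0"
    hence "F (\<lambda>p. \<Phi> p (case_sum x a)) = 0" using F(3) h'_sol[OF sol] by simp
    moreover have "F (\<lambda>p. \<Phi> p (case_sum x a)) = F a"
      by (rule PF_cong[OF F(1)]) (rule \<Phi>_sol[OF sol])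
    ultimately show "F a = 0" by simp
  qed
qed

text \<open>On the compact set \<open>S\<close> the sum of \<open>cmod (x0 c)\<close> and the
  absolute values of the left hand sides has a positive minimum. A change of the coefficients by
  less than \<delta> changes the left hand sides by at most \<delta> times the maximum of
  \<open>g\<close>, which is at most half of that minimum. With \<open>x0\<close> the equation of
  the boundary this keeps solutions away from infinity; with \<open>x0 = 0\<close> it excludes
  solutions in \<open>S\<close> altogether.\<close>

lemma lin_sys_nonvanishing_near:
  fixes x0 :: "'c::topological_space \<Rightarrow> complex"
  assumes fin: "\<And>e. e < N \<Longrightarrow> finite (K e)"
    and S: "compact S" "continuous_on S x0"
    and q: "\<And>e i. e < N \<Longrightarrow> i \<in> K e \<Longrightarrow> continuous_on S (q e i)"
    and nv: "\<And>c. c \<in> S \<Longrightarrow> x0 c = 0 \<Longrightarrow> \<exists>e<N. lin_sys K q a0 e c \<noteq> 0"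
  shows "\<exists>\<mu>>0. \<forall>\<^sub>F a in nhds a0. \<forall>c\<in>S. (\<forall>e<N. lin_sys K q a e c = 0) \<longrightarrow> cmod (x0 c) \<ge> \<mu>"
proof (cases "S = {}")
  case False
  define P where "P = Sigma {..<N} K"
  have finP: "finite P" unfolding P_def using fin by auto
  define f where "f = (\<lambda>c. cmod (x0 c) + (\<Sum>e<N. cmod (lin_sys K q a0 e c)))"
  define g where "g = (\<lambda>c. \<Sum>(e, i)\<in>P. cmod (q e i c))"
  have "continuous_on S f"
    unfolding f_def lin_sys_def by (intro continuous_intros S q) auto
  then obtain c0 where c0: "c0 \<in> S" "\<And>c. c \<in> S \<Longrightarrow> f c0 \<le> f c"
    using continuous_attains_inf[OF S(1) False] by blast
  have f_nonneg: "(\<Sum>e<N. cmod (lin_sys K q a0 e c0)) \<ge> 0" by (intro sum_nonneg) simp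
  have "f c0 > 0"
  proof (cases "x0 c0 = 0")
    case True
    then obtain e where "e < N" "lin_sys K q a0 e c0 \<noteq> 0" using nv c0(1) by blast
    hence "(\<Sum>e<N. cmod (lin_sys K q a0 e c0)) > 0" by (intro sum_pos2[of _ e]) auto
    thus ?thesis by (simp add: f_def add_nonneg_pos)
  next
    case False
    thus ?thesis using f_nonneg by (simp add: f_def add_pos_nonneg)
  qed
  have "continuous_on S g"
    unfolding g_def P_def by (intro continuous_intros) (auto intro!: continuous_intros q)
  then obtain c1 where c1: "c1 \<in> S" "\<And>c. c \<in> S \<Longrightarrow> g c \<le> g c1"
    using continuous_attains_sup[OF S(1) False] by blast
  have g1: "g c1 \<ge> 0" unfolding g_def by (intro sum_nonneg) auto
  define \<mu> where "\<mu> = f c0 / 2"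
  define \<delta> where "\<delta> = \<mu> / (g c1 + 1)"
  have \<mu>: "\<mu> > 0" and \<delta>: "\<delta> > 0" using \<open>f c0 > 0\<close> g1 by (auto simp: \<mu>_def \<delta>_def)
  show ?thesis
  proof (intro exI[of _ \<mu>] conjI \<mu> eventually_mono[OF eventually_nhds_coordinates[OF finP \<delta>, of a0]] ballI impI)
    fix a c
    assume a: "\<forall>p\<in>P. cmod (a p - a0 p) < \<delta>" and c: "c \<in> S" and z: "\<forall>e<N. lin_sys K q a e c = 0"
    have "(\<Sum>e<N. cmod (lin_sys K q a0 e c)) = (\<Sum>e<N. cmod (\<Sum>i\<in>K e. (a0 (e, i) - a (e, i)) * q e i c))"
      using z by (intro sum.cong) (auto simp: lin_sys_def left_diff_distrib sum_subtractf)
    also have "\<dots> \<le> (\<Sum>e<N. \<Sum>i\<in>K e. \<delta> * cmod (q e i c))"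
    proof (intro sum_mono sum_norm_le)
      fix e i assume "e \<in> {..<N}" "i \<in> K e"
      hence "cmod (a0 (e, i) - a (e, i)) \<le> \<delta>"
        using a by (force simp: P_def norm_minus_commute intro: less_imp_le)
      thus "norm ((a0 (e, i) - a (e, i)) * q e i c) \<le> \<delta> * cmod (q e i c)"
        by (simp add: norm_mult mult_right_mono)
    qed
    also have "\<dots> = \<delta> * g c"
      unfolding g_def P_def by (subst sum.Sigma[symmetric]) (use fin in \<open>auto simp: sum_distrib_left\<close>)
    also have "\<dots> \<le> \<delta> * g c1" using c1(2)[OF c] \<delta> by simp
    also have "\<dots> \<le> \<mu>" using g1 \<mu> by (simp add: \<delta>_def field_simps)
    finally have "f c \<le> cmod (x0 c) + \<mu>" by (simp add: f_def)
    thus "\<mu> \<le> cmod (x0 c)" using c0(2)[OF c] by (simp add: \<mu>_def)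
  qed
qed (auto intro: exI[of _ 1])

locale linear_system =
  fixes N :: nat and K :: "nat \<Rightarrow> 'i set" and \<phi> :: "nat \<Rightarrow> 'i \<Rightarrow> (nat \<Rightarrow> complex) \<Rightarrow> complex"
  assumes finite_K: "e < N \<Longrightarrow> finite (K e)"
    and \<phi>_PF: "e < N \<Longrightarrow> i \<in> K e \<Longrightarrow> \<phi> e i \<in> polynomial_functions {..<N}"
begin

abbreviation params :: "(nat \<times> 'i) set" where
  "params \<equiv> Sigma {..<N} K"

text \<open>The coordinates from \<open>N\<close> on are fixed to \<open>0\<close>, so that every
  point of affine space is represented by just one function and the zeros can be counted.\<close>

definition zeros :: "(nat \<times> 'i \<Rightarrow> complex) \<Rightarrow> (nat \<Rightarrow> complex) set" where
  "zeros a = {x. (\<forall>u\<ge>N. x u = 0) \<and> (\<forall>e<N. lin_sys K \<phi> a e x = 0)}"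

definition jacobian :: "(nat \<times> 'i \<Rightarrow> complex) \<Rightarrow> (nat \<Rightarrow> complex) \<Rightarrow> complex" where
  "jacobian a x = det (mat N N (\<lambda>(e, u). pd u (lin_sys K \<phi> a e) x))"

lemma finite_params: "finite params"
  using finite_K by auto

lemma lin_sys_PF: "e < N \<Longrightarrow> lin_sys K \<phi> a e \<in> polynomial_functions {..<N}"
  unfolding lin_sys_def by (intro PF_sum PF_cmult \<phi>_PF)

lemma pd_lin_sys:
  assumes "e < N" "u < N"
  shows "pd u (lin_sys K \<phi> a e) x = (\<Sum>i\<in>K e. a (e, i) * pd u (\<phi> e i) x)"
  unfolding lin_sys_def
  by (intro pd_eqI DERIV_sum DERIV_cmult PF_has_deriv[of "{..<N}"] \<phi>_PF) (use assms in auto)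

definition polydisc :: "(nat \<Rightarrow> complex) \<Rightarrow> real \<Rightarrow> (nat \<Rightarrow> complex) set" where
  "polydisc z r = {x. (\<forall>u<N. cmod (x u - z u) \<le> r) \<and> (\<forall>u\<ge>N. x u = 0)}"

lemma compact_polydisc: "compact (polydisc z r)"
proof -
  have "polydisc z r = {x. \<forall>u. x u \<in> (if u < N then cball (z u) r else {0})}"
    unfolding polydisc_def
  proof (intro Collect_cong iffI allI conjI impI)
    fix x u assume "(\<forall>u<N. cmod (x u - z u) \<le> r) \<and> (\<forall>u\<ge>N. x u = 0)"
    thus "x u \<in> (if u < N then cball (z u) r else {0})"
      by (cases "u < N") (simp_all add: dist_norm norm_minus_commute[of "z u"])
  next
    fix x u assume *: "\<forall>u. x u \<in> (if u < N then cball (z u) r else {0})"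
    { assume "u < N"
      thus "cmod (x u - z u) \<le> r" using spec[OF *, of u] by (simp add: dist_norm norm_minus_commute[of "z u"]) }
    { assume "u \<ge> N"
      thus "x u = 0" using spec[OF *, of u] by simp }
  qed
  also have "compact \<dots>" by (rule compact_product) auto
  finally show ?thesis .
qed

text \<open>Implicit function theorem by a simplified Newton map: \<open>T a\<close> subtracts from
  \<open>x\<close> the inverse Jacobian \<open>M\<close> at \<open>z\<close>, applied to the left
  hand sides. It maps the polydisc into itself and halves the sum of coordinate distances. All radii
  up to \<eta> are covered, because the counting argument later shrinks the polydiscs until they are
  disjoint.\<close>

lemma unique_zero_near:
  assumes z: "z \<in> zeros a0" and nondeg: "jacobian a0 z \<noteq> 0"
  shows "\<exists>\<eta>>0. \<forall>r. 0 < r \<longrightarrow> r \<le> \<eta> \<longrightarrow> (\<forall>\<^sub>F a in nhds a0. \<exists>!x. x \<in> polydisc z r \<and> x \<in> zeros a)"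
proof -
  let ?J = "\<lambda>e u. pd u (lin_sys K \<phi> a0 e) z"
  from det_nonzero_inverse_fun[OF nondeg[unfolded jacobian_def]]
  obtain M where M': "\<forall>i<N. \<forall>j<N. (\<Sum>k<N. M i k * ?J k j) = (if i = j then 1 else 0)"
    "\<forall>i<N. \<forall>j<N. (\<Sum>k<N. ?J i k * M k j) = (if i = j then 1 else 0)"
    by (elim exE conjE) (rule that)
  note M = M'(1)[rule_format] M'(2)[rule_format]
  have "\<forall>p\<in>params. \<exists>Q. (\<forall>v. Q v \<in> polynomial_functions (Inl ` {..<N} \<union> Inr ` {..<N})) \<and>
     (\<forall>x y. \<phi> (fst p) (snd p) x - \<phi> (fst p) (snd p) y = (\<Sum>v<N. Q v (case_sum x y) * (x v - y v)))"
  proof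
    fix p assume "p \<in> params"
    hence "fst p < N" "snd p \<in> K (fst p)" by auto
    from PF_hadamard[OF finite_lessThan[of N] \<phi>_PF[OF this]]
    show "\<exists>Q. (\<forall>v. Q v \<in> polynomial_functions (Inl ` {..<N} \<union> Inr ` {..<N})) \<and>
     (\<forall>x y. \<phi> (fst p) (snd p) x - \<phi> (fst p) (snd p) y = (\<Sum>v<N. Q v (case_sum x y) * (x v - y v)))" .
  qed
  from bchoice[OF this] obtain Q' where Q': "\<forall>p\<in>params. (\<forall>v. Q' p v \<in> polynomial_functions (Inl ` {..<N} \<union> Inr ` {..<N})) \<and>
     (\<forall>x y. \<phi> (fst p) (snd p) x - \<phi> (fst p) (snd p) y = (\<Sum>v<N. Q' p v (case_sum x y) * (x v - y v)))" ..
  define Q where "Q = (\<lambda>e i. Q' (e, i))"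
  have Q_PF: "Q e i v \<in> polynomial_functions (Inl ` {..<N} \<union> Inr ` {..<N})"
    and Q: "\<phi> e i x - \<phi> e i y = (\<Sum>v<N. Q e i v (case_sum x y) * (x v - y v))"
    if "e < N" "i \<in> K e" for e i v x y
  proof -
    have "(e, i) \<in> params" using that by simp
    from bspec[OF Q' this]
    show "Q e i v \<in> polynomial_functions (Inl ` {..<N} \<union> Inr ` {..<N})"
      "\<phi> e i x - \<phi> e i y = (\<Sum>v<N. Q e i v (case_sum x y) * (x v - y v))"
      by (simp_all only: Q_def fst_conv snd_conv)
  qed
  have Q_diag: "Q e i v (case_sum x x) = pd v (\<phi> e i) x" if "e < N" "i \<in> K e" "v < N" for e i v x
    by (rule hadamard_deriv(2)[where V="{..<N}" and Q="Q e i" and F="\<phi> e i", symmetric, OF _ _ Q_PF Q])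
      (use that in simp_all)
  define W :: "((nat + nat) + nat \<times> 'i) set" where "W = Inl ` (Inl ` {..<N} \<union> Inr ` {..<N}) \<union> Inr ` params"
  have finW: "finite W" using finite_params by (simp add: W_def)
  \<comment> \<open>The matrix of difference quotients of \<open>T\<close>, as a polynomial in two
    points and the parameters. It vanishes at \<open>w0\<close>, where both points are
    \<open>z\<close> and the parameters are \<open>a0\<close>, and is therefore small
    nearby.\<close>
  define R where "R = (\<lambda>u v w. (if u = v then 1 else 0) - (\<Sum>e<N. M u e *
      (\<Sum>i\<in>K e. w (Inr (e, i)) * Q e i v (\<lambda>s. w (Inl s)))))"
  have R_PF: "R u v \<in> polynomial_functions W" for u v
    unfolding R_def
    by (intro PF_diff const PF_sum PF_cmult mult coord PF_subst[OF Q_PF]) (auto simp: W_def)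
  define w0 where "w0 = case_sum (case_sum z z) a0"
  have R0: "R u v w0 = 0" if uv: "u < N" "v < N" for u v
  proof -
    have "(\<Sum>e<N. M u e * (\<Sum>i\<in>K e. w0 (Inr (e, i)) * Q e i v (\<lambda>s. w0 (Inl s)))) = (\<Sum>e<N. M u e * ?J e v)"
    proof (intro sum.cong refl arg_cong[of _ _ "\<lambda>t. _ * t"])
      fix e assume e: "e \<in> {..<N}"
      have w0: "(\<lambda>s. w0 (Inl s)) = case_sum z z" by (auto simp: w0_def)
      show "(\<Sum>i\<in>K e. w0 (Inr (e, i)) * Q e i v (\<lambda>s. w0 (Inl s))) = ?J e v"
        unfolding w0 using e uv by (subst pd_lin_sys) (auto simp: w0_def Q_diag intro!: sum.cong)
    qed
    also have "\<dots> = (if u = v then 1 else 0)" using M(1) that by simp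
    finally show ?thesis by (simp add: R_def)
  qed
  define \<epsilon> where "\<epsilon> = 1 / (2 * (real N + 1))"
  have \<epsilon>: "\<epsilon> > 0" "N * \<epsilon> \<le> 1 / 2" by (auto simp: \<epsilon>_def field_simps)
  have "\<forall>\<^sub>F w in nhds w0. \<forall>p\<in>{..<N} \<times> {..<N}. cmod (R (fst p) (snd p) w) < \<epsilon>"
  proof (rule eventually_ball_finite, simp, rule ballI)
    fix p assume "p \<in> {..<N} \<times> {..<N}"
    hence "R (fst p) (snd p) w0 = 0" using R0 by auto
    hence "(R (fst p) (snd p) \<longlongrightarrow> 0) (nhds w0)" using PF_tendsto[OF R_PF, of "fst p" "snd p" w0] by simp
    thus "\<forall>\<^sub>F w in nhds w0. cmod (R (fst p) (snd p) w) < \<epsilon>" using \<epsilon>(1) by (auto simp: tendsto_iff)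
  qed
  note ev = this
  have "\<exists>\<eta>>0. \<forall>w. (\<forall>v\<in>W. cmod (w v - w0 v) \<le> \<eta>) \<longrightarrow> (\<forall>p\<in>{..<N} \<times> {..<N}. cmod (R (fst p) (snd p) w) < \<epsilon>)"
  proof (rule nhds_coordinatewise[OF ev finW])
    fix b b' :: "(nat + nat) + nat \<times> 'i \<Rightarrow> complex"
    assume "\<forall>v\<in>W. b v = b' v"
    hence "R u v b = R u v b'" for u v by (intro PF_cong[OF R_PF]) simp
    moreover assume "\<forall>p\<in>{..<N} \<times> {..<N}. cmod (R (fst p) (snd p) b) < \<epsilon>"
    ultimately show "\<forall>p\<in>{..<N} \<times> {..<N}. cmod (R (fst p) (snd p) b') < \<epsilon>" by simp
  qed
  then obtain \<eta> where \<eta>0: "\<eta> > 0" and \<eta>1: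
    "\<forall>w. (\<forall>v\<in>W. cmod (w v - w0 v) \<le> \<eta>) \<longrightarrow> (\<forall>p\<in>{..<N} \<times> {..<N}. cmod (R (fst p) (snd p) w) < \<epsilon>)"
    by (elim exE conjE) (rule that)
  have \<eta>: "\<eta> > 0"
    "\<And>w u v. (\<And>t. t \<in> W \<Longrightarrow> cmod (w t - w0 t) \<le> \<eta>) \<Longrightarrow> u < N \<Longrightarrow> v < N \<Longrightarrow> cmod (R u v w) < \<epsilon>"
    using \<eta>1 by (auto intro: \<eta>0)
  define T where "T = (\<lambda>a x u. if u < N then x u - (\<Sum>e<N. M u e * lin_sys K \<phi> a e x) else 0)"
  have T_fix: "x \<in> zeros a \<longleftrightarrow> (\<forall>u. T a x u = x u)" if "x \<in> polydisc z r" for x a r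
  proof
    assume x: "\<forall>u. T a x u = x u"
    hence M0: "(\<Sum>e<N. M u e * lin_sys K \<phi> a e x) = 0" if "u < N" for u
      using that by (auto simp: T_def dest!: spec[of _ u])
    have "lin_sys K \<phi> a e x = 0" if e: "e < N" for e
    proof -
      have "lin_sys K \<phi> a e x = (\<Sum>e'<N. if e = e' then lin_sys K \<phi> a e' x else 0)" using e by simp
      also have "\<dots> = (\<Sum>e'<N. (\<Sum>u<N. ?J e u * M u e') * lin_sys K \<phi> a e' x)"
        by (intro sum.cong refl, subst M(2)) (use e in auto)
      also have "\<dots> = (\<Sum>e'<N. \<Sum>u<N. ?J e u * (M u e' * lin_sys K \<phi> a e' x))"
        by (simp only: sum_distrib_right mult.assoc)
      also have "\<dots> = (\<Sum>u<N. \<Sum>e'<N. ?J e u * (M u e' * lin_sys K \<phi> a e' x))"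
        by (rule sum.swap)
      also have "\<dots> = (\<Sum>u<N. ?J e u * (\<Sum>e'<N. M u e' * lin_sys K \<phi> a e' x))"
        by (simp only: sum_distrib_left)
      finally show ?thesis using M0 by simp
    qed
    thus "x \<in> zeros a" using that by (auto simp: zeros_def polydisc_def)
  qed (auto simp: zeros_def T_def)
  have T_diff: "cmod (T a x u - T a y u) \<le> \<epsilon> * (\<Sum>v<N. cmod (x v - y v))"
    if a: "\<forall>p\<in>params. cmod (a p - a0 p) < \<eta>" and x: "x \<in> polydisc z \<eta>" and y: "y \<in> polydisc z \<eta>" and u: "u < N"
    for a x y u
  proof -
    define w where "w = case_sum (case_sum x y) a"
    have w: "(\<lambda>s. w (Inl s)) = case_sum x y" "\<And>p. w (Inr p) = a p" by (auto simp: w_def)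
    have R: "cmod (R u v w) < \<epsilon>" if "v < N" for v
    proof (rule \<eta>(2)[OF _ u that])
      fix t assume "t \<in> W"
      thus "cmod (w t - w0 t) \<le> \<eta>"
        using a x y unfolding W_def w_def w0_def polydisc_def by (auto intro: less_imp_le)
    qed
    define C where "C = (\<lambda>e v. \<Sum>i\<in>K e. a (e, i) * Q e i v (case_sum x y))"
    have sys_diff: "lin_sys K \<phi> a e x - lin_sys K \<phi> a e y = (\<Sum>v<N. C e v * (x v - y v))"
      if "e < N" for e
    proof -
      have "lin_sys K \<phi> a e x - lin_sys K \<phi> a e y = (\<Sum>i\<in>K e. a (e, i) * (\<phi> e i x - \<phi> e i y))"
        by (simp add: lin_sys_def sum_subtractf right_diff_distrib)
      also have "\<dots> = (\<Sum>i\<in>K e. \<Sum>v<N. a (e, i) * Q e i v (case_sum x y) * (x v - y v))"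
        by (intro sum.cong refl) (simp add: Q[OF that] sum_distrib_left mult.assoc)
      also have "\<dots> = (\<Sum>v<N. \<Sum>i\<in>K e. a (e, i) * Q e i v (case_sum x y) * (x v - y v))"
        by (rule sum.swap)
      finally show ?thesis by (simp only: C_def sum_distrib_right)
    qed
    have "(\<Sum>e<N. M u e * (lin_sys K \<phi> a e x - lin_sys K \<phi> a e y)) =
       (\<Sum>e<N. \<Sum>v<N. M u e * C e v * (x v - y v))"
      by (intro sum.cong refl) (simp add: sys_diff sum_distrib_left mult.assoc)
    also have "\<dots> = (\<Sum>v<N. \<Sum>e<N. M u e * C e v * (x v - y v))"
      by (rule sum.swap)
    also have "\<dots> = (\<Sum>v<N. ((if u = v then 1 else 0) - R u v w) * (x v - y v))"
    proof (intro sum.cong refl)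
      fix v
      have "(if u = v then 1 else 0) - R u v w = (\<Sum>e<N. M u e * C e v)"
        by (simp only: R_def w C_def diff_diff_eq2 add_diff_cancel_left')
      thus "(\<Sum>e<N. M u e * C e v * (x v - y v)) = ((if u = v then 1 else 0) - R u v w) * (x v - y v)"
        by (simp only: sum_distrib_right)
    qed
    also have "\<dots> = (\<Sum>v<N. (if u = v then x v - y v else 0) - R u v w * (x v - y v))"
      by (intro sum.cong) (auto simp: left_diff_distrib)
    also have "\<dots> = (x u - y u) - (\<Sum>v<N. R u v w * (x v - y v))"
      using u by (simp add: sum_subtractf)
    finally have *: "(\<Sum>e<N. M u e * (lin_sys K \<phi> a e x - lin_sys K \<phi> a e y)) =
      (x u - y u) - (\<Sum>v<N. R u v w * (x v - y v))" .
    have "T a x u - T a y u = (x u - y u) - (\<Sum>e<N. M u e * (lin_sys K \<phi> a e x - lin_sys K \<phi> a e y))"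
      using u by (simp add: T_def right_diff_distrib sum_subtractf)
    also have "\<dots> = (\<Sum>v<N. R u v w * (x v - y v))" unfolding * by simp
    finally have "cmod (T a x u - T a y u) \<le> (\<Sum>v<N. cmod (R u v w * (x v - y v)))"
      by (simp add: norm_sum)
    also have "\<dots> \<le> (\<Sum>v<N. \<epsilon> * cmod (x v - y v))"
      unfolding norm_mult by (intro sum_mono mult_right_mono) (use R in \<open>auto intro: less_imp_le\<close>)
    finally show ?thesis by (simp add: sum_distrib_left)
  qed
  show ?thesis
  proof (intro exI[of _ \<eta>] conjI \<eta>(1) allI impI)
    fix r :: real assume r: "0 < r" "r \<le> \<eta>"
    have sub: "polydisc z r \<subseteq> polydisc z \<eta>" using r by (force simp: polydisc_def)
    have z_in: "z \<in> polydisc z r" using z r by (auto simp: polydisc_def zeros_def)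
    have Tz: "\<forall>\<^sub>F a in nhds a0. \<forall>u\<in>{..<N}. cmod (T a z u - z u) < r / 2"
    proof (rule eventually_ball_finite, simp, rule ballI)
      fix u assume u: "u \<in> {..<N}"
      have "(\<lambda>a. (\<Sum>e<N. M u e * lin_sys K \<phi> a e z)) \<in> polynomial_functions params"
        unfolding lin_sys_def by (intro PF_sum PF_cmult) (auto intro!: PF_intros)
      from PF_tendsto[OF this, of a0]
      have "((\<lambda>a. (\<Sum>e<N. M u e * lin_sys K \<phi> a e z)) \<longlongrightarrow> 0) (nhds a0)"
        using z by (simp add: zeros_def)
      thus "\<forall>\<^sub>F a in nhds a0. cmod (T a z u - z u) < r / 2"
        using r(1) u by (auto simp: tendsto_iff T_def simp del: less_divide_eq_numeral1)
    qed
    show "\<forall>\<^sub>F a in nhds a0. \<exists>!x. x \<in> polydisc z r \<and> x \<in> zeros a"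
      using Tz eventually_nhds_coordinates[OF finite_params \<eta>(1), of a0]
    proof eventually_elim
      case (elim a)
      have contr: "cmod (T a x u - T a y u) \<le> \<epsilon> * (\<Sum>v<N. cmod (x v - y v))"
        if "x \<in> polydisc z r" "y \<in> polydisc z r" "u < N" for x y u
        by (rule T_diff[OF elim(2) subsetD[OF sub that(1)] subsetD[OF sub that(2)] that(3)])
      have into: "T a x \<in> polydisc z r" if x: "x \<in> polydisc z r" for x
      proof -
        have "cmod (T a x u - z u) \<le> r" if u: "u < N" for u
        proof -
          have "(\<Sum>v<N. cmod (x v - z v)) \<le> (\<Sum>v<N. r)" using x by (intro sum_mono) (auto simp: polydisc_def)
          hence "\<epsilon> * (\<Sum>v<N. cmod (x v - z v)) \<le> \<epsilon> * (N * r)" using \<epsilon>(1) by (intro mult_left_mono) auto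
          also have "\<dots> = (N * \<epsilon>) * r" by simp
          also have "\<dots> \<le> 1 / 2 * r" using \<epsilon>(2) r(1) by (intro mult_right_mono) auto
          finally have "cmod (T a x u - T a z u) \<le> r / 2" using contr[OF x z_in u] by simp
          moreover have "cmod (T a z u - z u) < r / 2" using elim(1) u by simp
          ultimately show ?thesis
            using norm_triangle_ineq[of "T a x u - T a z u" "T a z u - z u"] by simp
        qed
        thus ?thesis by (auto simp: polydisc_def T_def)
      qed
      \<comment> \<open>A fixed point is obtained by compactness instead of iteration: at a minimum
        of \<open>\<Psi>\<close>, applying \<open>T a\<close> would halve the value, so the minimum
        is \<open>0\<close>.\<close>
      define \<Psi> where "\<Psi> = (\<lambda>x. \<Sum>u<N. cmod (T a x u - x u))"
      have "continuous_on (polydisc z r) (\<lambda>x. T a x u - x u)" if "u < N" for u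
      proof -
        have "(\<lambda>x. x u - (\<Sum>e<N. M u e * lin_sys K \<phi> a e x) - x u) \<in> polynomial_functions {..<N}"
          using that by (intro PF_diff coord PF_sum PF_cmult lin_sys_PF) auto
        thus ?thesis using that by (simp add: T_def PF_continuous)
      qed
      hence "continuous_on (polydisc z r) \<Psi>"
        unfolding \<Psi>_def by (intro continuous_on_sum continuous_on_norm) auto
      from continuous_attains_inf[OF compact_polydisc _ this] z_in
      obtain x where x: "x \<in> polydisc z r" "\<And>y. y \<in> polydisc z r \<Longrightarrow> \<Psi> x \<le> \<Psi> y"
        by auto
      have half: "(\<Sum>u<N. cmod (T a x u - T a y u)) \<le> 1 / 2 * (\<Sum>v<N. cmod (x v - y v))"
        if "x \<in> polydisc z r" "y \<in> polydisc z r" for x y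
      proof -
        have "(\<Sum>u<N. cmod (T a x u - T a y u)) \<le> (\<Sum>u<N. \<epsilon> * (\<Sum>v<N. cmod (x v - y v)))"
          by (intro sum_mono contr that) auto
        also have "\<dots> = (N * \<epsilon>) * (\<Sum>v<N. cmod (x v - y v))" by simp
        also have "\<dots> \<le> 1 / 2 * (\<Sum>v<N. cmod (x v - y v))"
          using \<epsilon>(2) by (intro mult_right_mono sum_nonneg) auto
        finally show ?thesis .
      qed
      have zero_iff: "(\<Sum>u<N. cmod (f u)) \<le> 0 \<longleftrightarrow> (\<forall>u<N. f u = 0)" for f :: "nat \<Rightarrow> complex"
      proof -
        have "0 \<le> (\<Sum>u<N. cmod (f u))" by (intro sum_nonneg) auto
        hence "(\<Sum>u<N. cmod (f u)) \<le> 0 \<longleftrightarrow> (\<Sum>u<N. cmod (f u)) = 0" by linarith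
        also have "\<dots> \<longleftrightarrow> (\<forall>u<N. f u = 0)" by (subst sum_nonneg_eq_0_iff) auto
        finally show ?thesis .
      qed
      have "\<Psi> x \<le> \<Psi> (T a x)" using x into by blast
      also have "\<dots> \<le> 1 / 2 * \<Psi> x" unfolding \<Psi>_def using half[OF into[OF x(1)] x(1)] .
      finally have "\<Psi> x \<le> 0" by simp
      hence "\<forall>u<N. T a x u = x u" unfolding \<Psi>_def zero_iff by simp
      moreover have "T a x u = x u" if "\<not> u < N" for u using x(1) that by (simp add: T_def polydisc_def)
      ultimately have x_zero: "x \<in> zeros a" using T_fix[OF x(1)] by blast
      show ?case
      proof (rule ex1I[of _ x])
        fix y assume y: "y \<in> polydisc z r \<and> y \<in> zeros a"
        have "(\<Sum>v<N. cmod (x v - y v)) \<le> 1 / 2 * (\<Sum>v<N. cmod (x v - y v))"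
          using half[OF x(1), of y] y x_zero T_fix[OF x(1), of a] T_fix[of y r a] by simp
        hence *: "\<forall>u<N. x u - y u = 0" using zero_iff[of "\<lambda>u. x u - y u"] by simp
        show "y = x"
        proof
          fix u
          show "y u = x u"
            using y x(1) * by (cases "u < N") (simp_all add: polydisc_def)
        qed
      qed (use x(1) x_zero in simp)
    qed
  qed
qed

end

section \<open>Conservation of number\<close>

context linear_system
begin

definition locally_bounded :: "(nat \<times> 'i \<Rightarrow> complex) \<Rightarrow> bool" where
  "locally_bounded a0 \<longleftrightarrow> (\<exists>R. \<forall>\<^sub>F a in nhds a0. \<forall>x\<in>zeros a. \<forall>u<N. cmod (x u) \<le> R)"

definition regular :: "(nat \<times> 'i \<Rightarrow> complex) \<Rightarrow> bool" where
  "regular a \<longleftrightarrow> (\<forall>z\<in>zeros a. jacobian a z \<noteq> 0)"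

lemma continuous_on_coord: "continuous_on S (\<lambda>x :: nat \<Rightarrow> complex. x u)"
  by (rule continuous_on_subset[OF continuous_on_product_coordinates]) simp

lemma continuous_lin_sys: "e < N \<Longrightarrow> continuous_on S (lin_sys K \<phi> a e)"
  by (rule PF_continuous[OF lin_sys_PF])

lemma closed_zeros: "closed (zeros a)"
proof -
  have "closed {x :: nat \<Rightarrow> complex. x u = 0}" for u
    using closed_Collect_eq[OF continuous_on_coord[of UNIV u] continuous_on_const[of UNIV 0]] by simp
  moreover have "closed {x. lin_sys K \<phi> a e x = 0}" if "e < N" for e
    using closed_Collect_eq[OF continuous_lin_sys[OF that] continuous_on_const[of UNIV 0]] by simp
  ultimately have "closed ((\<Inter>u\<in>{N..}. {x. x u = 0}) \<inter> (\<Inter>e\<in>{..<N}. {x. lin_sys K \<phi> a e x = 0}))"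
    by (intro closed_Int closed_INT) auto
  also have "\<dots> = zeros a" by (auto simp: zeros_def)
  finally show ?thesis .
qed

text \<open>For parameters near \<open>a0\<close> each small polydisc around a zero of
  \<open>a0\<close> contains exactly one zero, and the compact remainder \<open>S\<close> of the
  bounding polydisc contains none. This gives a bijection between the zeros.\<close>

lemma card_zeros_locally_constant:
  assumes bdd: "locally_bounded a0" and reg: "regular a0"
  shows "finite (zeros a0)" "\<forall>\<^sub>F a in nhds a0. card (zeros a) = card (zeros a0)"
proof -
  obtain R where R: "\<forall>\<^sub>F a in nhds a0. \<forall>x\<in>zeros a. \<forall>u<N. cmod (x u) \<le> R"
    using bdd unfolding locally_bounded_def ..
  have "\<forall>z\<in>zeros a0. \<exists>\<eta>. \<eta> > 0 \<and> (\<forall>r. 0 < r \<longrightarrow> r \<le> \<eta> \<longrightarrow>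
      (\<forall>\<^sub>F a in nhds a0. \<exists>!x. x \<in> polydisc z r \<and> x \<in> zeros a))"
    using unique_zero_near reg unfolding regular_def by simp
  from bchoice[OF this] obtain \<eta> where \<eta>: "\<forall>z\<in>zeros a0. \<eta> z > 0 \<and> (\<forall>r. 0 < r \<longrightarrow> r \<le> \<eta> z \<longrightarrow>
      (\<forall>\<^sub>F a in nhds a0. \<exists>!x. x \<in> polydisc z r \<and> x \<in> zeros a))" ..
  have center: "z \<in> polydisc z r" if "z \<in> zeros a" "r > 0" for z r a
    using that by (simp add: polydisc_def zeros_def)
  have isolated: "z' = z" if z: "z \<in> zeros a0" "z' \<in> zeros a0" "z' \<in> polydisc z (\<eta> z)" for z z'
  proof -
    have pos: "\<eta> z > 0" using \<eta> z(1) by simp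
    have "\<forall>\<^sub>F a in nhds a0. \<exists>!x. x \<in> polydisc z (\<eta> z) \<and> x \<in> zeros a" using \<eta> z(1) pos by simp
    from eventually_nhds_x_imp_x[OF this]
    have "\<exists>!x. x \<in> polydisc z (\<eta> z) \<and> x \<in> zeros a0" .
    thus ?thesis using z center[OF z(1) pos] by (elim ex1E) metis
  qed
  define opd where "opd = (\<lambda>z r. {x :: nat \<Rightarrow> complex. \<forall>u<N. cmod (x u - z u) < r})"
  have open_opd: "open (opd z r)" for z r
  proof -
    have "open {x :: nat \<Rightarrow> complex. cmod (x u - z u) < r}" for u
      by (intro open_Collect_less continuous_intros continuous_on_coord)
    hence "open (\<Inter>u\<in>{..<N}. {x :: nat \<Rightarrow> complex. cmod (x u - z u) < r})"
      by (intro open_INT) auto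
    also have "(\<Inter>u\<in>{..<N}. {x :: nat \<Rightarrow> complex. cmod (x u - z u) < r}) = opd z r"
      by (auto simp: opd_def)
    finally show ?thesis .
  qed
  have opd_sub: "x \<in> polydisc z r" if "x \<in> opd z r" "x \<in> zeros a" for x z r a
    using that by (auto simp: opd_def polydisc_def zeros_def less_imp_le)
  have zeros_bounded: "zeros a \<subseteq> polydisc (\<lambda>_. 0) R" if "\<forall>x\<in>zeros a. \<forall>u<N. cmod (x u) \<le> R" for a
    using that by (auto simp: polydisc_def zeros_def)
  have "compact (zeros a0)"
  proof -
    have "compact (polydisc (\<lambda>_. 0) R \<inter> zeros a0)"
      by (intro compact_Int_closed compact_polydisc closed_zeros)
    also have "polydisc (\<lambda>_. 0) R \<inter> zeros a0 = zeros a0"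
      using zeros_bounded[OF eventually_nhds_x_imp_x[OF R]] by blast
    finally show ?thesis .
  qed
  moreover have "zeros a0 \<subseteq> (\<Union>z\<in>zeros a0. opd z (\<eta> z))"
    using \<eta> by (auto simp: opd_def)
  ultimately obtain T where T: "T \<subseteq> zeros a0" "finite T" "zeros a0 \<subseteq> (\<Union>z\<in>T. opd z (\<eta> z))"
    using open_opd by (elim compactE_image)
  have "zeros a0 \<subseteq> T"
  proof
    fix x assume x: "x \<in> zeros a0"
    then obtain z where z: "z \<in> T" "x \<in> opd z (\<eta> z)" using T(3) by (elim subsetD[THEN UN_E])
    have "x = z" using T(1) z x by (intro isolated opd_sub) auto
    thus "x \<in> T" using z by simp
  qed
  thus fin: "finite (zeros a0)" using T(2) by (rule finite_subset)
  \<comment> \<open>Two polydiscs of radius \<open>r\<close> with a common point have centers at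
    distance at most \<open>2 * r \<le> \<eta> z\<close>, and there \<open>z\<close> is the only
    zero of \<open>a0\<close>.\<close>
  define r where "r = Min (insert 1 (\<eta> ` zeros a0)) / 2"
  have r_pos: "r > 0" using fin \<eta> by (auto simp: r_def)
  have r_le: "2 * r \<le> \<eta> z" if "z \<in> zeros a0" for z using fin that by (auto simp: r_def)
  define S where "S = polydisc (\<lambda>_. 0) R - (\<Union>z\<in>zeros a0. opd z r)"
  have "compact S" unfolding S_def by (intro compact_diff compact_polydisc open_UN) (simp add: open_opd)
  have "\<exists>\<mu>>0. \<forall>\<^sub>F a in nhds a0. \<forall>c\<in>S. (\<forall>e<N. lin_sys K \<phi> a e c = 0) \<longrightarrow> cmod ((\<lambda>_. 0) c) \<ge> \<mu>"
  proof (rule lin_sys_nonvanishing_near[OF finite_K \<open>compact S\<close>])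
    show "continuous_on S (\<phi> e i)" if "e < N" "i \<in> K e" for e i
      by (rule PF_continuous[OF \<phi>_PF[OF that]])
    fix c assume c: "c \<in> S"
    show "\<exists>e<N. lin_sys K \<phi> a0 e c \<noteq> 0"
    proof (rule ccontr)
      assume "\<not> (\<exists>e<N. lin_sys K \<phi> a0 e c \<noteq> 0)"
      hence cz: "c \<in> zeros a0" using c by (auto simp: zeros_def S_def polydisc_def)
      have "c \<in> opd c r" using r_pos by (simp add: opd_def)
      thus False using c cz by (auto simp: S_def)
    qed
  qed (auto intro: continuous_intros)
  then obtain \<mu> where \<mu>: "\<mu> > 0"
    "\<forall>\<^sub>F a in nhds a0. \<forall>c\<in>S. (\<forall>e<N. lin_sys K \<phi> a e c = 0) \<longrightarrow> cmod (0::complex) \<ge> \<mu>"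
    by (elim exE conjE) (rule that)
  have uniq: "\<forall>\<^sub>F a in nhds a0. \<forall>z\<in>zeros a0. \<exists>!x. x \<in> polydisc z r \<and> x \<in> zeros a"
  proof (rule eventually_ball_finite[OF fin], rule ballI)
    fix z assume z: "z \<in> zeros a0"
    show "\<forall>\<^sub>F a in nhds a0. \<exists>!x. x \<in> polydisc z r \<and> x \<in> zeros a"
      using \<eta> z r_pos r_le[OF z] by simp
  qed
  show "\<forall>\<^sub>F a in nhds a0. card (zeros a) = card (zeros a0)"
    using R \<mu>(2) uniq
  proof eventually_elim
    case (elim a)
    define f where "f = (\<lambda>z. THE x. x \<in> polydisc z r \<and> x \<in> zeros a)"
    have f: "f z \<in> polydisc z r" "f z \<in> zeros a" if "z \<in> zeros a0" for z
      using theI'[OF elim(3)[rule_format, OF that]] by (simp_all add: f_def)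
    have f_uniq: "x = f z" if "z \<in> zeros a0" "x \<in> polydisc z r" "x \<in> zeros a" for x z
      using elim(3)[rule_format, OF that(1)] f[OF that(1)] that(2,3) by (elim ex1E) metis
    have "bij_betw f (zeros a0) (zeros a)"
      unfolding bij_betw_def
    proof (intro conjI inj_onI equalityI subsetI)
      fix z z' assume z: "z \<in> zeros a0" "z' \<in> zeros a0" and eq: "f z = f z'"
      have "cmod (z' u - z u) \<le> 2 * r" if u: "u < N" for u
      proof -
        have "cmod (f z u - z u) \<le> r" "cmod (f z u - z' u) \<le> r"
          using f(1)[OF z(1)] f(1)[OF z(2)] u by (simp_all add: eq polydisc_def)
        thus ?thesis
          using norm_triangle_ineq4[of "f z u - z u" "f z u - z' u"] by simp
      qed
      hence "z' \<in> polydisc z (\<eta> z)"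
        using z r_le[OF z(1)] by (auto simp: polydisc_def zeros_def intro: order_trans)
      thus "z = z'" using isolated[OF z] by simp
    next
      fix x assume "x \<in> f ` zeros a0"
      thus "x \<in> zeros a" using f(2) by auto
    next
      fix x assume x: "x \<in> zeros a"
      have "x \<notin> S"
      proof
        assume "x \<in> S"
        moreover have "\<forall>e<N. lin_sys K \<phi> a e x = 0" using x by (simp add: zeros_def)
        ultimately show False using elim(2) \<mu>(1) by fastforce
      qed
      moreover have "x \<in> polydisc (\<lambda>_. 0) R" using zeros_bounded[OF elim(1)] x by blast
      ultimately obtain z where z: "z \<in> zeros a0" "x \<in> opd z r" unfolding S_def by auto
      have "x = f z" using f_uniq[OF z(1) opd_sub[OF z(2) x] x] .
      thus "x \<in> f ` zeros a0" using z(1) by simp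
    qed
    thus ?case using bij_betw_same_card by fastforce
  qed
qed

text \<open>On the complex line joining two parameters with \<open>F \<noteq> 0\<close> only
  finitely many points are bad, and their complement is connected. The parameter \<open>a0\<close>
  itself may satisfy \<open>F a0 = 0\<close>; it is first moved a little along a line towards
  \<open>a\<close>, which does not change the number.\<close>

theorem card_zeros_generic:
  assumes F: "F \<in> polynomial_functions params"
    and good: "\<And>a. F a \<noteq> 0 \<Longrightarrow> locally_bounded a \<and> regular a"
    and a0: "locally_bounded a0" "regular a0" and a: "F a \<noteq> 0"
  shows "card (zeros a) = card (zeros a0)"
proof -
  have line: "card (zeros a1) = card (zeros a)" if a1: "F a1 \<noteq> 0" for a1
  proof -
    define l where "l = (\<lambda>t p. a1 p + t * (a p - a1 p))"
    have l01: "l 0 = a1" "l 1 = a" by (auto simp: l_def)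
    have fin: "finite {t. F (l t) = 0}"
      unfolding l_def by (rule PF_line_finite_zeros[OF F, of _ 0]) (use a1 in simp)
    have conn: "connected (UNIV - {t. F (l t) = 0})"
      by (rule connected_open_delete_finite) (use fin in auto)
    have "card (zeros (l 0)) = card (zeros (l 1))"
    proof (rule connected_local_const[OF conn, where f="\<lambda>t. card (zeros (l t))"])
      show "0 \<in> UNIV - {t. F (l t) = 0}" "1 \<in> UNIV - {t. F (l t) = 0}"
        using a a1 l01 by simp_all
      show "\<forall>t\<in>UNIV - {t. F (l t) = 0}.
          \<forall>\<^sub>F s in at t within UNIV - {t. F (l t) = 0}. card (zeros (l t)) = card (zeros (l s))"
      proof
        fix t assume "t \<in> UNIV - {t. F (l t) = 0}"
        hence "F (l t) \<noteq> 0" by simp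
        from good[OF this] have "\<forall>\<^sub>F b in nhds (l t). card (zeros b) = card (zeros (l t))"
          by (intro card_zeros_locally_constant(2)) auto
        moreover have "(l \<longlongrightarrow> l t) (nhds t)" unfolding l_def by (rule tendsto_line)
        ultimately have "\<forall>\<^sub>F s in nhds t. card (zeros (l s)) = card (zeros (l t))"
          by (rule eventually_compose_filterlim)
        thus "\<forall>\<^sub>F s in at t within UNIV - {t. F (l t) = 0}. card (zeros (l t)) = card (zeros (l s))"
          by (auto simp: eventually_at_filter elim!: eventually_mono)
      qed
    qed
    thus ?thesis by (simp add: l01)
  qed
  define l where "l = (\<lambda>t p. a0 p + t * (a p - a0 p))"
  have fin: "finite {t. F (l t) = 0}"
    unfolding l_def by (rule PF_line_finite_zeros[OF F, of _ 1]) (use a in simp)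
  have "(l \<longlongrightarrow> l 0) (nhds 0)" unfolding l_def by (rule tendsto_line)
  moreover have "l 0 = a0" by (simp add: l_def)
  ultimately have "\<forall>\<^sub>F s in nhds 0. card (zeros (l s)) = card (zeros a0)"
    using eventually_compose_filterlim[OF card_zeros_locally_constant(2)[OF a0]] by simp
  hence "\<forall>\<^sub>F s in at 0. card (zeros (l s)) = card (zeros a0)"
    by (auto simp: eventually_at_filter elim!: eventually_mono)
  moreover have "\<forall>\<^sub>F s in at 0. s \<notin> {t. F (l t) = 0}"
    using islimpt_finite[OF fin, of 0] by (simp add: islimpt_iff_eventually)
  ultimately have "\<forall>\<^sub>F s in at (0::complex). card (zeros (l s)) = card (zeros a0) \<and> F (l s) \<noteq> 0"
    by eventually_elim simp
  then obtain s where "card (zeros (l s)) = card (zeros a0)" "F (l s) \<noteq> 0"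
    using eventually_happens'[OF at_neq_bot] by blast
  thus ?thesis using line[of "l s"] by simp
qed

end

text \<open>
  \<open>S\<close> is a compact space of representatives for the points of a compactification of affine space, \<open>x0\<close> cuts
  out the boundary, and the functions \<open>q\<close> extend the \<open>\<phi>\<close> up to nonzero factors. Near the boundary there are
  coordinates in which the functions are \<open>\<psi> t\<close> and the boundary is the zero set of \<open>h t\<close>. A term that is constant
  in the coordinates is required in each equation, to make the incidence varieties affine spaces.
\<close>

locale compactified_system = linear_system N K \<phi>
  for N :: nat and K :: "nat \<Rightarrow> 'i set" and \<phi> :: "nat \<Rightarrow> 'i \<Rightarrow> (nat \<Rightarrow> complex) \<Rightarrow> complex" +
  fixes S :: "'c::topological_space set" and x0 :: "'c \<Rightarrow> complex" and q :: "nat \<Rightarrow> 'i \<Rightarrow> 'c \<Rightarrow> complex"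
    and B :: real
    and charts :: "'t set" and \<psi> :: "'t \<Rightarrow> nat \<Rightarrow> 'i \<Rightarrow> (nat \<Rightarrow> complex) \<Rightarrow> complex"
    and h :: "'t \<Rightarrow> (nat \<Rightarrow> complex) \<Rightarrow> complex"
    and i0 :: "'t \<Rightarrow> nat \<Rightarrow> 'i" and \<kappa> :: "'t \<Rightarrow> nat \<Rightarrow> complex"
    and i1 :: "nat \<Rightarrow> 'i" and \<kappa>1 :: "nat \<Rightarrow> complex"
  assumes compact_S: "compact S"
    and cont_x0: "continuous_on S x0"
    and cont_q: "e < N \<Longrightarrow> i \<in> K e \<Longrightarrow> continuous_on S (q e i)"
    and embed: "\<forall>u\<ge>N. x u = 0 \<Longrightarrow> \<exists>c\<in>S. \<exists>s. (\<forall>e<N. s e \<noteq> 0) \<and>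
      (\<forall>e<N. \<forall>i\<in>K e. q e i c = s e * \<phi> e i x) \<and> (\<forall>u<N. cmod (x u) * cmod (x0 c) \<le> B)"
    and finite_charts: "finite charts"
    and \<psi>_PF: "t \<in> charts \<Longrightarrow> e < N \<Longrightarrow> i \<in> K e \<Longrightarrow> \<psi> t e i \<in> polynomial_functions {..<N}"
    and \<psi>_const: "t \<in> charts \<Longrightarrow> e < N \<Longrightarrow> i0 t e \<in> K e"
      "t \<in> charts \<Longrightarrow> e < N \<Longrightarrow> \<psi> t e (i0 t e) x = \<kappa> t e"
      "t \<in> charts \<Longrightarrow> e < N \<Longrightarrow> \<kappa> t e \<noteq> 0"
    and h_PF: "t \<in> charts \<Longrightarrow> h t \<in> polynomial_functions {..<N}"
    and h_nonzero: "t \<in> charts \<Longrightarrow> \<exists>x. h t x \<noteq> 0"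
    and boundary: "c \<in> S \<Longrightarrow> x0 c = 0 \<Longrightarrow> \<exists>t\<in>charts. \<exists>x s. (\<forall>e<N. s e \<noteq> 0) \<and>
      (\<forall>e<N. \<forall>i\<in>K e. q e i c = s e * \<psi> t e i x) \<and> h t x = 0"
    and \<phi>_const: "e < N \<Longrightarrow> i1 e \<in> K e" "e < N \<Longrightarrow> \<phi> e (i1 e) x = \<kappa>1 e" "e < N \<Longrightarrow> \<kappa>1 e \<noteq> 0"
begin

definition admissible :: "(nat \<times> 'i \<Rightarrow> complex) \<Rightarrow> bool" where
  "admissible a \<longleftrightarrow> (\<forall>c\<in>S. x0 c = 0 \<longrightarrow> (\<exists>e<N. lin_sys K q a e c \<noteq> 0))"

lemma lin_sys_scale:
  assumes "\<And>i. i \<in> K e \<Longrightarrow> f e i y = s * g e i z"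
  shows "lin_sys K f a e y = s * lin_sys K g a e z"
  unfolding lin_sys_def sum_distrib_left by (intro sum.cong refl) (simp add: assms)

text \<open>By compactness \<open>cmod (x0 c)\<close> is bounded below on the solutions for all
  nearby parameters. This keeps them off the boundary, and by \<open>embed\<close> it bounds their
  affine coordinates.\<close>

lemma admissible_near:
  assumes "admissible a0"
  shows "\<forall>\<^sub>F a in nhds a0. admissible a" "locally_bounded a0"
proof -
  have "\<exists>\<mu>>0. \<forall>\<^sub>F a in nhds a0. \<forall>c\<in>S. (\<forall>e<N. lin_sys K q a e c = 0) \<longrightarrow> cmod (x0 c) \<ge> \<mu>"
  proof (rule lin_sys_nonvanishing_near[OF finite_K compact_S cont_x0 cont_q])
    show "\<exists>e<N. lin_sys K q a0 e c \<noteq> 0" if "c \<in> S" "x0 c = 0" for c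
      using assms that by (simp add: admissible_def)
  qed
  then obtain \<mu> where \<mu>: "\<mu> > 0"
    "\<forall>\<^sub>F a in nhds a0. \<forall>c\<in>S. (\<forall>e<N. lin_sys K q a e c = 0) \<longrightarrow> cmod (x0 c) \<ge> \<mu>"
    by (elim exE conjE) (rule that)
  show "\<forall>\<^sub>F a in nhds a0. admissible a"
    using \<mu>(2)
  proof eventually_elim
    case (elim a)
    thus ?case unfolding admissible_def using \<mu>(1) by fastforce
  qed
  show "locally_bounded a0"
    unfolding locally_bounded_def
  proof (intro exI[of _ "B / \<mu>"] eventually_mono[OF \<mu>(2)] ballI allI impI)
    fix a x u
    assume a: "\<forall>c\<in>S. (\<forall>e<N. lin_sys K q a e c = 0) \<longrightarrow> cmod (x0 c) \<ge> \<mu>" and x: "x \<in> zeros a" and u: "u < N"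
    have "\<forall>u\<ge>N. x u = 0" using x by (simp add: zeros_def)
    from embed[of x, OF this] obtain c s where c: "c \<in> S" "\<forall>e<N. s e \<noteq> 0"
      "\<forall>e<N. \<forall>i\<in>K e. q e i c = s e * \<phi> e i x" "\<forall>u<N. cmod (x u) * cmod (x0 c) \<le> B"
      by (elim bexE exE conjE) (rule that)
    have "lin_sys K q a e c = 0" if "e < N" for e
    proof -
      have "lin_sys K q a e c = s e * lin_sys K \<phi> a e x"
        using c(3) that by (intro lin_sys_scale) simp
      thus ?thesis using x that by (simp add: zeros_def)
    qed
    hence "\<mu> \<le> cmod (x0 c)" using a c(1) by simp
    hence "cmod (x u) * \<mu> \<le> cmod (x u) * cmod (x0 c)" by (intro mult_left_mono) auto
    also have "\<dots> \<le> B" using c(4) u by simp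
    finally show "cmod (x u) \<le> B / \<mu>" using \<mu>(1) by (simp add: pos_le_divide_eq)
  qed
qed

text \<open>In each boundary chart the solutions at the boundary form the hypersurface
  \<open>h t = 0\<close> in the incidence variety. The polynomials obtained for the finitely many
  charts are multiplied.\<close>

lemma generic_admissible:
  "\<exists>F\<in>polynomial_functions params. (\<exists>a. F a \<noteq> 0) \<and> (\<forall>a. F a \<noteq> 0 \<longrightarrow> admissible a)"
proof -
  have "\<forall>t\<in>charts. \<exists>F. F \<in> polynomial_functions params \<and> (\<exists>a. F a \<noteq> 0) \<and>
     (\<forall>x a. (\<forall>e<N. lin_sys K (\<psi> t) a e x = 0) \<longrightarrow> h t x = 0 \<longrightarrow> F a = 0)"
  proof
    fix t assume t: "t \<in> charts"
    obtain x1 where x1: "h t x1 \<noteq> 0" using h_nonzero[OF t] ..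
    define h' :: "(nat + nat \<times> 'i \<Rightarrow> complex) \<Rightarrow> complex" where "h' = (\<lambda>w. h t (\<lambda>u. w (Inl u)))"
    have "\<exists>F\<in>polynomial_functions params. (\<exists>a. F a \<noteq> 0) \<and>
     (\<forall>x a. (\<forall>e<N. lin_sys K (\<psi> t) a e x = 0) \<longrightarrow> h' (case_sum x a) = 0 \<longrightarrow> F a = 0)"
    \<comment> \<open>With all coefficients \<open>0\<close> every point solves the system, so
      \<open>x1\<close> with the zero system is a point of the incidence variety off the
      hypersurface.\<close>
    proof (rule incidence_hypersurface[where ?x1.0 = x1 and ?a1.0 = "\<lambda>_. 0"])
      show "finite (K e)" if "e < N" for e using finite_K[OF that] .
      show "\<psi> t e i \<in> polynomial_functions {..<N}" if "e < N" "i \<in> K e" for e i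
        using \<psi>_PF[OF t that] .
      show "i0 t e \<in> K e" "\<kappa> t e \<noteq> 0" "\<psi> t e (i0 t e) x = \<kappa> t e" if "e < N" for e x
        using \<psi>_const[OF t that] by simp_all
      show "h' \<in> polynomial_functions (Inl ` {..<N} \<union> Inr ` params)"
        unfolding h'_def by (rule PF_subst[OF h_PF[OF t]]) (auto intro: coord)
    qed (use x1 in \<open>simp_all add: h'_def lin_sys_def\<close>)
    thus "\<exists>F. F \<in> polynomial_functions params \<and> (\<exists>a. F a \<noteq> 0) \<and>
     (\<forall>x a. (\<forall>e<N. lin_sys K (\<psi> t) a e x = 0) \<longrightarrow> h t x = 0 \<longrightarrow> F a = 0)"
      by (simp add: h'_def Bex_def)
  qed
  from bchoice[OF this] obtain F where F: "\<forall>t\<in>charts. F t \<in> polynomial_functions params \<and> (\<exists>a. F t a \<noteq> 0) \<and>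
     (\<forall>x a. (\<forall>e<N. lin_sys K (\<psi> t) a e x = 0) \<longrightarrow> h t x = 0 \<longrightarrow> F t a = 0)" ..
  show ?thesis
  proof (intro bexI[of _ "\<lambda>a. \<Prod>t\<in>charts. F t a"] conjI allI impI)
    show "(\<lambda>a. \<Prod>t\<in>charts. F t a) \<in> polynomial_functions params"
      using F by (intro PF_prod) simp
    show "\<exists>a. (\<Prod>t\<in>charts. F t a) \<noteq> 0"
      by (rule PF_prod_nonzero[OF finite_charts, where V=params]) (use F in simp_all)
    fix a assume nz: "(\<Prod>t\<in>charts. F t a) \<noteq> 0"
    show "admissible a"
      unfolding admissible_def
    proof (intro ballI impI)
      fix c assume "c \<in> S" "x0 c = 0"
      from boundary[OF this] obtain t x s where t: "t \<in> charts" and s: "\<forall>e<N. s e \<noteq> 0"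
        "\<forall>e<N. \<forall>i\<in>K e. q e i c = s e * \<psi> t e i x" and hx: "h t x = 0"
        by (elim bexE exE conjE) (rule that)
      have "F t a \<noteq> 0" using nz t finite_charts by simp
      hence "\<exists>e<N. lin_sys K (\<psi> t) a e x \<noteq> 0" using F t hx by metis
      then obtain e where e: "e < N" "lin_sys K (\<psi> t) a e x \<noteq> 0" by (elim exE conjE) (rule that)
      have "lin_sys K q a e c = s e * lin_sys K (\<psi> t) a e x"
        using s(2) e(1) by (intro lin_sys_scale) simp
      thus "\<exists>e<N. lin_sys K q a e c \<noteq> 0" using e s(1) by auto
    qed
  qed
qed

text \<open>The degenerate zeros are the hypersurface in the incidence variety cut out by the
  Jacobian determinant. A single nondegenerate zero of some system shows that it is not the whole
  variety.\<close>

lemma generic_regular: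
  assumes "z1 \<in> zeros a1" "jacobian a1 z1 \<noteq> 0"
  shows "\<exists>F\<in>polynomial_functions params. (\<exists>a. F a \<noteq> 0) \<and> (\<forall>a. F a \<noteq> 0 \<longrightarrow> regular a)"
proof -
  define g :: "(nat + nat \<times> 'i \<Rightarrow> complex) \<Rightarrow> complex" where
    "g = (\<lambda>w. det (mat N N (\<lambda>(e, u). \<Sum>i\<in>K e. w (Inr (e, i)) * pd u (\<phi> e i) (\<lambda>u. w (Inl u)))))"
  have g: "g (case_sum x a) = jacobian a x" for x a
    unfolding g_def jacobian_def by (intro arg_cong[of _ _ det] eq_matI) (simp_all add: pd_lin_sys)
  have "\<exists>F\<in>polynomial_functions params. (\<exists>a. F a \<noteq> 0) \<and>
     (\<forall>x a. (\<forall>e<N. lin_sys K \<phi> a e x = 0) \<longrightarrow> g (case_sum x a) = 0 \<longrightarrow> F a = 0)"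
  proof (rule incidence_hypersurface[where ?x1.0 = z1 and ?a1.0 = a1 and ?i0.0 = i1 and \<kappa> = \<kappa>1 and h = g])
    show "g \<in> polynomial_functions (Inl ` {..<N} \<union> Inr ` params)"
      unfolding g_def
    proof (intro PF_det PF_sum mult)
      fix e u i assume *: "e < N" "u < N" "i \<in> K e"
      show "(\<lambda>w. w (Inr (e, i))) \<in> polynomial_functions (Inl ` {..<N} \<union> Inr ` params)"
        by (rule coord) (use * in auto)
      have "pd u (\<phi> e i) \<in> polynomial_functions {..<N}"
        by (rule PF_pd) (use * \<phi>_PF in auto)
      thus "(\<lambda>w. pd u (\<phi> e i) (\<lambda>u. w (Inl u))) \<in> polynomial_functions (Inl ` {..<N} \<union> Inr ` params)"
        by (rule PF_subst) (auto intro: coord)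
    qed
    show "lin_sys K \<phi> a1 e z1 = 0" if "e < N" for e using assms(1) that by (simp add: zeros_def)
    show "g (case_sum z1 a1) \<noteq> 0" using assms(2) g by simp
  qed (rule finite_K \<phi>_PF \<phi>_const; assumption)+
  thus ?thesis
    unfolding g regular_def by (elim bexE, intro bexI) (auto simp: zeros_def)
qed

text \<open>\<open>F\<close> is fixed before \<open>a0\<close>, so the generic number can be read
  off from any admissible regular system, even from one with \<open>F a0 = 0\<close>, and any two
  such systems have equally many zeros.\<close>

theorem generic_count:
  assumes "z1 \<in> zeros a1" "jacobian a1 z1 \<noteq> 0"
  shows "\<exists>F\<in>polynomial_functions params. (\<exists>a. F a \<noteq> 0) \<and>
    (\<forall>a. F a \<noteq> 0 \<longrightarrow> admissible a \<and> regular a \<and> finite (zeros a)) \<and>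
    (\<forall>a0 a. admissible a0 \<longrightarrow> regular a0 \<longrightarrow> F a \<noteq> 0 \<longrightarrow> card (zeros a) = card (zeros a0))"
proof -
  from generic_admissible obtain F1 where F1: "F1 \<in> polynomial_functions params" "\<exists>a. F1 a \<noteq> 0"
    "\<forall>a. F1 a \<noteq> 0 \<longrightarrow> admissible a" by (elim bexE conjE) (rule that)
  from generic_regular[OF assms] obtain F2 where F2: "F2 \<in> polynomial_functions params" "\<exists>a. F2 a \<noteq> 0"
    "\<forall>a. F2 a \<noteq> 0 \<longrightarrow> regular a" by (elim bexE conjE) (rule that)
  define F where "F = (\<lambda>a. F1 a * F2 a)"
  have F: "F \<in> polynomial_functions params" unfolding F_def by (intro mult F1 F2)
  have good: "admissible a \<and> regular a" if "F a \<noteq> 0" for a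
    using that F1(3) F2(3) by (simp add: F_def)
  show ?thesis
  proof (intro bexI[OF _ F] conjI allI impI)
    show "\<exists>a. F a \<noteq> 0"
    proof -
      obtain a b where ab: "F1 a \<noteq> 0" "F2 b \<noteq> 0" using F1(2) F2(2) by (elim exE) (rule that)
      from PF_domain[where F=F1 and G=F2, OF F1(1) ab(1) F2(1) ab(2)] show ?thesis by (simp add: F_def)
    qed
    show "admissible a" "regular a" "finite (zeros a)" if "F a \<noteq> 0" for a
      using good[OF that] card_zeros_locally_constant(1)[OF admissible_near(2)] by simp_all
    show "card (zeros a) = card (zeros a0)" if "admissible a0" "regular a0" "F a \<noteq> 0" for a0 a
      by (rule card_zeros_generic[OF F _ admissible_near(2)[OF that(1)] that(2,3)])
        (use good admissible_near(2) in simp)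
  qed
qed

end

subsection \<open>Minors of isotropic matrices\<close>

text \<open>The rows are given by a map rather than a set. It may be unsorted or not injective,
  which suits expansions and row exchanges; sorting costs only a sign.\<close>

definition rows_minor :: "nat \<Rightarrow> (nat \<Rightarrow> nat) \<Rightarrow> (nat \<Rightarrow> nat \<Rightarrow> complex) \<Rightarrow> complex" where
  "rows_minor n f b = det (mat n n (\<lambda>(i, j). b (f i) j))"

definition row_val :: "nat \<Rightarrow> (nat \<Rightarrow> nat \<Rightarrow> complex) \<Rightarrow> nat \<Rightarrow> (nat \<Rightarrow> complex) \<Rightarrow> complex" where
  "row_val n b i x = (\<Sum>j<n. b i j * x j)"

definition mat_mul :: "nat \<Rightarrow> (nat \<Rightarrow> nat \<Rightarrow> complex) \<Rightarrow> (nat \<Rightarrow> nat \<Rightarrow> complex) \<Rightarrow> nat \<Rightarrow> nat \<Rightarrow> complex" where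
  "mat_mul n b c i j = (\<Sum>k<n. b i k * c k j)"

lemma rows_minor_cong:
  assumes "\<And>i j. i < n \<Longrightarrow> j < n \<Longrightarrow> b (f i) j = b' (f' i) j"
  shows "rows_minor n f b = rows_minor n f' b'"
  unfolding rows_minor_def by (intro arg_cong[of _ _ det] eq_matI) (simp_all add: assms)

lemma rows_minor_mul:
  "rows_minor n f (mat_mul n b c) = rows_minor n f b * det (mat n n (\<lambda>(i, j). c i j))"
proof -
  have "mat n n (\<lambda>(i, j). mat_mul n b c (f i) j) = mat n n (\<lambda>(i, j). b (f i) j) * mat n n (\<lambda>(i, j). c i j)"
    by (rule eq_matI) (auto simp: mat_mul_def scalar_prod_def atLeast0LessThan intro!: sum.cong)
  thus ?thesis unfolding rows_minor_def by (simp add: det_mult[of _ n])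
qed

lemma rows_minor_nonzero_iff:
  "rows_minor n f b \<noteq> 0 \<longleftrightarrow> (\<forall>x. (\<forall>i<n. row_val n b (f i) x = 0) \<longrightarrow> (\<forall>j<n. x j = 0))"
proof -
  let ?A = "mat n n (\<lambda>(i, j). b (f i) j)"
  have A: "?A \<in> carrier_mat n n" by simp
  have val: "vec_index (?A *\<^sub>v v) i = row_val n b (f i) (vec_index v)" if "v \<in> carrier_vec n" "i < n" for v i
    using that by (simp add: row_val_def scalar_prod_def atLeast0LessThan)
  show ?thesis
  proof
    assume nz: "rows_minor n f b \<noteq> 0"
    show "\<forall>x. (\<forall>i<n. row_val n b (f i) x = 0) \<longrightarrow> (\<forall>j<n. x j = 0)"
    proof (intro allI impI)
      fix x j assume x: "\<forall>i<n. row_val n b (f i) x = 0" and j: "j < n"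
      define v where "v = vec n x"
      have v: "v \<in> carrier_vec n" by (simp add: v_def)
      have "row_val n b (f i) (vec_index v) = row_val n b (f i) x" for i
        by (simp add: row_val_def v_def)
      hence "?A *\<^sub>v v = 0\<^sub>v n" using x val[OF v] by (intro eq_vecI) auto
      hence "v = 0\<^sub>v n" using nz det_0_iff_vec_prod_zero_field[OF A] v unfolding rows_minor_def by blast
      thus "x j = 0" using j by (metis v_def index_vec index_zero_vec(1))
    qed
  next
    assume *: "\<forall>x. (\<forall>i<n. row_val n b (f i) x = 0) \<longrightarrow> (\<forall>j<n. x j = 0)"
    show "rows_minor n f b \<noteq> 0"
    proof
      assume "rows_minor n f b = 0"
      then obtain v where v: "v \<in> carrier_vec n" "v \<noteq> 0\<^sub>v n" "?A *\<^sub>v v = 0\<^sub>v n"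
        using det_0_iff_vec_prod_zero_field[OF A] unfolding rows_minor_def by blast
      have "row_val n b (f i) (vec_index v) = 0" if "i < n" for i
        using val[OF v(1) that] v(3) that by simp
      hence "\<forall>j<n. vec_index v j = 0" using * by simp
      hence "v = 0\<^sub>v n" using v(1) by (intro eq_vecI) auto
      thus False using v(2) by simp
    qed
  qed
qed

lemma rows_minor_normalize:
  assumes "rows_minor n f b \<noteq> 0"
  shows "\<exists>c. det (mat n n (\<lambda>(i, j). c i j)) * rows_minor n f b = 1 \<and>
     (\<forall>i<n. \<forall>j<n. mat_mul n b c (f i) j = (if i = j then 1 else 0))"
proof -
  from det_nonzero_inverse_fun[OF assms[unfolded rows_minor_def]]
  obtain c where c: "\<forall>i<n. \<forall>j<n. (\<Sum>k<n. b (f i) k * c k j) = (if i = j then 1 else 0)"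
    by (elim exE conjE) (rule that)
  have "rows_minor n f (mat_mul n b c) = det (1\<^sub>m n)"
    unfolding rows_minor_def using c by (intro arg_cong[of _ _ det] eq_matI) (auto simp: mat_mul_def)
  hence "rows_minor n f b * det (mat n n (\<lambda>(i, j). c i j)) = 1"
    by (simp add: rows_minor_mul)
  thus ?thesis using c by (intro exI[of _ c]) (simp add: mat_mul_def mult.commute)
qed

text \<open>The columns of \<open>b\<close> are pairwise orthogonal for the standard symplectic
  form, which pairs coordinate \<open>i\<close> with coordinate \<open>n + i\<close>.\<close>

definition isotropic :: "nat \<Rightarrow> (nat \<Rightarrow> nat \<Rightarrow> complex) \<Rightarrow> bool" where
  "isotropic n b \<longleftrightarrow> (\<forall>j<n. \<forall>k<n. (\<Sum>i<n. b i j * b (n + i) k - b (n + i) j * b i k) = 0)"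

lemma isotropic_row_val:
  assumes "isotropic n b"
  shows "(\<Sum>i<n. row_val n b i x * row_val n b (n + i) y - row_val n b (n + i) x * row_val n b i y) = 0"
proof -
  have "(\<Sum>i<n. row_val n b i x * row_val n b (n + i) y - row_val n b (n + i) x * row_val n b i y) =
    (\<Sum>i<n. \<Sum>j<n. \<Sum>k<n. (b i j * b (n + i) k - b (n + i) j * b i k) * (x j * y k))"
    unfolding row_val_def sum_product sum_subtractf[symmetric]
    by (intro sum.cong refl) (simp only: left_diff_distrib right_diff_distrib mult_ac)
  also have "\<dots> = (\<Sum>j<n. \<Sum>i<n. \<Sum>k<n. (b i j * b (n + i) k - b (n + i) j * b i k) * (x j * y k))"
    by (rule sum.swap)
  also have "\<dots> = (\<Sum>j<n. \<Sum>k<n. \<Sum>i<n. (b i j * b (n + i) k - b (n + i) j * b i k) * (x j * y k))"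
    by (intro sum.cong refl sum.swap)
  also have "\<dots> = (\<Sum>j<n. \<Sum>k<n. (\<Sum>i<n. b i j * b (n + i) k - b (n + i) j * b i k) * (x j * y k))"
    by (simp only: sum_distrib_right)
  also have "\<dots> = 0" using assms by (simp add: isotropic_def)
  finally show ?thesis .
qed

lemma isotropic_mul:
  assumes "isotropic n b"
  shows "isotropic n (mat_mul n b c)"
proof -
  have "mat_mul n b c i j = row_val n b i (\<lambda>k. c k j)" for i j
    by (simp add: mat_mul_def row_val_def)
  thus ?thesis unfolding isotropic_def using isotropic_row_val[OF assms] by simp
qed

text \<open>One row from each pair \<open>i\<close>, \<open>n + i\<close>. The minors on these rows
  are the principal Pluecker coordinates; in the main chart they are the principal minors of the
  symmetric matrix.\<close>

definition mixed_rows :: "nat \<Rightarrow> nat set \<Rightarrow> nat \<Rightarrow> nat" where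
  "mixed_rows n I i = (if i \<in> I then n + i else i)"

definition full_rank :: "nat \<Rightarrow> (nat \<Rightarrow> nat \<Rightarrow> complex) \<Rightarrow> bool" where
  "full_rank n b \<longleftrightarrow> (\<forall>x. (\<forall>i<2 * n. row_val n b i x = 0) \<longrightarrow> (\<forall>j<n. x j = 0))"

lemma rows_minor_full_rank:
  assumes "\<And>i. i < n \<Longrightarrow> f i < 2 * n" "rows_minor n f b \<noteq> 0"
  shows "full_rank n b"
  unfolding full_rank_def
proof (intro allI impI)
  fix x j assume x: "\<forall>i<2 * n. row_val n b i x = 0" and j: "j < n"
  have "\<forall>i<n. row_val n b (f i) x = 0" using x assms(1) by simp
  thus "x j = 0" using assms(2) j unfolding rows_minor_nonzero_iff by simp
qed

text \<open>\<open>J\<close> is a minimal set of upper rows spanning all upper rows, expressed by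
  common kernels; it is completed by the lower rows outside \<open>J\<close>. A vector killed by
  these rows is killed by all upper rows, and isotropy carries this over to the lower rows in
  \<open>J\<close>. So a Lagrangian subspace is always transversal to a coordinate one.\<close>

lemma isotropic_mixed_minor:
  assumes iso: "isotropic n b" and full: "full_rank n b"
  shows "\<exists>I\<subseteq>{..<n}. rows_minor n (mixed_rows n I) b \<noteq> 0"
proof -
  define P where "P = (\<lambda>J. J \<subseteq> {..<n} \<and> (\<forall>x. (\<forall>i\<in>J. row_val n b i x = 0) \<longrightarrow> (\<forall>i<n. row_val n b i x = 0)))"
  have "P {..<n}" by (simp add: P_def)
  from ex_has_least_nat[of P, OF this, of card]
  obtain J where J: "P J" "\<forall>J'. P J' \<longrightarrow> card J \<le> card J'" by (elim exE conjE) (rule that)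
  have J_sub: "J \<subseteq> {..<n}" "finite J" using J(1) by (auto simp: P_def intro: finite_subset)
  have sep: "\<exists>x. (\<forall>i\<in>J - {k}. row_val n b i x = 0) \<and> row_val n b k x \<noteq> 0" if k: "k \<in> J" for k
  proof -
    have "card (J - {k}) < card J" using k J_sub by (intro psubset_card_mono) auto
    hence "\<not> P (J - {k})" using J(2) by fastforce
    hence "\<not> (\<forall>x. (\<forall>i\<in>J - {k}. row_val n b i x = 0) \<longrightarrow> (\<forall>i<n. row_val n b i x = 0))"
      using J_sub by (auto simp: P_def)
    then obtain x where x: "\<forall>i\<in>J - {k}. row_val n b i x = 0" "\<not> (\<forall>i<n. row_val n b i x = 0)"
      unfolding not_all not_imp by (elim exE conjE) (rule that, assumption, simp only: not_all not_imp, rule exI, rule conjI)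
    have "row_val n b k x \<noteq> 0"
    proof
      assume "row_val n b k x = 0"
      hence "\<forall>i\<in>J. row_val n b i x = 0" using x(1) by auto
      thus False using J(1) x(2) by (simp add: P_def)
    qed
    thus ?thesis using x(1) by (intro exI conjI)
  qed
  have "rows_minor n (mixed_rows n ({..<n} - J)) b \<noteq> 0"
    unfolding rows_minor_nonzero_iff
  proof (intro allI impI)
    fix x j assume x: "\<forall>i<n. row_val n b (mixed_rows n ({..<n} - J) i) x = 0" and j: "j < n"
    have "row_val n b i x = 0" if "i \<in> J" for i
      using x[rule_format, of i] that J_sub by (auto simp: mixed_rows_def)
    hence upper: "row_val n b i x = 0" if "i < n" for i using J(1) that by (simp add: P_def)
    have lower_out: "row_val n b (n + i) x = 0" if "i < n" "i \<notin> J" for i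
      using x[rule_format, of i] that by (auto simp: mixed_rows_def)
    have lower: "row_val n b (n + k) x = 0" if k: "k \<in> J" for k
    proof -
      \<comment> \<open>\<open>y\<close> is dual to \<open>k\<close> among the rows in
        \<open>J\<close>, so only the term \<open>k\<close> survives in the pairing of
        \<open>x\<close> with \<open>y\<close>.\<close>
      obtain y where y: "\<forall>i\<in>J - {k}. row_val n b i y = 0" "row_val n b k y \<noteq> 0"
        using sep[OF k] by (elim exE conjE) (rule that)
      have "0 = (\<Sum>i<n. row_val n b i x * row_val n b (n + i) y - row_val n b (n + i) x * row_val n b i y)"
        using isotropic_row_val[OF iso] by simp
      also have "\<dots> = (\<Sum>i<n. if i = k then - (row_val n b (n + k) x * row_val n b k y) else 0)"
      proof (intro sum.cong refl)
        fix i assume i: "i \<in> {..<n}"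
        show "row_val n b i x * row_val n b (n + i) y - row_val n b (n + i) x * row_val n b i y =
          (if i = k then - (row_val n b (n + k) x * row_val n b k y) else 0)"
          using upper[of i] lower_out[of i] y(1) i by (cases "i \<in> J"; cases "i = k") simp_all
      qed
      also have "\<dots> = - (row_val n b (n + k) x * row_val n b k y)" using k J_sub by auto
      finally show ?thesis using y(2) by simp
    qed
    have "row_val n b i x = 0" if "i < 2 * n" for i
    proof (cases "i < n")
      case False
      define i' where "i' = i - n"
      have i': "i = n + i'" "i' < n" using False that by (auto simp: i'_def)
      show ?thesis unfolding i'(1) using lower[of i'] lower_out[OF i'(2)] by (cases "i' \<in> J") simp_all
    qed (rule upper)
    thus "x j = 0" using full j by (simp add: full_rank_def)
  qed
  thus ?thesis by (intro exI[of _ "{..<n} - J"]) simp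
qed

text \<open>\<sigma> numbers the entries of a symmetric matrix with the diagonal in front. As
  \<open>weight {e} = e + 1\<close>, the special form with index \<open>e < n\<close> then has the
  variable with the same index as its linear part, which makes the Jacobian at the origin
  diagonal.\<close>

locale symmetric_coordinates =
  fixes n N :: nat and \<sigma> :: "nat \<Rightarrow> nat \<times> nat"
  assumes n_pos: "n > 0"
    and N: "N = n * (n + 1) div 2"
    and \<sigma>: "bij_betw \<sigma> {..<N} {(i, k). i \<le> k \<and> k < n}"
    and \<sigma>_diag: "e < n \<Longrightarrow> \<sigma> e = (e, e)"
begin

definition idx :: "nat \<Rightarrow> nat \<Rightarrow> nat" where
  "idx i k = the_inv_into {..<N} \<sigma> (min i k, max i k)"

lemma n_le_N: "n \<le> N"
proof -
  have "2 * n \<le> n * (n + 1)" using n_pos by (cases n) auto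
  hence "2 * n div 2 \<le> n * (n + 1) div 2" by (rule div_le_mono)
  thus ?thesis unfolding N by simp
qed

lemma idx_sym: "idx i k = idx k i"
  by (simp add: idx_def min.commute max.commute)

lemma idx: "idx i k < N" "\<sigma> (idx i k) = (min i k, max i k)" if "i < n" "k < n"
proof -
  have *: "(min i k, max i k) \<in> {(i, k). i \<le> k \<and> k < n}" using that by auto
  show "idx i k < N"
    using the_inv_into_into[of \<sigma> "{..<N}" "(min i k, max i k)" "{..<N}"] \<sigma> * unfolding idx_def bij_betw_def by auto
  show "\<sigma> (idx i k) = (min i k, max i k)"
    unfolding idx_def by (rule f_the_inv_into_f_bij_betw[OF \<sigma>]) (use * in simp)
qed

lemma \<sigma>_props: "fst (\<sigma> u) \<le> snd (\<sigma> u)" "snd (\<sigma> u) < n" if "u < N"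
proof -
  have "\<sigma> u \<in> {(i, k). i \<le> k \<and> k < n}" using bij_betwE[OF \<sigma>] that by simp
  thus "fst (\<sigma> u) \<le> snd (\<sigma> u)" "snd (\<sigma> u) < n" by (simp_all add: case_prod_unfold)
qed

lemma idx_\<sigma>: "idx (fst (\<sigma> u)) (snd (\<sigma> u)) = u" if "u < N"
proof -
  have "(min (fst (\<sigma> u)) (snd (\<sigma> u)), max (fst (\<sigma> u)) (snd (\<sigma> u))) = \<sigma> u"
    using \<sigma>_props[OF that] by (simp add: min_absorb1 max_absorb2)
  thus ?thesis unfolding idx_def using the_inv_into_f_f[of \<sigma> "{..<N}" u] \<sigma> that by (simp add: bij_betw_def)
qed

text \<open>
  In the chart \<open>I\<close> the Lagrangian subspaces transversal to a coordinate one are the column spans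
  of matrices whose rows \<open>mixed_rows n I\<close> form the identity; the other rows give a symmetric matrix
  (up to sign), whose entries are the coordinates.
\<close>

definition chart :: "nat set \<Rightarrow> (nat \<Rightarrow> complex) \<Rightarrow> nat \<Rightarrow> nat \<Rightarrow> complex" where
  "chart I x i k =
     (if i < n \<and> k < n then (if i \<in> I then - x (idx i k) else if i = k then 1 else 0)
      else if i < 2 * n \<and> k < n then (if i - n \<in> I then (if i - n = k then 1 else 0) else x (idx (i - n) k))
      else 0)"

lemma chart_upper: "i < n \<Longrightarrow> k < n \<Longrightarrow> chart I x i k = (if i \<in> I then - x (idx i k) else if i = k then 1 else 0)"
  and chart_lower: "i < n \<Longrightarrow> k < n \<Longrightarrow> chart I x (n + i) k = (if i \<in> I then (if i = k then 1 else 0) else x (idx i k))"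
  by (simp_all add: chart_def)

lemma chart_mixed_rows:
  assumes "i < n" "k < n"
  shows "chart I x (mixed_rows n I i) k = (if i = k then 1 else 0)"
  using assms by (simp add: mixed_rows_def chart_upper chart_lower)

lemma rows_minor_chart_self: "rows_minor n (mixed_rows n I) (chart I x) = 1"
proof -
  have "mat n n (\<lambda>(i, j). chart I x (mixed_rows n I i) j) = 1\<^sub>m n"
    by (rule eq_matI) (simp_all add: chart_mixed_rows)
  thus ?thesis by (simp add: rows_minor_def)
qed

lemma isotropic_chart: "isotropic n (chart I x)"
  unfolding isotropic_def
proof (intro allI impI)
  fix j k assume jk: "j < n" "k < n"
  have "(\<Sum>i<n. chart I x i j * chart I x (n + i) k - chart I x (n + i) j * chart I x i k) =
    (\<Sum>i<n. (if i = j then x (idx j k) else 0) - (if i = k then x (idx k j) else 0))"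
    using jk by (intro sum.cong refl) (auto simp: chart_upper chart_lower)
  also have "\<dots> = 0" using jk by (simp add: sum_subtractf idx_sym)
  finally show "(\<Sum>i<n. chart I x i j * chart I x (n + i) k - chart I x (n + i) j * chart I x i k) = 0" .
qed

text \<open>When the mixed rows form the identity, the isotropy condition on two columns involves
  just two entries of the other rows and says that they agree, up to the sign put into the upper
  rows.\<close>

lemma isotropic_normal_form:
  assumes iso: "isotropic n b"
    and unit: "\<And>i k. i < n \<Longrightarrow> k < n \<Longrightarrow> b (mixed_rows n I i) k = (if i = k then 1 else 0)"
  shows "\<exists>x. (\<forall>u\<ge>N. x u = 0) \<and> (\<forall>i<2 * n. \<forall>k<n. b i k = chart I x i k)"
proof -
  define Q where "Q = (\<lambda>i k. if i \<in> I then - b i k else b (n + i) k)"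
  have up: "b i k = (if i \<in> I then - Q i k else if i = k then 1 else 0)"
    and low: "b (n + i) k = (if i \<in> I then if i = k then 1 else 0 else Q i k)" if "i < n" "k < n" for i k
    using unit[OF that] by (auto simp: Q_def mixed_rows_def split: if_splits)
  have Q_sym: "Q j k = Q k j" if jk: "j < n" "k < n" for j k
  proof -
    have "0 = (\<Sum>i<n. b i j * b (n + i) k - b (n + i) j * b i k)" using iso jk by (simp add: isotropic_def)
    also have "\<dots> = (\<Sum>i<n. (if i = j then Q j k else 0) - (if i = k then Q k j else 0))"
      using jk by (intro sum.cong refl) (auto simp: up low)
    also have "\<dots> = Q j k - Q k j" using jk by (simp add: sum_subtractf)
    finally show ?thesis by simp
  qed
  define x where "x = (\<lambda>u. if u < N then Q (fst (\<sigma> u)) (snd (\<sigma> u)) else 0)"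
  have x: "x (idx i k) = Q i k" if "i < n" "k < n" for i k
    using idx[OF that] Q_sym[OF that] by (cases "i \<le> k") (auto simp: x_def min_def max_def)
  show ?thesis
  proof (intro exI[of _ x] conjI allI impI)
    fix i k assume ik: "i < 2 * n" "k < n"
    show "b i k = chart I x i k"
    proof (cases "i < n")
      case True
      thus ?thesis using ik up[OF True ik(2)] by (simp add: chart_upper x)
    next
      case False
      hence "i = n + (i - n)" "i - n < n" using ik by auto
      thus ?thesis using low[of "i - n" k] chart_lower[of "i - n" k I x] x[of "i - n" k] ik by simp
    qed
  qed (simp add: x_def)
qed

text \<open>Normalizing the mixed rows to the identity only changes the basis of the same subspace,
  so all minors are multiplied by a common factor.\<close>

lemma isotropic_to_chart:
  assumes iso: "isotropic n b" and nz: "rows_minor n (mixed_rows n I) b \<noteq> 0" and I: "I \<subseteq> {..<n}"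
  shows "\<exists>x. (\<forall>u\<ge>N. x u = 0) \<and> (\<forall>f. (\<forall>i<n. f i < 2 * n) \<longrightarrow>
     rows_minor n f b = rows_minor n (mixed_rows n I) b * rows_minor n f (chart I x))"
proof -
  let ?m = "rows_minor n (mixed_rows n I) b"
  from rows_minor_normalize[OF nz] obtain c where c: "det (mat n n (\<lambda>(i, j). c i j)) * ?m = 1"
    "\<forall>i<n. \<forall>j<n. mat_mul n b c (mixed_rows n I i) j = (if i = j then 1 else 0)"
    by (elim exE conjE) (rule that)
  from isotropic_normal_form[OF isotropic_mul[OF iso], of c I] c(2)
  obtain x where x: "\<forall>u\<ge>N. x u = 0" "\<forall>i<2 * n. \<forall>k<n. mat_mul n b c i k = chart I x i k"
    by auto
  have "rows_minor n f b = ?m * rows_minor n f (chart I x)" if f: "\<forall>i<n. f i < 2 * n" for f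
  proof -
    have "rows_minor n f (chart I x) = rows_minor n f (mat_mul n b c)"
      by (rule rows_minor_cong) (use x(2) f in simp)
    hence "?m * rows_minor n f (chart I x) = rows_minor n f b * (det (mat n n (\<lambda>(i, j). c i j)) * ?m)"
      by (simp add: rows_minor_mul)
    thus ?thesis using c(1) by simp
  qed
  thus ?thesis using x(1) by blast
qed

text \<open>In the chart \<open>I\<close> the minor after exchanging \<open>m\<close> is the
  diagonal entry \<open>x (idx m m)\<close> up to sign.\<close>

lemma chart_rank_one_exchange:
  assumes I: "I \<subseteq> {..<n}" and m: "m < n" and nz: "x (idx m m) \<noteq> 0"
  shows "rows_minor n (mixed_rows n (sym_diff I {m})) (chart I x) \<noteq> 0"
  unfolding rows_minor_nonzero_iff
proof (intro allI impI)
  fix y j assume y: "\<forall>i<n. row_val n (chart I x) (mixed_rows n (sym_diff I {m}) i) y = 0" and j: "j < n"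
  have other: "y i = 0" if "i < n" "i \<noteq> m" for i
  proof -
    have "mixed_rows n (sym_diff I {m}) i = mixed_rows n I i" using that by (auto simp: mixed_rows_def)
    hence "row_val n (chart I x) (mixed_rows n I i) y = 0" using y that by metis
    thus ?thesis using that by (simp add: row_val_def chart_mixed_rows if_distrib[of "\<lambda>t. t * _"] cong: if_cong)
  qed
  have "row_val n (chart I x) (mixed_rows n (sym_diff I {m}) m) y = chart I x (mixed_rows n (sym_diff I {m}) m) m * y m"
    unfolding row_val_def using m other by (subst sum.remove[of _ m]) auto
  moreover have "chart I x (mixed_rows n (sym_diff I {m}) m) m \<noteq> 0"
    using m nz by (auto simp: mixed_rows_def chart_upper chart_lower)
  ultimately have "y m = 0" using y m by auto
  thus "y j = 0" using other j by (cases "j = m") auto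
qed

text \<open>The exchanged minor is, up to sign, the principal minor of \<open>x\<close> on
  \<open>m\<close> and \<open>k\<close>, which is minus the square of the entry
  \<open>x (idx m k)\<close> as the diagonal entry at \<open>m\<close> vanishes.\<close>

lemma chart_rank_two_exchange:
  assumes I: "I \<subseteq> {..<n}" and mk: "m < n" "k < n" "m \<noteq> k"
    and zero: "x (idx m m) = 0" and nz: "x (idx m k) \<noteq> 0"
  shows "rows_minor n (mixed_rows n (sym_diff I {m, k})) (chart I x) \<noteq> 0"
  unfolding rows_minor_nonzero_iff
proof (intro allI impI)
  let ?g = "mixed_rows n (sym_diff I {m, k})"
  fix y j assume y: "\<forall>i<n. row_val n (chart I x) (?g i) y = 0" and j: "j < n"
  have other: "y i = 0" if "i < n" "i \<noteq> m" "i \<noteq> k" for i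
  proof -
    have "?g i = mixed_rows n I i" using that by (auto simp: mixed_rows_def)
    hence "row_val n (chart I x) (mixed_rows n I i) y = 0" using y that by metis
    thus ?thesis using that by (simp add: row_val_def chart_mixed_rows if_distrib[of "\<lambda>t. t * _"] cong: if_cong)
  qed
  have val: "row_val n (chart I x) r y = chart I x r m * y m + chart I x r k * y k" for r
    unfolding row_val_def using mk other
    by (subst sum.remove[of _ m], simp, simp, subst sum.remove[of _ k]) auto
  have entry: "chart I x (?g i) l = (if i \<in> I then x (idx i l) else x (idx i l)) \<or>
      chart I x (?g i) l = - x (idx i l)" if "i = m \<or> i = k" "l < n" for i l
    using that mk by (auto simp: mixed_rows_def chart_upper chart_lower)
  have "chart I x (?g m) m = 0" "chart I x (?g m) k \<noteq> 0"
    using entry[of m m] entry[of m k] zero nz mk by auto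
  hence "y k = 0" using y mk(1) val[of "?g m"] by auto
  moreover have "chart I x (?g k) m \<noteq> 0"
    using entry[of k m] nz mk by (auto simp: idx_sym)
  ultimately have "y m = 0" using y mk(2) val[of "?g k"] by auto
  thus "y j = 0" using other j \<open>y k = 0\<close> by (cases "j = m"; cases "j = k") auto
qed

text \<open>The symmetric exchange axiom of delta-matroids.\<close>

lemma mixed_minor_exchange:
  assumes iso: "isotropic n b" and I: "I \<subseteq> {..<n}" "I' \<subseteq> {..<n}"
    and nz: "rows_minor n (mixed_rows n I) b \<noteq> 0" "rows_minor n (mixed_rows n I') b \<noteq> 0"
    and m: "m \<in> sym_diff I I'"
  shows "\<exists>k\<in>sym_diff I I'. rows_minor n (mixed_rows n (sym_diff I {m, k})) b \<noteq> 0"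
proof -
  from isotropic_to_chart[OF iso nz(1) I(1)] obtain x where
    x: "\<forall>f. (\<forall>i<n. f i < 2 * n) \<longrightarrow>
     rows_minor n f b = rows_minor n (mixed_rows n I) b * rows_minor n f (chart I x)" by (elim exE conjE) (rule that)
  have iff: "rows_minor n (mixed_rows n J) b \<noteq> 0 \<longleftrightarrow> rows_minor n (mixed_rows n J) (chart I x) \<noteq> 0" for J
  proof -
    have "\<forall>i<n. mixed_rows n J i < 2 * n" by (simp add: mixed_rows_def)
    with x have "rows_minor n (mixed_rows n J) b =
      rows_minor n (mixed_rows n I) b * rows_minor n (mixed_rows n J) (chart I x)" by simp
    thus ?thesis using nz(1) by simp
  qed
  have mn: "m < n" using m I by auto
  \<comment> \<open>Otherwise the unit vector at \<open>m\<close> would be killed by all rows of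
    \<open>I'\<close>: in the symmetric difference the rows carry entries of \<open>x\<close>,
    elsewhere they are unit rows for indices other than \<open>m\<close>.\<close>
  have "\<exists>k\<in>sym_diff I I'. x (idx m k) \<noteq> 0"
  proof (rule ccontr)
    assume "\<not> (\<exists>k\<in>sym_diff I I'. x (idx m k) \<noteq> 0)"
    hence z: "x (idx m k) = 0" if "k \<in> sym_diff I I'" for k using that by auto
    define y :: "nat \<Rightarrow> complex" where "y = (\<lambda>j. if j = m then 1 else 0)"
    have "row_val n (chart I x) (mixed_rows n I' i) y = 0" if i: "i < n" for i
    proof -
      have "row_val n (chart I x) (mixed_rows n I' i) y = chart I x (mixed_rows n I' i) m"
        using mn by (simp add: row_val_def y_def if_distrib[of "\<lambda>t. _ * t"] cong: if_cong)
      also have "\<dots> = 0"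
      proof (cases "i \<in> sym_diff I I'")
        case True
        hence "x (idx i m) = 0" using z by (simp add: idx_sym)
        thus ?thesis using True i mn by (auto simp: mixed_rows_def chart_upper chart_lower)
      next
        case False
        hence "mixed_rows n I' i = mixed_rows n I i" "i \<noteq> m" using m by (auto simp: mixed_rows_def)
        thus ?thesis using i mn by (simp add: chart_mixed_rows)
      qed
      finally show ?thesis .
    qed
    hence "y m = 0" using nz(2)[THEN iff[THEN iffD1], unfolded rows_minor_nonzero_iff, rule_format, of y m] mn by simp
    thus False by (simp add: y_def)
  qed
  then obtain k where k: "k \<in> sym_diff I I'" "x (idx m k) \<noteq> 0" by (elim bexE) (rule that)
  have kn: "k < n" using k I by auto
  show ?thesis
  proof (cases "x (idx m m) = 0")
    case True
    hence "m \<noteq> k" using k by auto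
    from chart_rank_two_exchange[where x=x, OF I(1) mn kn this True k(2)] k(1) show ?thesis
      unfolding iff by (rule bexI)
  next
    case False
    from chart_rank_one_exchange[where x=x, OF I(1) mn False]
    have "rows_minor n (mixed_rows n (sym_diff I {m, m})) b \<noteq> 0" unfolding iff by simp
    thus ?thesis using m by (rule bexI)
  qed
qed

text \<open>The numbers \<open>i + 1\<close> for \<open>i \<in> I\<close> are the parts of a strict
  partition, the usual index of a Schubert variety of \<open>LG(n)\<close>; \<open>weight\<close> is
  the size of the partition.\<close>

definition weight :: "nat set \<Rightarrow> nat" where
  "weight I = (\<Sum>i\<in>I. i + 1)"

text \<open>For two different sets of the same greatest weight let \<open>m\<close> be the largest
  element of their symmetric difference. An exchange at \<open>m\<close> in the set without it
  either only adds elements or replaces some \<open>k < m\<close> by \<open>m\<close>; both would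
  raise the weight. Hence the sum of the mixed minors of greatest weight has one nonzero term and
  cannot cancel.\<close>

lemma exists_dominant_mixed_minor:
  assumes iso: "isotropic n b" and full: "full_rank n b"
  shows "\<exists>I\<subseteq>{..<n}. rows_minor n (mixed_rows n I) b \<noteq> 0 \<and>
    (\<forall>I'\<subseteq>{..<n}. I' \<noteq> I \<longrightarrow> weight I \<le> weight I' \<longrightarrow> rows_minor n (mixed_rows n I') b = 0)"
proof -
  define \<F> where "\<F> = {I. I \<subseteq> {..<n} \<and> rows_minor n (mixed_rows n I) b \<noteq> 0}"
  have "\<F> \<subseteq> Pow {..<n}" by (auto simp: \<F>_def)
  hence fin: "finite \<F>" by (rule finite_subset) simp
  have "\<F> \<noteq> {}" using isotropic_mixed_minor[OF iso full] by (auto simp: \<F>_def)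
  hence "Max (weight ` \<F>) \<in> weight ` \<F>" using fin by (intro Max_in) auto
  then obtain I where I: "I \<in> \<F>" "weight I = Max (weight ` \<F>)" by auto
  have max: "weight J \<le> weight I" if "J \<in> \<F>" for J using that fin by (simp add: I(2))
  have no_exchange: False
    if "J \<in> \<F>" "J' \<in> \<F>" "weight J = weight I" "m \<in> J'" "m \<notin> J" "\<forall>k\<in>sym_diff J J'. k \<le> m" for J J' m
  proof -
    have sub: "J \<subseteq> {..<n}" "J' \<subseteq> {..<n}" using that by (auto simp: \<F>_def)
    have finJ: "finite J" using sub(1) by (rule finite_subset) simp
    have "\<exists>k\<in>sym_diff J J'. rows_minor n (mixed_rows n (sym_diff J {m, k})) b \<noteq> 0"
      by (rule mixed_minor_exchange[OF iso sub]) (use that in \<open>auto simp: \<F>_def\<close>)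
    then obtain k where k: "k \<in> sym_diff J J'" "rows_minor n (mixed_rows n (sym_diff J {m, k})) b \<noteq> 0"
      by (elim bexE) (rule that)
    have "sym_diff J {m, k} \<in> \<F>" using k sub that(4) by (auto simp: \<F>_def)
    hence le: "weight (sym_diff J {m, k}) \<le> weight J" using max that(3) by simp
    show False
    proof (cases "k \<in> J")
      case False
      hence "sym_diff J {m, k} = J \<union> {m, k}" using that(5) by auto
      hence "weight (sym_diff J {m, k}) = weight J + weight {m, k}"
        using sum.union_disjoint[of J "{m, k}" "\<lambda>i. i + 1"] that(5) False finJ by (simp only: weight_def) simp
      moreover have "weight {m, k} > 0" by (auto simp: weight_def intro: sum_pos)
      ultimately show False using le by simp
    next
      case True
      hence km: "k \<noteq> m" "k < m" using that(5,6) k(1) by (auto simp: le_less)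
      have "sym_diff J {m, k} = insert m (J - {k})" using that(5) True by auto
      hence "weight (sym_diff J {m, k}) = (m + 1) + weight (J - {k})"
        unfolding weight_def using that(5) finJ by simp
      moreover have "weight J = (k + 1) + weight (J - {k})"
        unfolding weight_def using finJ True by (simp add: sum.remove)
      ultimately show False using le km by simp
    qed
  qed
  have "I' = I" if I': "I' \<in> \<F>" "weight I \<le> weight I'" for I'
  proof (rule ccontr)
    assume ne: "I' \<noteq> I"
    have eq: "weight I' = weight I" using max[OF I'(1)] I'(2) by simp
    define m where "m = Max (sym_diff I I')"
    have finD: "finite (sym_diff I I')" using I(1) I'(1) by (auto simp: \<F>_def intro: finite_subset)
    have "sym_diff I I' \<noteq> {}" using ne by auto
    hence m: "m \<in> sym_diff I I'" using Max_in[OF finD] by (simp add: m_def)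
    have m_max: "\<forall>k\<in>sym_diff I I'. k \<le> m" using finD by (auto simp: m_def)
    show False
    proof (cases "m \<in> I'")
      case True
      thus False using no_exchange[of I I' m] I I' m m_max by auto
    next
      case False
      thus False using no_exchange[of I' I m] I I' m m_max eq by auto
    qed
  qed
  thus ?thesis using I(1) by (intro exI[of _ I]) (auto simp: \<F>_def)
qed

end

subsection \<open>Pluecker coordinates of Lagrangian subspaces\<close>

abbreviation pick where "pick \<equiv> DL_Missing_Sublist.pick"

lemma pluecker_index_finite: "finite (pluecker_index k m)"
  unfolding pluecker_index_def by (rule finite_subset[of _ "Pow {..<m}"]) auto

lemma pick_bij:
  assumes "I \<in> pluecker_index k m"
  shows "bij_betw (pick I) {..<k} I" "\<And>i. i < k \<Longrightarrow> pick I i < m"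
proof -
  have I: "card I = k" "finite I" "I \<subseteq> {..<m}"
    using assms by (auto simp: pluecker_index_def intro: finite_subset)
  have inj: "inj_on (pick I) {..<k}"
  proof (rule linorder_inj_onI')
    fix i j assume "i \<in> {..<k}" "j \<in> {..<k}" "i < j"
    thus "pick I i \<noteq> pick I j" using pick_mono[of j I i] I(1) by simp
  qed
  have sub: "pick I ` {..<k} \<subseteq> I" using pick_in_set[of _ I] I by auto
  have "pick I ` {..<k} = I"
    by (rule card_subset_eq[OF I(2) sub]) (simp add: card_image[OF inj] I(1))
  thus "bij_betw (pick I) {..<k} I" using inj by (simp add: bij_betw_def)
  show "\<And>i. i < k \<Longrightarrow> pick I i < m" using sub I(3) by auto
qed

lemma pluecker_coords_rows_minor:
  assumes "I \<in> pluecker_index n m"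
  shows "pluecker_coords n m (mat m n (\<lambda>(i, j). b i j)) I = rows_minor n (pick I) b"
proof -
  have I: "card I = n" "I \<subseteq> {..<m}" using assms by (auto simp: pluecker_index_def)
  have rows: "{i. i < dim_row (mat m n (\<lambda>(i, j). b i j)) \<and> i \<in> I} = I" using I by auto
  have cols: "{j. j < dim_col (mat m n (\<lambda>(i, j). b i j)) \<and> j \<in> UNIV} = {..<n}" by auto
  have "submatrix (mat m n (\<lambda>(i, j). b i j)) I UNIV = mat n n (\<lambda>(i, j). b (pick I i) j)"
    unfolding submatrix_def rows cols I(1) card_lessThan
    by (rule eq_matI) (use pick_bij(2)[OF assms] in \<open>auto simp: pick_UNIV\<close>)
  thus ?thesis using assms by (simp add: pluecker_coords_def rows_minor_def)
qed

lemma rows_minor_sort: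
  assumes inj: "inj_on f {..<n}" and f: "\<And>i. i < n \<Longrightarrow> f i < m"
  shows "f ` {..<n} \<in> pluecker_index n m"
    "\<exists>s. s \<noteq> 0 \<and> (\<forall>b. rows_minor n f b = s * rows_minor n (pick (f ` {..<n})) b)"
proof -
  let ?I = "f ` {..<n}"
  show I: "?I \<in> pluecker_index n m"
    using assms by (auto simp: pluecker_index_def card_image)
  note bij = pick_bij(1)[OF I]
  define \<pi> where "\<pi> = (\<lambda>i. if i < n then the_inv_into {..<n} (pick ?I) (f i) else i)"
  have \<pi>: "\<pi> i < n" "pick ?I (\<pi> i) = f i" if "i < n" for i
  proof -
    have fi: "f i \<in> pick ?I ` {..<n}" using bij that by (simp add: bij_betw_def)
    have "the_inv_into {..<n} (pick ?I) (f i) \<in> {..<n}"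
      by (rule the_inv_into_into[OF bij_betw_imp_inj_on[OF bij] fi]) simp
    thus "\<pi> i < n" using that by (simp add: \<pi>_def)
    show "pick ?I (\<pi> i) = f i"
      using f_the_inv_into_f[OF bij_betw_imp_inj_on[OF bij] fi] that by (simp add: \<pi>_def)
  qed
  have "inj_on \<pi> {0..<n}"
  proof (rule inj_onI)
    fix i j assume ij: "i \<in> {0..<n}" "j \<in> {0..<n}" "\<pi> i = \<pi> j"
    hence "f i = f j" using \<pi>(2)[of i] \<pi>(2)[of j] by simp
    thus "i = j" using inj ij by (auto dest: inj_onD)
  qed
  moreover have "\<pi> ` {0..<n} \<subseteq> {0..<n}" using \<pi>(1) by auto
  ultimately have "bij_betw \<pi> {0..<n} {0..<n}"
    by (simp add: bij_betw_def endo_inj_surj)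
  hence perm: "\<pi> permutes {0..<n}"
    by (rule bij_imp_permutes) (simp add: \<pi>_def)
  have "rows_minor n f b = of_int (sign \<pi>) * rows_minor n (pick ?I) b" for b
  proof -
    have "mat n n (\<lambda>(i, j). b (f i) j) = mat n n (\<lambda>(i, j). mat n n (\<lambda>(i, j). b (pick ?I i) j) $$ (\<pi> i, j))"
      by (rule eq_matI) (simp_all add: \<pi>)
    thus ?thesis unfolding rows_minor_def
      using det_permute_rows[OF _ perm, of "mat n n (\<lambda>(i, j). b (pick ?I i) j)"] by simp
  qed
  moreover have "(of_int (sign \<pi>) :: complex) \<noteq> 0" by (simp add: sign_def)
  ultimately show "\<exists>s. s \<noteq> 0 \<and> (\<forall>b. rows_minor n f b = s * rows_minor n (pick ?I) b)" by blast
qed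

text \<open>Linear forms in the Pluecker coordinates, seen as functions of a matrix. The
  coefficients stay existential here; \<open>form_coeff\<close> recovers them for building a linear
  section.\<close>

definition pluecker_form :: "nat \<Rightarrow> ((nat \<Rightarrow> nat \<Rightarrow> complex) \<Rightarrow> complex) \<Rightarrow> bool" where
  "pluecker_form n G \<longleftrightarrow> (\<exists>c. \<forall>b. G b = (\<Sum>I\<in>pluecker_index n (2 * n). c I * rows_minor n (pick I) b))"

lemma pluecker_form_add:
  assumes "pluecker_form n G" "pluecker_form n H"
  shows "pluecker_form n (\<lambda>b. G b + H b)"
proof -
  obtain c d where "\<forall>b. G b = (\<Sum>I\<in>pluecker_index n (2 * n). c I * rows_minor n (pick I) b)"
    "\<forall>b. H b = (\<Sum>I\<in>pluecker_index n (2 * n). d I * rows_minor n (pick I) b)"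
    using assms unfolding pluecker_form_def by (elim exE) (rule that)
  thus ?thesis unfolding pluecker_form_def
    by (intro exI[of _ "\<lambda>I. c I + d I"]) (simp add: distrib_right sum.distrib)
qed

lemma pluecker_form_cmult:
  assumes "pluecker_form n G"
  shows "pluecker_form n (\<lambda>b. a * G b)"
proof -
  obtain c where "\<forall>b. G b = (\<Sum>I\<in>pluecker_index n (2 * n). c I * rows_minor n (pick I) b)"
    using assms unfolding pluecker_form_def by (elim exE) (rule that)
  thus ?thesis unfolding pluecker_form_def
    by (intro exI[of _ "\<lambda>I. a * c I"]) (simp add: sum_distrib_left mult.assoc)
qed

lemma pluecker_form_zero: "pluecker_form n (\<lambda>b. 0)"
  unfolding pluecker_form_def by (intro exI[of _ "\<lambda>I. 0"]) simp

lemma pluecker_form_sum: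
  "(\<And>i. i \<in> A \<Longrightarrow> pluecker_form n (G i)) \<Longrightarrow> pluecker_form n (\<lambda>b. \<Sum>i\<in>A. G i b)"
  by (induction A rule: infinite_finite_induct) (simp_all add: pluecker_form_zero pluecker_form_add)

lemma pluecker_form_rows_minor:
  assumes f: "\<And>i. i < n \<Longrightarrow> f i < 2 * n"
  shows "pluecker_form n (rows_minor n f)"
proof (cases "inj_on f {..<n}")
  case True
  from rows_minor_sort[OF True f] obtain s where I: "f ` {..<n} \<in> pluecker_index n (2 * n)"
    and s: "\<forall>b. rows_minor n f b = s * rows_minor n (pick (f ` {..<n})) b" by blast
  show ?thesis unfolding pluecker_form_def
    by (intro exI[of _ "\<lambda>I. if I = f ` {..<n} then s else 0"])
      (use I s pluecker_index_finite[of n "2 * n"] in \<open>simp add: if_distrib[of "\<lambda>t. t * _"] cong: if_cong\<close>)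
next
  case False
  then obtain i j where ij: "i < n" "j < n" "i \<noteq> j" "f i = f j" by (auto simp: inj_on_def)
  have "rows_minor n f b = 0" for b
    unfolding rows_minor_def
    by (rule det_identical_rows[of _ n, OF _ ij(3,1,2)]) (use ij in \<open>auto intro!: eq_vecI\<close>)
  hence "rows_minor n f = (\<lambda>b. 0)" by auto
  thus ?thesis using pluecker_form_zero by simp
qed

definition row_act :: "nat \<Rightarrow> (nat \<Rightarrow> nat \<Rightarrow> complex) \<Rightarrow> (nat \<Rightarrow> nat \<Rightarrow> complex) \<Rightarrow> nat \<Rightarrow> nat \<Rightarrow> complex" where
  "row_act m g b i j = (\<Sum>k<m. g i k * b k j)"

text \<open>Multilinear expansion in the rows, the Cauchy-Binet formula before sorting.
  \<open>h\<close> ranges over all maps; those with repeated values contribute zero minors. So a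
  linear change of coordinates of the ambient space acts linearly on the Pluecker
  coordinates.\<close>

lemma pluecker_form_row_act: "pluecker_form n (\<lambda>b. rows_minor n f (row_act (2 * n) g b))"
proof -
  let ?H = "{0..<n} \<rightarrow>\<^sub>E {..<2 * n}"
  have "rows_minor n f (row_act (2 * n) g b) = (\<Sum>h\<in>?H. (\<Prod>i\<in>{0..<n}. g (f i) (h i)) * rows_minor n h b)" for b
  proof -
    have "rows_minor n f (row_act (2 * n) g b) =
      (\<Sum>p | p permutes {0..<n}. of_int (sign p) * (\<Prod>i\<in>{0..<n}. \<Sum>k<2 * n. g (f i) k * b k (p i)))"
      unfolding rows_minor_def
      by (subst det_def'[where n=n]) (auto intro!: sum.cong prod.cong simp: permutes_in_image row_act_def)
    also have "\<dots> = (\<Sum>p | p permutes {0..<n}. \<Sum>h\<in>?H. of_int (sign p) * (\<Prod>i\<in>{0..<n}. g (f i) (h i) * b (h i) (p i)))"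
      by (simp add: prod_sum_PiE sum_distrib_left)
    also have "\<dots> = (\<Sum>h\<in>?H. \<Sum>p | p permutes {0..<n}. of_int (sign p) * (\<Prod>i\<in>{0..<n}. g (f i) (h i) * b (h i) (p i)))"
      by (rule sum.swap)
    also have "\<dots> = (\<Sum>h\<in>?H. (\<Prod>i\<in>{0..<n}. g (f i) (h i)) * rows_minor n h b)"
    proof (intro sum.cong refl)
      fix h assume "h \<in> ?H"
      have "rows_minor n h b = (\<Sum>p | p permutes {0..<n}. of_int (sign p) * (\<Prod>i\<in>{0..<n}. b (h i) (p i)))"
        unfolding rows_minor_def
        by (subst det_def'[where n=n]) (auto intro!: sum.cong prod.cong simp: permutes_in_image)
      thus "(\<Sum>p | p permutes {0..<n}. of_int (sign p) * (\<Prod>i\<in>{0..<n}. g (f i) (h i) * b (h i) (p i))) =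
         (\<Prod>i\<in>{0..<n}. g (f i) (h i)) * rows_minor n h b"
        by (simp add: prod.distrib sum_distrib_left mult.left_commute)
    qed
    finally show ?thesis .
  qed
  moreover have "pluecker_form n (\<lambda>b. \<Sum>h\<in>?H. (\<Prod>i\<in>{0..<n}. g (f i) (h i)) * rows_minor n h b)"
  proof (intro pluecker_form_sum pluecker_form_cmult pluecker_form_rows_minor)
    fix h i assume "h \<in> ?H" "i < n"
    thus "h i < 2 * n" using PiE_mem[of h "{0..<n}" "\<lambda>_. {..<2 * n}" i] by simp
  qed
  ultimately show ?thesis by simp
qed

lemma rows_minor_unit_rows:
  assumes j: "j < n" and unit: "\<And>i k. i < n \<Longrightarrow> i \<noteq> j \<Longrightarrow> k < n \<Longrightarrow> b (f i) k = (if i = k then 1 else 0)"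
  shows "rows_minor n f b = b (f j) j"
proof -
  let ?P = "{p. p permutes {0..<n}}"
  let ?t = "\<lambda>p. of_int (sign p) * (\<Prod>i\<in>{0..<n}. b (f i) (p i))"
  have "rows_minor n f b = sum ?t ?P"
    unfolding rows_minor_def
    by (subst det_def'[where n=n]) (auto intro!: sum.cong prod.cong simp: permutes_in_image)
  also have "\<dots> = sum ?t {id}"
  proof (rule sum.mono_neutral_right)
    show "\<forall>p\<in>?P - {id}. ?t p = 0"
    proof
      fix p assume p: "p \<in> ?P - {id}"
      have "\<exists>i<n. i \<noteq> j \<and> p i \<noteq> i"
      proof (rule ccontr)
        assume *: "\<not> (\<exists>i<n. i \<noteq> j \<and> p i \<noteq> i)"
        have fix_other: "p i = i" if "i \<noteq> j" for i
          using * p that permutes_not_in[of p "{0..<n}" i] by (cases "i < n") auto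
        have "p j = j"
        proof (rule ccontr)
          assume "p j \<noteq> j"
          hence "p (p j) = p j" by (rule fix_other)
          moreover have "inj p" using p permutes_inj by blast
          ultimately show False using \<open>p j \<noteq> j\<close> by (simp add: inj_eq)
        qed
        hence "p = id" using fix_other by (intro ext) (metis id_apply)
        thus False using p by simp
      qed
      then obtain i where i: "i < n" "i \<noteq> j" "p i \<noteq> i" by (elim exE conjE) (rule that)
      have "p i < n" using p i(1) permutes_in_image[of p "{0..<n}" i] by auto
      hence "b (f i) (p i) = 0" using unit[OF i(1,2)] i(3) by simp
      hence "(\<Prod>i\<in>{0..<n}. b (f i) (p i)) = 0" using i(1) by (intro prod_zero) auto
      thus "?t p = 0" by simp
    qed
  qed (auto simp: permutes_id finite_permutations)
  also have "\<dots> = (\<Prod>i\<in>{0..<n}. if i = j then b (f j) j else 1)"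
  proof -
    have "(\<Prod>i\<in>{0..<n}. b (f i) i) = (\<Prod>i\<in>{0..<n}. if i = j then b (f j) j else 1)"
      using unit by (intro prod.cong) auto
    thus ?thesis by simp
  qed
  also have "\<dots> = b (f j) j" using j by simp
  finally show ?thesis .
qed

section \<open>Compact representatives of Lagrangian subspaces\<close>

lemma continuous_on_entry: "continuous_on S (\<lambda>b :: nat \<Rightarrow> nat \<Rightarrow> complex. b i j)"
proof -
  have "continuous_on UNIV (\<lambda>b :: nat \<Rightarrow> nat \<Rightarrow> complex. (b i) j)"
    by (rule continuous_on_compose2[OF continuous_on_product_coordinates continuous_on_product_coordinates]) auto
  thus ?thesis by (rule continuous_on_subset) simp
qed

lemma continuous_on_rows_minor: "continuous_on S (rows_minor n f)"
proof -
  have eq: "rows_minor n f = (\<lambda>b. \<Sum>p | p permutes {0..<n}. of_int (sign p) * (\<Prod>i\<in>{0..<n}. b (f i) (p i)))"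
    unfolding rows_minor_def
    by (intro ext, subst det_def'[where n=n]) (auto intro!: sum.cong prod.cong simp: permutes_in_image)
  show ?thesis unfolding eq by (intro continuous_intros continuous_on_entry)
qed

text \<open>Normalized bases of Lagrangian subspaces, a compact substitute for \<open>LG(n)\<close>
  that avoids a quotient topology. A subspace may have several representatives, which does no harm
  to compactness arguments.\<close>

definition reduced_isotropic :: "nat \<Rightarrow> (nat \<Rightarrow> nat \<Rightarrow> complex) set" where
  "reduced_isotropic n = {b. (\<forall>i j. b i j \<in> (if i < 2 * n \<and> j < n then cball 0 1 else {0})) \<and> isotropic n b \<and>
     (\<exists>f\<in>{..<n} \<rightarrow>\<^sub>E {..<2 * n}. \<forall>i<n. \<forall>j<n. b (f i) j = (if i = j then 1 else 0))}"

lemma compact_reduced_isotropic: "compact (reduced_isotropic n)"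
proof -
  define C :: "nat \<Rightarrow> nat \<Rightarrow> complex set" where "C = (\<lambda>i j. if i < 2 * n \<and> j < n then cball 0 1 else {0})"
  have "compact {b. \<forall>i. b i \<in> {r. \<forall>j. r j \<in> C i j}}"
    by (intro compact_product) (simp add: C_def)
  hence box: "compact {b. \<forall>i j. b i j \<in> C i j}" by simp
  have closed_eq: "closed {b :: nat \<Rightarrow> nat \<Rightarrow> complex. F b = G b}"
    if "continuous_on UNIV F" "continuous_on UNIV G" for F G :: "_ \<Rightarrow> complex"
    by (rule closed_Collect_eq[OF that])
  have iso: "closed {b. isotropic n b}"
  proof -
    have "closed (\<Inter>j\<in>{..<n}. \<Inter>k\<in>{..<n}. {b :: nat \<Rightarrow> nat \<Rightarrow> complex.
        (\<Sum>i<n. b i j * b (n + i) k - b (n + i) j * b i k) = 0})"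
      by (intro closed_INT ballI closed_eq continuous_intros continuous_on_entry)
    also have "\<dots> = {b. isotropic n b}" by (auto simp: isotropic_def)
    finally show ?thesis .
  qed
  have unit: "closed (\<Union>f\<in>{..<n} \<rightarrow>\<^sub>E {..<2 * n}. \<Inter>i\<in>{..<n}. \<Inter>j\<in>{..<n}.
      {b :: nat \<Rightarrow> nat \<Rightarrow> complex. b (f i) j = (if i = j then 1 else 0)})"
    by (intro closed_UN closed_INT ballI closed_eq continuous_intros continuous_on_entry finite_PiE) auto
  have "compact ({b. \<forall>i j. b i j \<in> C i j} \<inter> ({b. isotropic n b} \<inter>
     (\<Union>f\<in>{..<n} \<rightarrow>\<^sub>E {..<2 * n}. \<Inter>i\<in>{..<n}. \<Inter>j\<in>{..<n}.
      {b :: nat \<Rightarrow> nat \<Rightarrow> complex. b (f i) j = (if i = j then 1 else 0)})))"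
    by (intro compact_Int_closed box closed_Int iso unit)
  also have "\<dots> = reduced_isotropic n"
    unfolding reduced_isotropic_def C_def Int_def UN_iff INT_iff mem_Collect_eq lessThan_iff
    by (rule Collect_cong) (simp add: Ball_def)
  finally show ?thesis .
qed

text \<open>The basis is normalized at the minor of greatest modulus, so all minors become at most
  \<open>1\<close> in modulus. Every entry is itself a minor, obtained by replacing one row of the
  identity block, so the entries are bounded as well.\<close>

lemma isotropic_reduce:
  assumes iso: "isotropic n b" and f0: "\<And>i. i < n \<Longrightarrow> f0 i < 2 * n" "rows_minor n f0 b \<noteq> 0"
  shows "\<exists>b'\<in>reduced_isotropic n. \<exists>s. s \<noteq> 0 \<and>
    (\<forall>f. (\<forall>i<n. f i < 2 * n) \<longrightarrow> rows_minor n f b' = s * rows_minor n f b \<and> cmod (rows_minor n f b') \<le> 1)"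
proof -
  let ?H = "{..<n} \<rightarrow>\<^sub>E {..<2 * n}"
  have finH: "finite ?H" by (intro finite_PiE) auto
  have restr: "restrict f {..<n} \<in> ?H" "rows_minor n (restrict f {..<n}) b = rows_minor n f b"
    if "\<forall>i<n. f i < 2 * n" for f b
    using that by (auto intro!: rows_minor_cong)
  have neH: "?H \<noteq> {}" using restr(1)[of f0] f0(1) by blast
  define M where "M = Max ((\<lambda>f. cmod (rows_minor n f b)) ` ?H)"
  have "M \<in> (\<lambda>f. cmod (rows_minor n f b)) ` ?H" unfolding M_def using finH neH by (intro Max_in) auto
  then obtain f1 where f1: "f1 \<in> ?H" "cmod (rows_minor n f1 b) = M" by auto
  have M: "cmod (rows_minor n f b) \<le> M" if "\<forall>i<n. f i < 2 * n" for f
  proof -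
    have "cmod (rows_minor n (restrict f {..<n}) b) \<le> M"
      unfolding M_def using finH restr(1)[OF that] by (intro Max_ge) auto
    thus ?thesis using restr(2)[OF that] by simp
  qed
  have "M > 0" using M[of f0] f0 by (intro less_le_trans[OF _ M[of f0]]) auto
  hence nz1: "rows_minor n f1 b \<noteq> 0" using f1(2) by auto
  from rows_minor_normalize[OF nz1] obtain c where c: "det (mat n n (\<lambda>(i, j). c i j)) * rows_minor n f1 b = 1"
    "\<forall>i<n. \<forall>j<n. mat_mul n b c (f1 i) j = (if i = j then 1 else 0)" by (elim exE conjE) (rule that)
  define s where "s = det (mat n n (\<lambda>(i, j). c i j))"
  have s_nz: "s \<noteq> 0" using c(1) by (auto simp: s_def)
  have s_M: "cmod s * M = 1" using c(1) f1(2) by (metis s_def norm_mult norm_one)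
  define b' where "b' = (\<lambda>i j. if i < 2 * n \<and> j < n then mat_mul n b c i j else 0)"
  have f1_lt: "f1 i < 2 * n" if "i < n" for i using f1(1) that PiE_mem[of f1 "{..<n}" "\<lambda>_. {..<2 * n}" i] by simp
  have b'_unit: "b' (f1 i) j = (if i = j then 1 else 0)" if "i < n" "j < n" for i j
    using that c(2) f1_lt by (simp add: b'_def)
  have minor: "rows_minor n f b' = s * rows_minor n f b" if "\<forall>i<n. f i < 2 * n" for f
  proof -
    have "rows_minor n f b' = rows_minor n f (mat_mul n b c)"
      by (rule rows_minor_cong) (use that in \<open>simp add: b'_def\<close>)
    thus ?thesis by (simp add: rows_minor_mul s_def)
  qed
  have bound: "cmod (rows_minor n f b') \<le> 1" if "\<forall>i<n. f i < 2 * n" for f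
  proof -
    have "cmod (rows_minor n f b') \<le> cmod s * M"
      unfolding minor[OF that] norm_mult using M[OF that] by (intro mult_left_mono) auto
    thus ?thesis using s_M by simp
  qed
  have entry: "cmod (b' i j) \<le> 1" if ij: "i < 2 * n" "j < n" for i j
  proof -
    have "rows_minor n (f1(j := i)) b' = b' ((f1(j := i)) j) j"
      by (rule rows_minor_unit_rows[OF ij(2)]) (simp add: b'_unit)
    moreover have "cmod (rows_minor n (f1(j := i)) b') \<le> 1"
      by (rule bound) (use ij f1_lt in auto)
    ultimately show ?thesis by simp
  qed
  have "isotropic n b'"
    using isotropic_mul[OF iso, of c] by (simp add: isotropic_def b'_def)
  moreover have "\<forall>i j. b' i j \<in> (if i < 2 * n \<and> j < n then cball 0 1 else {0})"
    using entry by (simp add: b'_def)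
  moreover have "\<exists>f\<in>?H. \<forall>i<n. \<forall>j<n. b' (f i) j = (if i = j then 1 else 0)"
    by (rule bexI[OF _ f1(1)]) (use b'_unit in simp)
  ultimately have "b' \<in> reduced_isotropic n"
    unfolding reduced_isotropic_def by simp
  thus ?thesis using s_nz minor bound by blast
qed

lemma det_nonzero_if_injective:
  fixes J :: "nat \<Rightarrow> nat \<Rightarrow> complex"
  assumes "\<And>x. (\<And>i. i < n \<Longrightarrow> (\<Sum>j<n. J i j * x j) = 0) \<Longrightarrow> \<forall>j<n. x j = 0"
  shows "det (mat n n (\<lambda>(i, j). J i j)) \<noteq> 0"
  using rows_minor_nonzero_iff[of n "\<lambda>i. i" J] assms unfolding rows_minor_def row_val_def by blast

lemma det_nonzero_injective:
  fixes J :: "nat \<Rightarrow> nat \<Rightarrow> complex"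
  assumes "det (mat n n (\<lambda>(i, j). J i j)) \<noteq> 0" "\<And>i. i < n \<Longrightarrow> (\<Sum>j<n. J i j * x j) = 0" "j < n"
  shows "x j = 0"
  using rows_minor_nonzero_iff[of n "\<lambda>i. i" J] assms unfolding rows_minor_def row_val_def by blast

text \<open>Outside \<open>I\<close> the rows are unit rows, so a permutation with a nonzero term
  permutes \<open>I\<close>, and every such term acquires the same factor. This yields the degrees
  of the mixed minors, ordinary and weighted.\<close>

lemma rows_minor_scale:
  assumes I: "I \<subseteq> {..<n}"
    and b': "\<And>i k. i < n \<Longrightarrow> k < n \<Longrightarrow> b' (f i) k = (if i \<in> I then \<rho> i * \<gamma> k * b (f i) k else if i = k then 1 else 0)"
    and b: "\<And>i k. i < n \<Longrightarrow> k < n \<Longrightarrow> i \<notin> I \<Longrightarrow> b (f i) k = (if i = k then 1 else 0)"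
  shows "rows_minor n f b' = (\<Prod>i\<in>I. \<rho> i * \<gamma> i) * rows_minor n f b"
proof -
  have expand: "rows_minor n f b = (\<Sum>p | p permutes {0..<n}. of_int (sign p) * (\<Prod>i\<in>{0..<n}. b (f i) (p i)))" for b
    unfolding rows_minor_def
    by (subst det_def'[where n=n]) (auto intro!: sum.cong prod.cong simp: permutes_in_image)
  have "(\<Prod>i\<in>{0..<n}. b' (f i) (p i)) = (\<Prod>i\<in>I. \<rho> i * \<gamma> i) * (\<Prod>i\<in>{0..<n}. b (f i) (p i))"
    if p: "p permutes {0..<n}" for p
  proof (cases "\<exists>i<n. i \<notin> I \<and> p i \<noteq> i")
    case True
    then obtain i where i: "i < n" "i \<notin> I" "p i \<noteq> i" by (elim exE conjE) (rule that)
    have "p i < n" using permutes_in_image[OF p, of i] i(1) by simp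
    hence "b' (f i) (p i) = 0" "b (f i) (p i) = 0" using i b b' by auto
    hence "(\<Prod>i\<in>{0..<n}. b' (f i) (p i)) = 0" "(\<Prod>i\<in>{0..<n}. b (f i) (p i)) = 0"
      using i(1) by (auto intro: prod_zero)
    thus ?thesis by (simp only: mult_zero_right)
  next
    case False
    hence fix_out: "p i = i" if "i \<notin> I" for i
      using that permutes_not_in[OF p, of i] by (cases "i < n") auto
    have inj: "inj p" using p by (rule permutes_inj)
    have "p ` I \<subseteq> I"
    proof
      fix j assume "j \<in> p ` I"
      then obtain i where i: "i \<in> I" "j = p i" by auto
      show "j \<in> I"
      proof (rule ccontr)
        assume "j \<notin> I"
        hence "p j = p i" using fix_out i(2) by simp
        hence "j = i" using inj by (simp add: inj_eq)
        thus False using i(1) \<open>j \<notin> I\<close> by simp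
      qed
    qed
    moreover have finI: "finite I" using I by (rule finite_subset) simp
    ultimately have bij: "bij_betw p I I"
      using inj_on_subset[OF inj subset_UNIV, of I] by (simp add: bij_betw_def endo_inj_surj)
    have split: "(\<Prod>i\<in>{0..<n}. g i) = (\<Prod>i\<in>I. g i)" if "\<And>i. i < n \<Longrightarrow> i \<notin> I \<Longrightarrow> g i = 1" for g :: "nat \<Rightarrow> complex"
      by (rule prod.mono_neutral_right) (use I that in auto)
    have plt: "p i < n" if "i < n" for i using permutes_in_image[OF p, of i] that by simp
    have "(\<Prod>i\<in>{0..<n}. b' (f i) (p i)) = (\<Prod>i\<in>I. b' (f i) (p i))"
      by (rule split) (use b' fix_out in simp)
    also have "\<dots> = (\<Prod>i\<in>I. \<rho> i * \<gamma> (p i) * b (f i) (p i))"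
      using I plt b' by (intro prod.cong refl) auto
    also have "\<dots> = (\<Prod>i\<in>I. \<rho> i) * (\<Prod>i\<in>I. \<gamma> (p i)) * (\<Prod>i\<in>I. b (f i) (p i))"
      by (simp add: prod.distrib)
    also have "(\<Prod>i\<in>I. \<gamma> (p i)) = (\<Prod>i\<in>I. \<gamma> i)"
      by (rule prod.reindex_bij_betw[OF bij])
    also have "(\<Prod>i\<in>I. b (f i) (p i)) = (\<Prod>i\<in>{0..<n}. b (f i) (p i))"
      by (rule split[symmetric]) (use b fix_out in simp)
    finally show ?thesis by (simp add: prod.distrib)
  qed
  thus ?thesis unfolding expand sum_distrib_left by (intro sum.cong) (simp_all add: mult.left_commute)
qed

section \<open>The Lagrangian Grassmannian as a compactification of its main chart\<close>

context symmetric_coordinates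
begin

lemma chart_PF: "(\<lambda>x. chart I x i k) \<in> polynomial_functions {..<N}"
proof -
  have *: "(\<lambda>x. x (idx i k)) \<in> polynomial_functions {..<N}" if "i < n" "k < n" for i
    using idx(1)[OF that] by (intro coord) simp
  have **: "(\<lambda>x. x (idx (i - n) k)) \<in> polynomial_functions {..<N}" if "i < 2 * n" "k < n"
    using idx(1)[of "i - n" k] that by (intro coord) simp
  consider "i < n \<and> k < n" | "\<not> (i < n \<and> k < n)" "i < 2 * n \<and> k < n" | "\<not> (i < n \<and> k < n)" "\<not> (i < 2 * n \<and> k < n)"
    by blast
  thus ?thesis
  proof cases
    case 1
    thus ?thesis using * by (cases "i \<in> I") (simp_all add: chart_def PF_uminus const)
  next
    case 2
    thus ?thesis using ** by (cases "i - n \<in> I") (simp_all add: chart_def const)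
  next
    case 3
    thus ?thesis by (auto simp: chart_def const)
  qed
qed

lemma rows_minor_chart_PF: "(\<lambda>x. rows_minor n f (chart I x)) \<in> polynomial_functions {..<N}"
  unfolding rows_minor_def by (intro PF_det chart_PF)

lemma mixed_rows_sort:
  assumes "I \<subseteq> {..<n}"
  shows "mixed_rows n I ` {..<n} \<in> pluecker_index n (2 * n)"
    "\<exists>s. s \<noteq> 0 \<and> (\<forall>b. rows_minor n (mixed_rows n I) b = s * rows_minor n (pick (mixed_rows n I ` {..<n})) b)"
  by (rule rows_minor_sort[where m = "2 * n"]; auto simp: mixed_rows_def inj_on_def split: if_splits)+

text \<open>The sign from sorting the mixed rows. It is the constant value on the chart
  \<open>I\<close> of the coordinate that defines this chart, as demanded of each equation in
  \<open>compactified_system\<close>.\<close>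

definition chart_const :: "nat set \<Rightarrow> complex" where
  "chart_const I = rows_minor n (pick (mixed_rows n I ` {..<n})) (chart I (\<lambda>_. 0))"

lemma chart_const:
  assumes "I \<subseteq> {..<n}"
  shows "rows_minor n (pick (mixed_rows n I ` {..<n})) (chart I x) = chart_const I" "chart_const I \<noteq> 0"
proof -
  obtain s where s: "s \<noteq> 0" "\<forall>b. rows_minor n (mixed_rows n I) b = s * rows_minor n (pick (mixed_rows n I ` {..<n})) b"
    using mixed_rows_sort(2)[OF assms] by (elim exE conjE) (rule that)
  have *: "s * rows_minor n (pick (mixed_rows n I ` {..<n})) (chart I x) = 1" for x
    using s(2) rows_minor_chart_self[of I x] by simp
  have "s * rows_minor n (pick (mixed_rows n I ` {..<n})) (chart I x) = s * chart_const I"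
    unfolding chart_const_def * ..
  thus "rows_minor n (pick (mixed_rows n I ` {..<n})) (chart I x) = chart_const I" using s(1) by simp
  show "chart_const I \<noteq> 0" using *[of "\<lambda>_. 0"] by (auto simp: chart_const_def)
qed

lemma mixed_rows_empty: "mixed_rows n {} = (\<lambda>i. i)"
  by (auto simp: mixed_rows_def)

text \<open>Exchanging a single row isolates an entry of the symmetric matrix. So bounds and
  proportionality of Pluecker coordinates pass to the chart coordinates.\<close>

lemma coordinate_minor:
  assumes "u < N"
  shows "rows_minor n ((\<lambda>i. i)(fst (\<sigma> u) := n + snd (\<sigma> u))) (chart {} x) = x u"
proof -
  let ?i = "fst (\<sigma> u)" and ?k = "snd (\<sigma> u)"
  have ik: "?i < n" "?k < n" using \<sigma>_props[OF assms] by auto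
  have "rows_minor n ((\<lambda>i. i)(?i := n + ?k)) (chart {} x) = chart {} x (((\<lambda>i. i)(?i := n + ?k)) ?i) ?i"
    by (rule rows_minor_unit_rows[OF ik(1)]) (simp add: chart_upper)
  also have "\<dots> = x (idx ?k ?i)" using ik by (simp add: chart_lower)
  also have "\<dots> = x u" using idx_\<sigma>[OF assms] by (simp add: idx_sym)
  finally show ?thesis .
qed

text \<open>The boundary of the main chart is the hyperplane section on which the minor of the first
  \<open>n\<close> rows vanishes. By \<open>isotropic_mixed_minor\<close> it is covered by the
  charts with \<open>I \<noteq> {}\<close>.\<close>

sublocale LG: compactified_system N "\<lambda>_. pluecker_index n (2 * n)" "\<lambda>e I x. rows_minor n (pick I) (chart {} x)"
  "reduced_isotropic n" "rows_minor n (\<lambda>i. i)" "\<lambda>e I. rows_minor n (pick I)" 1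
  "Pow {..<n} - {{}}" "\<lambda>I e J x. rows_minor n (pick J) (chart I x)" "\<lambda>I x. rows_minor n (\<lambda>i. i) (chart I x)"
  "\<lambda>I e. mixed_rows n I ` {..<n}" "\<lambda>I e. chart_const I"
  "\<lambda>e. mixed_rows n {} ` {..<n}" "\<lambda>e. chart_const {}"
proof
  show "finite (pluecker_index n (2 * n))" by (rule pluecker_index_finite)
  show "compact (reduced_isotropic n)" by (rule compact_reduced_isotropic)
  show "finite (Pow {..<n} - {{}})" by simp
next
  fix x :: "nat \<Rightarrow> complex"
  have "\<exists>b'\<in>reduced_isotropic n. \<exists>s. s \<noteq> 0 \<and> (\<forall>f. (\<forall>i<n. f i < 2 * n) \<longrightarrow>
      rows_minor n f b' = s * rows_minor n f (chart {} x) \<and> cmod (rows_minor n f b') \<le> 1)"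
    by (rule isotropic_reduce[OF isotropic_chart, of "\<lambda>i. i"])
      (use rows_minor_chart_self[of "{}" x] in \<open>auto simp: mixed_rows_empty\<close>)
  then obtain b' s where b': "b' \<in> reduced_isotropic n" "s \<noteq> 0" "\<forall>f. (\<forall>i<n. f i < 2 * n) \<longrightarrow>
      rows_minor n f b' = s * rows_minor n f (chart {} x) \<and> cmod (rows_minor n f b') \<le> 1"
    by (elim bexE exE conjE) (rule that)
  have 0: "rows_minor n (\<lambda>i. i) b' = s"
    using b'(3)[rule_format, of "\<lambda>i. i"] rows_minor_chart_self[of "{}" x] by (simp add: mixed_rows_empty)
  show "\<exists>c\<in>reduced_isotropic n. \<exists>s. (\<forall>e<N. s e \<noteq> 0) \<and>
      (\<forall>e<N. \<forall>I\<in>pluecker_index n (2 * n). rows_minor n (pick I) c = s e * rows_minor n (pick I) (chart {} x)) \<and>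
      (\<forall>u<N. cmod (x u) * cmod (rows_minor n (\<lambda>i. i) c) \<le> 1)"
  proof (intro bexI[OF _ b'(1)] exI[of _ "\<lambda>_. s"] conjI allI impI ballI)
    show "rows_minor n (pick I) b' = s * rows_minor n (pick I) (chart {} x)"
      if "I \<in> pluecker_index n (2 * n)" for I
      using b'(3) pick_bij(2)[OF that] by simp
    fix u assume u: "u < N"
    let ?f = "(\<lambda>i. i)(fst (\<sigma> u) := n + snd (\<sigma> u))"
    have f: "\<forall>i<n. ?f i < 2 * n" using \<sigma>_props[OF u] by simp
    have "rows_minor n ?f b' = s * x u"
      using b'(3) f coordinate_minor[OF u, of x] by simp
    moreover have "cmod (rows_minor n ?f b') \<le> 1" using b'(3) f by blast
    ultimately have "cmod (s * x u) \<le> 1" by simp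
    thus "cmod (x u) * cmod (rows_minor n (\<lambda>i. i) b') \<le> 1"
      by (simp add: 0 norm_mult mult.commute)
  qed (use b'(2) in simp)
next
  fix I assume "I \<in> Pow {..<n} - {{}}"
  \<comment> \<open>The diagonal matrix with entries \<open>- 1\<close> turns the upper rows into
    the identity, so the boundary is not the entire chart.\<close>
  have "rows_minor n (\<lambda>i. i) (chart I (\<lambda>u. if u < n then - 1 else 0)) = det (1\<^sub>m n)"
    unfolding rows_minor_def
  proof (intro arg_cong[of _ _ det] eq_matI)
    fix i j assume ij: "i < dim_row (1\<^sub>m n :: complex mat)" "j < dim_col (1\<^sub>m n :: complex mat)"
    have "idx i j < n \<longleftrightarrow> i = j"
    proof
      assume "idx i j < n"
      thus "i = j" using \<sigma>_diag[of "idx i j"] idx(2)[of i j] ij by (auto simp: min_def max_def split: if_splits)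
    next
      assume "i = j"
      hence "idx i j = i" using idx_\<sigma>[of i] \<sigma>_diag[of i] n_le_N ij by simp
      thus "idx i j < n" using ij by simp
    qed
    thus "mat n n (\<lambda>(i, j). chart I (\<lambda>u. if u < n then - 1 else 0) i j) $$ (i, j) = 1\<^sub>m n $$ (i, j)"
      using ij by (auto simp: chart_upper)
  qed auto
  thus "\<exists>x. rows_minor n (\<lambda>i. i) (chart I x) \<noteq> 0"
    by (intro exI[of _ "\<lambda>u. if u < n then - 1 else 0"]) simp
next
  fix b assume b: "b \<in> reduced_isotropic n" "rows_minor n (\<lambda>i. i) b = 0"
  then obtain f where f: "f \<in> {..<n} \<rightarrow>\<^sub>E {..<2 * n}" "\<forall>i<n. \<forall>j<n. b (f i) j = (if i = j then 1 else 0)"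
    unfolding reduced_isotropic_def by auto
  have iso: "isotropic n b" using b(1) by (simp add: reduced_isotropic_def)
  have "rows_minor n f b = det (1\<^sub>m n)"
    unfolding rows_minor_def by (intro arg_cong[of _ _ det] eq_matI) (use f(2) in auto)
  hence nz: "rows_minor n f b \<noteq> 0" by simp
  have f_lt: "f i < 2 * n" if "i < n" for i using f(1) that PiE_mem[of f "{..<n}" "\<lambda>_. {..<2 * n}" i] by simp
  have "full_rank n b" by (rule rows_minor_full_rank[OF _ nz]) (rule f_lt)
  from isotropic_mixed_minor[OF iso this] obtain I where
    I: "I \<subseteq> {..<n}" "rows_minor n (mixed_rows n I) b \<noteq> 0" by blast
  have "I \<noteq> {}" using I(2) b(2) by (auto simp: mixed_rows_empty)
  hence I': "I \<in> Pow {..<n} - {{}}" using I(1) by simp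
  from isotropic_to_chart[OF iso I(2,1)] obtain x where x: "\<forall>f. (\<forall>i<n. f i < 2 * n) \<longrightarrow>
     rows_minor n f b = rows_minor n (mixed_rows n I) b * rows_minor n f (chart I x)"
    by (elim exE conjE) (rule that)
  show "\<exists>I\<in>Pow {..<n} - {{}}. \<exists>x s. (\<forall>e<N. s e \<noteq> 0) \<and>
      (\<forall>e<N. \<forall>J\<in>pluecker_index n (2 * n). rows_minor n (pick J) b = s e * rows_minor n (pick J) (chart I x)) \<and>
      rows_minor n (\<lambda>i. i) (chart I x) = 0"
  proof (rule bexI[OF _ I'], rule exI[of _ x], rule exI[of _ "\<lambda>_. rows_minor n (mixed_rows n I) b"],
      intro conjI allI impI ballI I(2))
    show "rows_minor n (pick J) b = rows_minor n (mixed_rows n I) b * rows_minor n (pick J) (chart I x)"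
      if "J \<in> pluecker_index n (2 * n)" for J
      using x pick_bij(2)[OF that] by simp
    show "rows_minor n (\<lambda>i. i) (chart I x) = 0"
      using x[rule_format, of "\<lambda>i. i"] b(2) I(2) by simp
  qed
qed (auto intro!: rows_minor_chart_PF continuous_on_rows_minor mixed_rows_sort(1) chart_const)

end

subsection \<open>A special linear section\<close>

definition form_coeff :: "nat \<Rightarrow> ((nat \<Rightarrow> nat \<Rightarrow> complex) \<Rightarrow> complex) \<Rightarrow> nat set \<Rightarrow> complex" where
  "form_coeff n G = (SOME c. \<forall>b. G b = (\<Sum>I\<in>pluecker_index n (2 * n). c I * rows_minor n (pick I) b))"

lemma form_coeff:
  assumes "pluecker_form n G"
  shows "(\<Sum>I\<in>pluecker_index n (2 * n). form_coeff n G I * rows_minor n (pick I) b) = G b"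
  using someI_ex[OF assms[unfolded pluecker_form_def], folded form_coeff_def] by (rule allE) (rule sym)

context symmetric_coordinates
begin

lemma idx_diag: "m < n \<Longrightarrow> idx m m = m"
  using idx_\<sigma>[of m] \<sigma>_diag[of m] n_le_N by simp

text \<open>
  The forms \<open>top_form e\<close> add up the principal Pluecker coordinates of the same rank \<open>e + 1\<close> in the
  Bruhat order. They are weighted homogeneous and vanish simultaneously only at the origin of the main chart.
\<close>

definition top_form :: "nat \<Rightarrow> (nat \<Rightarrow> nat \<Rightarrow> complex) \<Rightarrow> complex" where
  "top_form e b = (\<Sum>I | I \<subseteq> {..<n} \<and> weight I = e + 1. rows_minor n (mixed_rows n I) b)"

text \<open>In the main chart this is the coordinate with index \<open>e\<close>. It is added for
  \<open>e \<ge> n\<close> only, as \<open>top_form e\<close> already has a linear part for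
  \<open>e < n\<close>.\<close>

definition lin_form :: "nat \<Rightarrow> (nat \<Rightarrow> nat \<Rightarrow> complex) \<Rightarrow> complex" where
  "lin_form e b = (if e < n then 0 else rows_minor n ((\<lambda>i. i)(fst (\<sigma> e) := n + snd (\<sigma> e))) b)"

text \<open>
  The term with \<open>\<epsilon>\<close> makes the zero at the origin nondegenerate, and a general \<open>c\<close> all the others.
\<close>

definition special :: "complex \<Rightarrow> (nat \<Rightarrow> complex) \<Rightarrow> nat \<times> nat set \<Rightarrow> complex" where
  "special \<epsilon> c = (\<lambda>(e, I). form_coeff n (top_form e) I + \<epsilon> * form_coeff n (lin_form e) I
     - c e * form_coeff n (rows_minor n (\<lambda>i. i)) I)"

lemma pluecker_form_top: "pluecker_form n (top_form e)"
  unfolding top_form_def[abs_def]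
  by (intro pluecker_form_sum pluecker_form_rows_minor) (auto simp: mixed_rows_def)

lemma pluecker_form_lin: "e < N \<Longrightarrow> pluecker_form n (lin_form e)"
  unfolding lin_form_def[abs_def]
  by (cases "e < n") (use \<sigma>_props[of e] in \<open>auto intro!: pluecker_form_rows_minor simp: pluecker_form_zero\<close>)

lemma special_sys:
  assumes "e < N"
  shows "lin_sys (\<lambda>_. pluecker_index n (2 * n)) (\<lambda>e I. rows_minor n (pick I)) (special \<epsilon> c) e b =
    top_form e b + \<epsilon> * lin_form e b - c e * rows_minor n (\<lambda>i. i) b"
proof -
  have id: "pluecker_form n (rows_minor n (\<lambda>i. i))" by (rule pluecker_form_rows_minor) simp
  have "lin_sys (\<lambda>_. pluecker_index n (2 * n)) (\<lambda>e I. rows_minor n (pick I)) (special \<epsilon> c) e b =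
    (\<Sum>I\<in>pluecker_index n (2 * n). form_coeff n (top_form e) I * rows_minor n (pick I) b) +
    \<epsilon> * (\<Sum>I\<in>pluecker_index n (2 * n). form_coeff n (lin_form e) I * rows_minor n (pick I) b) -
    c e * (\<Sum>I\<in>pluecker_index n (2 * n). form_coeff n (rows_minor n (\<lambda>i. i)) I * rows_minor n (pick I) b)"
    unfolding lin_sys_def special_def
    by (simp add: sum_distrib_left sum.distrib sum_subtractf ring_distribs mult.assoc)
  thus ?thesis unfolding form_coeff[OF pluecker_form_top] form_coeff[OF pluecker_form_lin[OF assms]] form_coeff[OF id] .
qed

lemma weight_le:
  assumes "I \<subseteq> {..<n}"
  shows "weight I \<le> N" "I \<noteq> {} \<Longrightarrow> weight I > 0"
proof -
  have "weight I \<le> weight {..<n}" unfolding weight_def using assms by (intro sum_mono2) auto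
  also have "weight {..<n} = N"
  proof -
    have "2 * (\<Sum>i<m. i + 1) = m * (m + 1)" for m :: nat by (induction m) auto
    thus ?thesis unfolding N weight_def by (metis nonzero_mult_div_cancel_left zero_neq_numeral)
  qed
  finally show "weight I \<le> N" .
  assume "I \<noteq> {}"
  moreover have "finite I" using assms by (rule finite_subset) simp
  ultimately show "weight I > 0" unfolding weight_def by (intro sum_pos) auto
qed

text \<open>Take the dominant set \<open>I\<close>. If it is nonempty, its weight is
  \<open>e + 1\<close> for some \<open>e < N\<close> and \<open>top_form e\<close> reduces to the
  one nonzero minor on \<open>I\<close>. If it is empty, its weight is \<open>0\<close> and
  dominance makes all other mixed minors vanish.\<close>

lemma top_form_dichotomy:
  assumes iso: "isotropic n b" and full: "full_rank n b"
  shows "(\<exists>e<N. top_form e b \<noteq> 0) \<or>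
    (rows_minor n (\<lambda>i. i) b \<noteq> 0 \<and> (\<forall>J\<subseteq>{..<n}. J \<noteq> {} \<longrightarrow> rows_minor n (mixed_rows n J) b = 0))"
proof -
  have "\<exists>I\<subseteq>{..<n}. rows_minor n (mixed_rows n I) b \<noteq> 0 \<and>
    (\<forall>I'\<subseteq>{..<n}. I' \<noteq> I \<longrightarrow> weight I \<le> weight I' \<longrightarrow> rows_minor n (mixed_rows n I') b = 0)"
    by (rule exists_dominant_mixed_minor[OF iso full])
  then obtain I where I: "I \<subseteq> {..<n}"
    "rows_minor n (mixed_rows n I) b \<noteq> 0"
    "\<forall>I'\<subseteq>{..<n}. I' \<noteq> I \<longrightarrow> weight I \<le> weight I' \<longrightarrow> rows_minor n (mixed_rows n I') b = 0"
    by (elim exE conjE) (rule that)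
  show ?thesis
  proof (cases "I = {}")
    case True
    have "weight {} = 0" by (simp add: weight_def)
    thus ?thesis using I True by (simp add: mixed_rows_empty)
  next
    case False
    define e where "e = weight I - 1"
    have e: "weight I = e + 1" "e < N" using weight_le[OF I(1)] False by (auto simp: e_def)
    have "top_form e b = (\<Sum>I'\<in>{I}. rows_minor n (mixed_rows n I') b)"
      unfolding top_form_def
    proof (rule sum.mono_neutral_right)
      show "finite {I. I \<subseteq> {..<n} \<and> weight I = e + 1}" by (rule finite_subset[of _ "Pow {..<n}"]) auto
    qed (use I e in auto)
    hence "top_form e b \<noteq> 0" using I(2) by simp
    thus ?thesis using e(2) by blast
  qed
qed

text \<open>At a common zero all nonempty principal minors vanish by
  \<open>top_form_dichotomy\<close>, and a symmetric matrix with vanishing principal minors of sizes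
  one and two is zero.\<close>

lemma top_forms_vanish_at_origin:
  assumes "\<And>e. e < N \<Longrightarrow> top_form e (chart {} x) = 0" "u < N"
  shows "x u = 0"
proof -
  have "rows_minor n (mixed_rows n {}) (chart {} x) = 1" by (rule rows_minor_chart_self)
  hence "rows_minor n (\<lambda>i. i) (chart {} x) \<noteq> 0" by (simp add: mixed_rows_empty)
  hence "full_rank n (chart {} x)" by (rule rows_minor_full_rank[rotated]) simp
  from top_form_dichotomy[OF isotropic_chart this] assms(1)
  have zero: "rows_minor n (mixed_rows n J) (chart {} x) = 0" if "J \<subseteq> {..<n}" "J \<noteq> {}" for J
    using that by auto
  have diag: "x (idx m m) = 0" if "m < n" for m
  proof (rule ccontr)
    assume "x (idx m m) \<noteq> 0"
    from chart_rank_one_exchange[where x=x, OF empty_subsetI that this] zero[of "{m}"] that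
    show False by simp
  qed
  have "x (idx m k) = 0" if mk: "m < n" "k < n" for m k
  proof (rule ccontr)
    assume nz: "x (idx m k) \<noteq> 0"
    hence "m \<noteq> k" using diag mk by auto
    from chart_rank_two_exchange[where x=x, OF empty_subsetI mk this diag[OF mk(1)] nz] zero[of "{m, k}"] mk
    show False by simp
  qed
  from this[of "fst (\<sigma> u)" "snd (\<sigma> u)"] show ?thesis
    using \<sigma>_props[OF assms(2)] idx_\<sigma>[OF assms(2)] by simp
qed

lemma admissible_special_zero: "LG.admissible (special 0 c)"
  unfolding LG.admissible_def
proof (intro ballI impI)
  fix b assume b: "b \<in> reduced_isotropic n" "rows_minor n (\<lambda>i. i) b = 0"
  then obtain f where f: "f \<in> {..<n} \<rightarrow>\<^sub>E {..<2 * n}" "\<forall>i<n. \<forall>j<n. b (f i) j = (if i = j then 1 else 0)"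
    unfolding reduced_isotropic_def by auto
  have iso: "isotropic n b" using b(1) by (simp add: reduced_isotropic_def)
  have "rows_minor n f b = det (1\<^sub>m n)"
    unfolding rows_minor_def by (intro arg_cong[of _ _ det] eq_matI) (use f(2) in auto)
  hence nz: "rows_minor n f b \<noteq> 0" by simp
  have f_lt: "f i < 2 * n" if "i < n" for i using f(1) that PiE_mem[of f "{..<n}" "\<lambda>_. {..<2 * n}" i] by simp
  have "full_rank n b" by (rule rows_minor_full_rank[OF _ nz]) (rule f_lt)
  from top_form_dichotomy[OF iso this] b(2) obtain e where "e < N" "top_form e b \<noteq> 0" by auto
  thus "\<exists>e<N. lin_sys (\<lambda>_. pluecker_index n (2 * n)) (\<lambda>e I. rows_minor n (pick I)) (special 0 c) e b \<noteq> 0"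
    by (intro exI[of _ e]) (simp add: special_sys b(2))
qed

text \<open>Admissibility is an open condition, so it survives a small \<epsilon>. The right hand
  sides \<open>c\<close> multiply the minor that vanishes on the boundary, so a single \<epsilon>
  serves all \<open>c\<close>.\<close>

lemma ex_admissible_special: "\<exists>\<epsilon>. \<epsilon> \<noteq> 0 \<and> (\<forall>c. LG.admissible (special \<epsilon> c))"
proof -
  define l where "l = (\<lambda>t p. special 0 (\<lambda>_. 0) p + t * (case p of (e, I) \<Rightarrow> form_coeff n (lin_form e) I))"
  have l: "l t = special t (\<lambda>_. 0)" for t by (auto simp: l_def special_def)
  have "(l \<longlongrightarrow> l 0) (nhds 0)" unfolding l_def by (rule tendsto_line)
  from eventually_compose_filterlim[OF LG.admissible_near(1)[OF admissible_special_zero[of "\<lambda>_. 0"]]] this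
  have "\<forall>\<^sub>F t in nhds 0. LG.admissible (special t (\<lambda>_. 0))" unfolding l by blast
  hence "\<forall>\<^sub>F t in at (0::complex). LG.admissible (special t (\<lambda>_. 0)) \<and> t \<noteq> 0"
    unfolding eventually_at_filter by (rule eventually_mono) simp
  then obtain \<epsilon> where \<epsilon>: "LG.admissible (special \<epsilon> (\<lambda>_. 0))" "\<epsilon> \<noteq> 0"
    using eventually_happens'[OF at_neq_bot] by blast
  have "LG.admissible (special \<epsilon> c)" for c
    unfolding LG.admissible_def
  proof (intro ballI impI)
    fix b assume b: "b \<in> reduced_isotropic n" "rows_minor n (\<lambda>i. i) b = 0"
    then obtain e where e: "e < N" "lin_sys (\<lambda>_. pluecker_index n (2 * n)) (\<lambda>e I. rows_minor n (pick I)) (special \<epsilon> (\<lambda>_. 0)) e b \<noteq> 0"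
      using \<epsilon>(1) unfolding LG.admissible_def by blast
    thus "\<exists>e<N. lin_sys (\<lambda>_. pluecker_index n (2 * n)) (\<lambda>e I. rows_minor n (pick I)) (special \<epsilon> c) e b \<noteq> 0"
      by (intro exI[of _ e]) (simp add: special_sys b(2))
  qed
  thus ?thesis using \<epsilon>(2) by blast
qed

definition main_poly :: "complex \<Rightarrow> nat \<Rightarrow> (nat \<Rightarrow> complex) \<Rightarrow> complex" where
  "main_poly \<epsilon> e x = top_form e (chart {} x) + (if e < n then 0 else \<epsilon> * x e)"

lemma special_sys_chart:
  assumes "e < N"
  shows "lin_sys (\<lambda>_. pluecker_index n (2 * n)) (\<lambda>e I x. rows_minor n (pick I) (chart {} x)) (special \<epsilon> c) e x =
    main_poly \<epsilon> e x - c e"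
proof -
  have "lin_sys (\<lambda>_. pluecker_index n (2 * n)) (\<lambda>e I x. rows_minor n (pick I) (chart {} x)) (special \<epsilon> c) e x =
    lin_sys (\<lambda>_. pluecker_index n (2 * n)) (\<lambda>e I. rows_minor n (pick I)) (special \<epsilon> c) e (chart {} x)"
    by (simp add: lin_sys_def)
  also have "\<dots> = top_form e (chart {} x) + \<epsilon> * lin_form e (chart {} x) - c e"
    using special_sys[OF assms] rows_minor_chart_self[of "{}" x] by (simp add: mixed_rows_empty)
  also have "lin_form e (chart {} x) = (if e < n then 0 else x e)"
    by (simp add: lin_form_def coordinate_minor[OF assms])
  finally show ?thesis by (simp add: main_poly_def)
qed

lemma main_poly_PF: "e < N \<Longrightarrow> main_poly \<epsilon> e \<in> polynomial_functions {..<N}"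
  unfolding main_poly_def[abs_def] top_form_def
  by (cases "e < n") (auto intro!: add PF_sum rows_minor_chart_PF PF_cmult coord const)

lemma zeros_special:
  "LG.zeros (special \<epsilon> c) = {x. (\<forall>u\<ge>N. x u = 0) \<and> (\<forall>e<N. main_poly \<epsilon> e x = c e)}"
  unfolding LG.zeros_def by (auto simp: special_sys_chart)

lemma pd_main_poly_special:
  assumes "e < N" "u < N"
  shows "pd u (lin_sys (\<lambda>_. pluecker_index n (2 * n)) (\<lambda>e I x. rows_minor n (pick I) (chart {} x)) (special \<epsilon> c) e) x =
    pd u (main_poly \<epsilon> e) x"
proof -
  have "lin_sys (\<lambda>_. pluecker_index n (2 * n)) (\<lambda>e I x. rows_minor n (pick I) (chart {} x)) (special \<epsilon> c) e =
    (\<lambda>x. main_poly \<epsilon> e x - c e)"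
    using special_sys_chart[OF assms(1)] by (intro ext) simp
  moreover have "((\<lambda>t. main_poly \<epsilon> e (x(u := t)) - c e) has_field_derivative pd u (main_poly \<epsilon> e) x - 0) (at (x u))"
    by (intro DERIV_diff DERIV_const PF_has_deriv[of "{..<N}"] main_poly_PF) (use assms in auto)
  ultimately show ?thesis by (intro pd_eqI) simp
qed

lemma jacobian_special:
  "LG.jacobian (special \<epsilon> c) x = det (mat N N (\<lambda>(e, u). pd u (main_poly \<epsilon> e) x))"
  unfolding LG.jacobian_def by (intro arg_cong[of _ _ det] eq_matI) (simp_all add: pd_main_poly_special)

lemma mixed_minor_at_axis:
  fixes u :: nat and t :: complex
  assumes "I \<subseteq> {..<n}"
  shows "rows_minor n (mixed_rows n I) (chart {} ((\<lambda>_. 0)(u := t))) =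
    t ^ card I * rows_minor n (mixed_rows n I) (chart {} ((\<lambda>_. 0)(u := 1)))"
proof -
  have "rows_minor n (mixed_rows n I) (chart {} ((\<lambda>_. 0)(u := t))) =
    (\<Prod>i\<in>I. t * 1) * rows_minor n (mixed_rows n I) (chart {} ((\<lambda>_. 0)(u := 1)))"
    by (rule rows_minor_scale[OF assms]) (use assms in \<open>auto simp: mixed_rows_def chart_upper chart_lower\<close>)
  thus ?thesis by simp
qed

text \<open>Along a coordinate axis a principal minor is homogeneous of degree
  \<open>card I\<close>, so linear terms come from singletons only. The singleton of weight
  \<open>e + 1\<close> is \<open>{e}\<close>, which is available exactly for
  \<open>e < n\<close>.\<close>

lemma pd_main_poly_zero:
  assumes e: "e < N" and u: "u < N"
  shows "pd u (main_poly \<epsilon> e) (\<lambda>_. 0) = (if e = u then if e < n then 1 else \<epsilon> else 0)"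
proof (rule pd_eqI)
  let ?W = "{I. I \<subseteq> {..<n} \<and> weight I = e + 1}"
  let ?C = "\<lambda>I. rows_minor n (mixed_rows n I) (chart {} ((\<lambda>_. 0)(u := 1)))"
  have finW: "finite ?W" by (rule finite_subset[of _ "Pow {..<n}"]) auto
  have fin: "finite I" if "I \<in> ?W" for I using that by (auto intro: finite_subset)
  have "((\<lambda>t. (\<Sum>I\<in>?W. t ^ card I * ?C I) + (if e < n then 0 else \<epsilon> * (if e = u then t else 0)))
     has_field_derivative (\<Sum>I\<in>?W. (of_nat (card I) * (1 * 0 ^ (card I - Suc 0))) * ?C I) + (if e < n then 0 else \<epsilon> * (if e = u then 1 else 0))) (at 0)"
    by (intro DERIV_add DERIV_sum DERIV_cmult_right DERIV_power DERIV_ident) (auto intro!: derivative_eq_intros)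
  also have "(\<lambda>t. (\<Sum>I\<in>?W. t ^ card I * ?C I) + (if e < n then 0 else \<epsilon> * (if e = u then t else 0))) =
     (\<lambda>t. main_poly \<epsilon> e ((\<lambda>_. 0)(u := t)))"
  proof
    fix t
    have "top_form e (chart {} ((\<lambda>_. 0)(u := t))) = (\<Sum>I\<in>?W. t ^ card I * ?C I)"
      unfolding top_form_def by (intro sum.cong refl mixed_minor_at_axis) simp
    thus "(\<Sum>I\<in>?W. t ^ card I * ?C I) + (if e < n then 0 else \<epsilon> * (if e = u then t else 0)) =
        main_poly \<epsilon> e ((\<lambda>_. 0)(u := t))"
      by (simp only: main_poly_def fun_upd_apply)
  qed
  also have "(\<Sum>I\<in>?W. (of_nat (card I) * (1 * 0 ^ (card I - Suc 0))) * ?C I) = (if e < n \<and> e = u then 1 else 0)"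
  proof (cases "e < n")
    case True
    have "(\<Sum>I\<in>?W. (of_nat (card I) * (1 * 0 ^ (card I - Suc 0))) * ?C I) = (\<Sum>I\<in>{{e}}. ?C I)"
    proof (rule sum.mono_neutral_cong_right[OF finW])
      show "{{e}} \<subseteq> ?W" using True by (simp add: weight_def)
      show "\<forall>I\<in>?W - {{e}}. (of_nat (card I) * (1 * 0 ^ (card I - Suc 0))) * ?C I = 0"
      proof
        fix I assume I: "I \<in> ?W - {{e}}"
        have "card I \<noteq> 1"
        proof
          assume "card I = 1"
          then obtain m where "I = {m}" by (rule card_1_singletonE)
          thus False using I by (simp add: weight_def)
        qed
        thus "(of_nat (card I) * (1 * 0 ^ (card I - Suc 0))) * ?C I = 0" by (cases "card I") auto
      qed
    qed simp
    also have "\<dots> = rows_minor n (mixed_rows n {e}) (chart {} ((\<lambda>_. 0)(u := 1)))" by simp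
    also have "\<dots> = chart {} ((\<lambda>_. 0)(u := 1)) (mixed_rows n {e} e) e"
      by (rule rows_minor_unit_rows[OF True]) (simp add: mixed_rows_def chart_upper)
    also have "\<dots> = (if e = u then 1 else 0)"
      using True by (simp add: mixed_rows_def chart_lower idx_diag)
    finally show ?thesis using True by simp
  next
    case False
    have "(of_nat (card I) * (1 * 0 ^ (card I - Suc 0))) * ?C I = 0" if I: "I \<in> ?W" for I
    proof -
      have "card I \<noteq> 1"
      proof
        assume "card I = 1"
        then obtain m where "I = {m}" by (rule card_1_singletonE)
        thus False using I False by (simp add: weight_def)
      qed
      thus ?thesis by (cases "card I") auto
    qed
    thus ?thesis using False by (simp add: sum.neutral)
  qed
  finally show "((\<lambda>t. main_poly \<epsilon> e ((\<lambda>_. 0)(u := t))) has_field_derivative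
     (if e = u then if e < n then 1 else \<epsilon> else 0)) (at ((\<lambda>_. 0) u))"
    by (cases "e = u"; cases "e < n") (simp_all add: fun_upd_def)
qed

lemma main_poly_zero: "e < N \<Longrightarrow> main_poly \<epsilon> e (\<lambda>_. 0) = 0"
proof -
  assume e: "e < N"
  have "top_form e (chart {} (\<lambda>_. 0)) = 0"
    unfolding top_form_def
  proof (rule sum.neutral, rule ballI)
    fix I assume I: "I \<in> {I. I \<subseteq> {..<n} \<and> weight I = e + 1}"
    hence "card I \<noteq> 0" by (auto simp: weight_def card_eq_0_iff dest: finite_subset)
    hence "(0::complex) ^ card I = 0" by simp
    show "rows_minor n (mixed_rows n I) (chart {} (\<lambda>_. 0)) = 0"
    proof -
      have eq: "(\<lambda>_. 0)(0 := 0) = (\<lambda>_ :: nat. 0 :: complex)" by auto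
      show ?thesis using mixed_minor_at_axis[of I 0 0, unfolded eq] I \<open>(0::complex) ^ card I = 0\<close> by simp
    qed
  qed
  thus ?thesis by (simp add: main_poly_def)
qed

definition main_jacobian :: "complex \<Rightarrow> (nat \<Rightarrow> complex) \<Rightarrow> complex" where
  "main_jacobian \<epsilon> x = det (mat N N (\<lambda>(e, u). pd u (main_poly \<epsilon> e) x))"

lemma main_jacobian_zero: "\<epsilon> \<noteq> 0 \<Longrightarrow> main_jacobian \<epsilon> (\<lambda>_. 0) \<noteq> 0"
  unfolding main_jacobian_def
proof (rule det_nonzero_if_injective)
  fix x assume \<epsilon>: "\<epsilon> \<noteq> 0" and x: "\<And>e. e < N \<Longrightarrow> (\<Sum>u<N. pd u (main_poly \<epsilon> e) (\<lambda>_. 0) * x u) = 0"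
  show "\<forall>e<N. x e = 0"
  proof (intro allI impI)
    fix e assume e: "e < N"
    have "(\<Sum>u<N. pd u (main_poly \<epsilon> e) (\<lambda>_. 0) * x u) = (\<Sum>u<N. if e = u then (if e < n then 1 else \<epsilon>) * x u else 0)"
      using e by (intro sum.cong) (auto simp: pd_main_poly_zero)
    also have "\<dots> = (if e < n then 1 else \<epsilon>) * x e" using e by simp
    finally show "x e = 0" using x[OF e] \<epsilon> by (auto split: if_splits)
  qed
qed

text \<open>The values of the system on the hypersurface where the Jacobian or a coordinate vanishes
  satisfy a polynomial relation by \<open>image_of_hypersurface\<close>, an algebraic substitute for
  Sard's theorem; \<open>c\<close> is chosen to violate it.\<close>

lemma ex_regular_special:
  assumes "\<epsilon> \<noteq> 0"
  shows "\<exists>c. \<forall>x. (\<forall>e<N. main_poly \<epsilon> e x = c e) \<longrightarrow> main_jacobian \<epsilon> x \<noteq> 0 \<and> (\<forall>u<N. x u \<noteq> 0)"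
proof -
  have J_PF: "main_jacobian \<epsilon> \<in> polynomial_functions {..<N}"
    unfolding main_jacobian_def[abs_def] by (intro PF_det PF_pd main_poly_PF) auto
  have X_PF: "(\<lambda>x. \<Prod>u<N. x u) \<in> polynomial_functions {..<N}" by (intro PF_prod coord)
  have "(\<Prod>u<N. (\<lambda>_. 1 :: complex) u) \<noteq> 0" by simp
  from PF_domain[where F="main_jacobian \<epsilon>" and G="\<lambda>x. \<Prod>u<N. x u", OF J_PF main_jacobian_zero[OF assms] X_PF this]
  obtain w0 where w0: "main_jacobian \<epsilon> w0 \<noteq> 0" "(\<Prod>u<N. w0 u) \<noteq> 0" by (elim exE conjE) (rule that)
  define h where "h = (\<lambda>x. main_jacobian \<epsilon> x * (\<Prod>u<N. x u))"
  have h_PF: "h \<in> polynomial_functions {..<N}" unfolding h_def by (intro mult J_PF X_PF)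
  have h0: "h w0 \<noteq> 0" using w0 by (simp add: h_def)
  have \<Phi>_PF: "\<And>e. e \<in> {..<N} \<Longrightarrow> main_poly \<epsilon> e \<in> polynomial_functions {..<N}" by (simp add: main_poly_PF)
  from image_of_hypersurface[where \<Phi>="main_poly \<epsilon>" and h=h, OF finite_lessThan finite_lessThan order_refl \<Phi>_PF h_PF h0]
  obtain F where F: "F \<in> polynomial_functions {..<N}" "\<exists>a. F a \<noteq> 0"
    "\<forall>w. h w = 0 \<longrightarrow> F (\<lambda>e. main_poly \<epsilon> e w) = 0" by auto
  obtain c where c: "F c \<noteq> 0" using F(2) ..
  show ?thesis
  proof (intro exI[of _ c] allI impI)
    fix x assume "\<forall>e<N. main_poly \<epsilon> e x = c e"
    hence "F (\<lambda>e. main_poly \<epsilon> e x) = F c" by (intro PF_cong[OF F(1)]) simp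
    hence "h x \<noteq> 0" using c F(3) by metis
    thus "main_jacobian \<epsilon> x \<noteq> 0 \<and> (\<forall>u<N. x u \<noteq> 0)" by (simp add: h_def)
  qed
qed

end

subsection \<open>Weighted Bezout count of the special section\<close>

lemma card_coordinatewise_roots:
  fixes x :: "nat \<Rightarrow> complex"
  assumes "\<And>u. u < N \<Longrightarrow> x u \<noteq> 0" "\<And>u. u < N \<Longrightarrow> k u > 0"
  shows "card {y. (\<forall>u\<ge>N. y u = 0) \<and> (\<forall>u<N. y u ^ k u = x u)} = (\<Prod>u<N. k u)"
    "finite {y. (\<forall>u\<ge>N. y u = 0) \<and> (\<forall>u<N. y u ^ k u = x u)}"
proof -
  let ?R = "\<Pi>\<^sub>E u\<in>{..<N}. {z. z ^ k u = x u}"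
  let ?Y = "{y. (\<forall>u\<ge>N. y u = 0) \<and> (\<forall>u<N. y u ^ k u = x u)}"
  have bij: "bij_betw (\<lambda>y. restrict y {..<N}) ?Y ?R"
  proof (rule bij_betw_byWitness[where f' = "\<lambda>y u. if u < N then y u else 0"])
    show "\<forall>y\<in>?Y. (\<lambda>u. if u < N then restrict y {..<N} u else 0) = y"
      by (intro ballI ext) simp
    show "\<forall>y\<in>?R. restrict (\<lambda>u. if u < N then y u else 0) {..<N} = y"
    proof (intro ballI ext)
      fix y u assume y: "y \<in> ?R"
      show "restrict (\<lambda>u. if u < N then y u else 0) {..<N} u = y u"
        using PiE_arb[OF y, of u] by (cases "u < N") (simp_all add: restrict_def)
    qed
    show "(\<lambda>y. restrict y {..<N}) ` ?Y \<subseteq> ?R" by (intro image_subsetI) (simp add: restrict_PiE_iff)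
    show "(\<lambda>y u. if u < N then y u else 0) ` ?R \<subseteq> ?Y"
    proof (intro image_subsetI CollectI conjI allI impI)
      fix y u assume "y \<in> ?R" "u < N"
      thus "(if u < N then y u else 0) ^ k u = x u" by (simp add: PiE_iff)
    qed simp
  qed
  have "card ?R = (\<Prod>u\<in>{..<N}. card {z. z ^ k u = x u})" by (rule card_PiE) simp
  also have "\<dots> = (\<Prod>u<N. k u)" by (intro prod.cong refl card_nth_roots) (simp_all only: assms lessThan_iff not_False_eq_True)
  finally have "card ?R = (\<Prod>u<N. k u)" .
  thus "card ?Y = (\<Prod>u<N. k u)" using bij_betw_same_card[OF bij] by simp
  have "finite ?R" by (intro finite_PiE finite_nth_roots) (simp_all add: assms(2))
  thus "finite ?Y" using bij_betw_finite[OF bij] by simp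
qed

locale weighted_system = symmetric_coordinates n N \<sigma> for n N \<sigma> +
  fixes \<epsilon> :: complex
begin

definition wt :: "nat \<Rightarrow> nat" where
  "wt u = fst (\<sigma> u) + snd (\<sigma> u) + 2"

definition pow_wt :: "(nat \<Rightarrow> complex) \<Rightarrow> nat \<Rightarrow> complex" where
  "pow_wt y u = (if u < N then y u ^ wt u else 0)"

text \<open>
  The variable with index \<open>N\<close> homogenizes; the equation \<open>e\<close> has degree \<open>2 * e + 2\<close> in the variables
  \<open>y u\<close> with \<open>y u ^ wt u = x u\<close>.
\<close>

definition hom_poly :: "nat \<Rightarrow> (nat \<Rightarrow> complex) \<Rightarrow> complex" where
  "hom_poly e c = top_form e (chart {} (pow_wt c)) +
     (if e < n then 0 else \<epsilon> * (c N ^ (2 * e + 2 - wt e) * c e ^ wt e))"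

text \<open>
  Linear combinations of these functions connect the special system with \<open>y e ^ (2 * e + 2) = 1\<close>.
\<close>

definition bez :: "nat \<Rightarrow> nat \<Rightarrow> (nat \<Rightarrow> complex) \<Rightarrow> complex" where
  "bez e i c = (if i = 0 then c N ^ (2 * e + 2) else if i = 1 then hom_poly e c else c (i - 2) ^ (2 * e + 2))"

definition bez_index :: "nat set" where
  "bez_index = {..<N + 2}"

text \<open>Representatives of the points of projective space whose largest coordinate has modulus
  \<open>1\<close>.\<close>

definition sphere_pts :: "(nat \<Rightarrow> complex) set" where
  "sphere_pts = {c. (\<forall>u. c u \<in> (if u \<le> N then cball 0 1 else {0})) \<and> (\<exists>u\<in>{..N}. cmod (c u) = 1)}"

text \<open>Both indices of the entry are less than \<open>n \<le> e\<close>. The inequality is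
  strict, so the homogenizing variable really divides the term with \<epsilon>, and this term
  disappears at infinity.\<close>

lemma wt_le: "e < N \<Longrightarrow> \<not> e < n \<Longrightarrow> wt e < 2 * e + 2"
  using \<sigma>_props[of e] by (simp add: wt_def)

lemma wt_idx: "i < n \<Longrightarrow> k < n \<Longrightarrow> wt (idx i k) = i + k + 2"
  using idx(2)[of i k] by (simp add: wt_def min_def max_def)

lemma wt_pos: "wt u > 0" by (simp add: wt_def)

lemma top_form_chart_PF: "(\<lambda>x. top_form e (chart {} x)) \<in> polynomial_functions {..<N}"
  unfolding top_form_def by (intro PF_sum rows_minor_chart_PF)

lemma bez_PF: "e < N \<Longrightarrow> i < N + 2 \<Longrightarrow> bez e i \<in> polynomial_functions {..N}"
proof -
  assume e: "e < N" and i: "i < N + 2"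
  have c: "(\<lambda>c. c u) \<in> polynomial_functions {..N}" if "u \<le> N" for u using that by (intro coord) simp
  have "(\<lambda>c. pow_wt c u) \<in> polynomial_functions {..N}" for u
    unfolding pow_wt_def by (cases "u < N") (simp_all add: PF_power c const)
  hence "(\<lambda>c. top_form e (chart {} (\<lambda>u. pow_wt c u))) \<in> polynomial_functions {..N}"
    by (rule PF_subst[OF top_form_chart_PF])
  moreover have "(\<lambda>c. (if e < n then 0 else \<epsilon> * (c N ^ (2 * e + 2 - wt e) * c e ^ wt e))) \<in> polynomial_functions {..N}"
    by (cases "e < n") (use e in \<open>simp_all add: const PF_cmult mult PF_power c\<close>)
  ultimately have "hom_poly e \<in> polynomial_functions {..N}"
    unfolding hom_poly_def[abs_def] by (intro add) auto
  moreover have "(\<lambda>c. c N ^ (2 * e + 2)) \<in> polynomial_functions {..N}" by (intro PF_power c) simp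
  moreover have "(\<lambda>c. c (i - 2) ^ (2 * e + 2)) \<in> polynomial_functions {..N}" by (intro PF_power c) (use i in simp)
  ultimately show ?thesis
    unfolding bez_def[abs_def] by (cases "i = 0"; cases "i = 1") (simp_all only: if_True if_False simp_thms)
qed

text \<open>An entry of weight \<open>i + k + 2\<close> scales by
  \<open>l ^ (i + 1) * l ^ (k + 1)\<close>, a row factor times a column factor, so the principal
  minor on \<open>I\<close> scales by \<open>l ^ (2 * weight I)\<close> with
  \<open>weight I = e + 1\<close>.\<close>

lemma bez_scale:
  assumes "e < N"
  shows "bez e i (\<lambda>u. l * c u) = l ^ (2 * e + 2) * bez e i c"
proof -
  have "top_form e (chart {} (pow_wt (\<lambda>u. l * c u))) = l ^ (2 * e + 2) * top_form e (chart {} (pow_wt c))"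
    unfolding top_form_def sum_distrib_left
  proof (intro sum.cong refl)
    fix I assume I: "I \<in> {I. I \<subseteq> {..<n} \<and> weight I = e + 1}"
    have "rows_minor n (mixed_rows n I) (chart {} (pow_wt (\<lambda>u. l * c u))) =
      (\<Prod>i\<in>I. l ^ (i + 1) * l ^ (i + 1)) * rows_minor n (mixed_rows n I) (chart {} (pow_wt c))"
    proof (rule rows_minor_scale[where \<gamma> = "\<lambda>k. l ^ (k + 1)"])
      show "I \<subseteq> {..<n}" using I by simp
      fix i k assume ik: "i < n" "k < n"
      show "chart {} (pow_wt (\<lambda>u. l * c u)) (mixed_rows n I i) k =
        (if i \<in> I then l ^ (i + 1) * l ^ (k + 1) * chart {} (pow_wt c) (mixed_rows n I i) k else if i = k then 1 else 0)"
        using ik idx(1)[OF ik]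
        by (simp add: mixed_rows_def chart_upper chart_lower pow_wt_def wt_idx power_mult_distrib power_add)
    qed (simp add: mixed_rows_def chart_upper)
    also have "(\<Prod>i\<in>I. l ^ (i + 1) * l ^ (i + 1)) = l ^ (2 * weight I)"
    proof -
      have "(\<Prod>i\<in>I. l ^ (i + 1)) = l ^ weight I" by (simp only: power_sum weight_def)
      thus ?thesis by (simp only: prod.distrib mult_2 power_add)
    qed
    also have "2 * weight I = 2 * e + 2" using I by simp
    finally show "rows_minor n (mixed_rows n I) (chart {} (pow_wt (\<lambda>u. l * c u))) =
      l ^ (2 * e + 2) * rows_minor n (mixed_rows n I) (chart {} (pow_wt c))" .
  qed
  moreover have "\<epsilon> * ((l * c N) ^ (2 * e + 2 - wt e) * (l * c e) ^ wt e) =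
     l ^ (2 * e + 2) * (\<epsilon> * (c N ^ (2 * e + 2 - wt e) * c e ^ wt e))" if "\<not> e < n"
  proof -
    have "2 * e + 2 = (2 * e + 2 - wt e) + wt e" using wt_le[OF assms that] by simp
    hence "l ^ (2 * e + 2) = l ^ (2 * e + 2 - wt e) * l ^ wt e" by (metis power_add)
    thus ?thesis by (simp only: power_mult_distrib mult_ac)
  qed
  ultimately have hom: "hom_poly e (\<lambda>u. l * c u) = l ^ (2 * e + 2) * hom_poly e c"
    unfolding hom_poly_def by (cases "e < n") (simp_all only: distrib_left if_True if_False add_0_right not_False_eq_True True_implies_equals)
  show ?thesis
    unfolding bez_def by (cases "i = 0"; cases "i = 1") (simp_all only: hom power_mult_distrib if_True if_False simp_thms)
qed

lemma compact_sphere_pts: "compact sphere_pts"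
proof -
  have "compact {c :: nat \<Rightarrow> complex. \<forall>u. c u \<in> (if u \<le> N then cball 0 1 else {0})}"
    by (rule compact_product) simp
  moreover have "closed (\<Union>u\<in>{..N}. {c :: nat \<Rightarrow> complex. cmod (c u) = 1})"
  proof (intro closed_UN ballI)
    fix u show "closed {c :: nat \<Rightarrow> complex. cmod (c u) = 1}"
      by (intro closed_Collect_eq continuous_on_norm continuous_on_const continuous_on_product_coordinates)
  qed simp
  ultimately have "compact ({c. \<forall>u. c u \<in> (if u \<le> N then cball 0 1 else {0})} \<inter> (\<Union>u\<in>{..N}. {c. cmod (c u) = 1}))"
    by (rule compact_Int_closed)
  also have "\<dots> = sphere_pts" unfolding sphere_pts_def Int_def UN_iff mem_Collect_eq by simp
  finally show ?thesis .
qed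

text \<open>Projective space with homogenizing coordinate \<open>N\<close>. In the chart
  \<open>l\<close> coordinate \<open>l\<close> is normalized to \<open>1\<close>, and the freed
  variable \<open>x l\<close> carries the homogenizing coordinate, so its vanishing is the boundary.
  The constant terms are the pure powers, with index \<open>0\<close> in the affine chart and
  \<open>l + 2\<close> in the chart \<open>l\<close>.\<close>

sublocale B: compactified_system N "\<lambda>_. bez_index" "\<lambda>e i y. bez e i (y(N := 1))"
  sphere_pts "\<lambda>c. c N" bez 1 "{..<N}" "\<lambda>l e i x. bez e i (x(N := x l, l := 1))" "\<lambda>l x. x l"
  "\<lambda>l e. l + 2" "\<lambda>l e. 1" "\<lambda>e. 0" "\<lambda>e. 1"
proof
  show "finite bez_index" "finite {..<N}" by (simp_all add: bez_index_def)
  show "compact sphere_pts" by (rule compact_sphere_pts)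
  show "continuous_on sphere_pts (\<lambda>c. c N)"
    by (rule continuous_on_subset[OF continuous_on_product_coordinates]) simp
next
  fix e i assume ei: "e < N" "i \<in> bez_index"
  have bez_ei: "bez e i \<in> polynomial_functions {..N}" using bez_PF[OF ei(1), of i] ei(2) by (simp add: bez_index_def)
  show "continuous_on sphere_pts (bez e i)" by (rule PF_continuous[OF bez_ei])
  have "(\<lambda>y. bez e i (\<lambda>v. (y(N := 1)) v)) \<in> polynomial_functions {..<N}"
  proof (rule PF_subst[OF bez_ei])
    fix v assume "v \<in> {..N}"
    thus "(\<lambda>y. (y(N := 1)) v) \<in> polynomial_functions {..<N}"
      by (cases "v = N") (auto simp: const coord)
  qed
  thus "(\<lambda>y. bez e i (y(N := 1))) \<in> polynomial_functions {..<N}" .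
  fix l assume l: "l \<in> {..<N}"
  have "(\<lambda>x. bez e i (\<lambda>v. (x(N := x l, l := 1)) v)) \<in> polynomial_functions {..<N}"
  proof (rule PF_subst[OF bez_ei])
    fix v assume "v \<in> {..N}"
    thus "(\<lambda>x. (x(N := x l, l := 1)) v) \<in> polynomial_functions {..<N}"
      using l by (cases "v = l"; cases "v = N") (auto simp: const coord)
  qed
  thus "(\<lambda>x. bez e i (x(N := x l, l := 1))) \<in> polynomial_functions {..<N}" .
next
  fix x :: "nat \<Rightarrow> complex"
  assume supp: "\<forall>u\<ge>N. x u = 0"
  define c0 where "c0 = x(N := 1)"
  define \<rho> where "\<rho> = Max ((\<lambda>u. cmod (c0 u)) ` {..N})"
  have le: "cmod (c0 u) \<le> \<rho>" if "u \<le> N" for u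
    unfolding \<rho>_def using that by (intro Max_ge) auto
  have "\<rho> \<ge> 1" using le[of N] by (simp add: c0_def)
  have "\<rho> \<in> (\<lambda>u. cmod (c0 u)) ` {..N}" unfolding \<rho>_def by (intro Max_in) auto
  then obtain v where v: "v \<le> N" "cmod (c0 v) = \<rho>" by auto
  define c where "c = (\<lambda>u. complex_of_real (1 / \<rho>) * c0 u)"
  have norm_c: "cmod (c u) = cmod (c0 u) / \<rho>" for u using \<open>\<rho> \<ge> 1\<close> by (simp add: c_def norm_divide)
  have "cmod (c u) \<le> 1" if "u \<le> N" for u using le[OF that] \<open>\<rho> \<ge> 1\<close> by (simp add: norm_c)
  moreover have "c u = 0" if "\<not> u \<le> N" for u using supp that by (simp add: c_def c0_def)
  moreover have "cmod (c v) = 1" using v \<open>\<rho> \<ge> 1\<close> by (simp add: norm_c)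
  ultimately have c: "c \<in> sphere_pts" unfolding sphere_pts_def using v(1) by auto
  show "\<exists>c\<in>sphere_pts. \<exists>s. (\<forall>e<N. s e \<noteq> 0) \<and>
      (\<forall>e<N. \<forall>i\<in>bez_index. bez e i c = s e * bez e i (x(N := 1))) \<and>
      (\<forall>u<N. cmod (x u) * cmod (c N) \<le> 1)"
  proof (rule bexI[OF _ c], rule exI[of _ "\<lambda>e. complex_of_real (1 / \<rho>) ^ (2 * e + 2)"], intro conjI allI impI ballI)
    show "complex_of_real (1 / \<rho>) ^ (2 * e + 2) \<noteq> 0" for e using \<open>\<rho> \<ge> 1\<close> by simp
    show "bez e i c = complex_of_real (1 / \<rho>) ^ (2 * e + 2) * bez e i (x(N := 1))" if "e < N" for e i
      unfolding c_def bez_scale[OF that] c0_def ..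
    fix u assume "u < N"
    thus "cmod (x u) * cmod (c N) \<le> 1"
      using le[of u] \<open>\<rho> \<ge> 1\<close> by (simp add: norm_c) (simp add: c0_def)
  qed
next
  fix c assume c: "c \<in> sphere_pts" "c N = 0"
  then obtain l where l: "l \<le> N" "cmod (c l) = 1" by (auto simp: sphere_pts_def)
  have cl: "c l \<noteq> 0" using l(2) by auto
  hence lN: "l \<in> {..<N}" using l c(2) by (cases "l = N") auto
  define x where "x = (\<lambda>u. if u = l then 0 else c u / c l)"
  have x: "x(N := x l, l := 1) = (\<lambda>u. c u / c l)"
    using cl c(2) by (auto simp: x_def)
  show "\<exists>l\<in>{..<N}. \<exists>x s. (\<forall>e<N. s e \<noteq> 0) \<and>
      (\<forall>e<N. \<forall>i\<in>bez_index. bez e i c = s e * bez e i (x(N := x l, l := 1))) \<and> x l = 0"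
  proof (rule bexI[OF _ lN], rule exI[of _ x], rule exI[of _ "\<lambda>e. c l ^ (2 * e + 2)"], intro conjI allI impI ballI)
    show "c l ^ (2 * e + 2) \<noteq> 0" for e using cl by simp
    show "bez e i c = c l ^ (2 * e + 2) * bez e i (x(N := x l, l := 1))" if "e < N" for e i
      unfolding x bez_scale[OF that, symmetric] using cl by simp
  qed (simp add: x_def)
next
  fix l assume "l \<in> {..<N}"
  thus "(\<lambda>x. x l) \<in> polynomial_functions {..<N}" by (rule coord)
  show "\<exists>x :: nat \<Rightarrow> complex. x l \<noteq> 0" by (intro exI[of _ "\<lambda>_. 1"]) simp
qed (auto simp: bez_def bez_index_def)

end

lemma power_has_deriv:
  fixes z :: complex
  shows "((\<lambda>t. t ^ k) has_field_derivative of_nat k * z ^ (k - Suc 0)) (at z)"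
  by (auto intro!: derivative_eq_intros)

section \<open>Comparison of the special section with the system of pure powers\<close>

context weighted_system
begin

text \<open>The coefficients that select the equations
  \<open>hom_poly e p = c e * p N ^ (2 * e + 2)\<close> from the family \<open>bez\<close>; those
  below select \<open>p e ^ (2 * e + 2) = p N ^ (2 * e + 2)\<close>.\<close>

definition sys_poly :: "(nat \<Rightarrow> complex) \<Rightarrow> nat \<times> nat \<Rightarrow> complex" where
  "sys_poly c = (\<lambda>(e, i). if i = 0 then - c e else if i = 1 then 1 else 0)"

definition sys_root :: "nat \<times> nat \<Rightarrow> complex" where
  "sys_root = (\<lambda>(e, i). if i = 0 then - 1 else if i = e + 2 then 1 else 0)"

lemma lin_sys_poly:
  assumes "N > 0"
  shows "lin_sys (\<lambda>_. bez_index) bez (sys_poly c) e p = hom_poly e p - c e * p N ^ (2 * e + 2)"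
proof -
  have "lin_sys (\<lambda>_. bez_index) bez (sys_poly c) e p = (\<Sum>i\<in>{0, 1}. sys_poly c (e, i) * bez e i p)"
    unfolding lin_sys_def
  proof (rule sum.mono_neutral_right)
    show "\<forall>i\<in>bez_index - {0, 1}. sys_poly c (e, i) * bez e i p = 0" by (simp add: sys_poly_def)
  qed (auto simp: bez_index_def)
  thus ?thesis by (simp add: sys_poly_def bez_def)
qed

lemma lin_sys_root:
  assumes "e < N"
  shows "lin_sys (\<lambda>_. bez_index) bez sys_root e p = p e ^ (2 * e + 2) - p N ^ (2 * e + 2)"
proof -
  have "lin_sys (\<lambda>_. bez_index) bez sys_root e p = (\<Sum>i\<in>{0, e + 2}. sys_root (e, i) * bez e i p)"
    unfolding lin_sys_def
  proof (rule sum.mono_neutral_right)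
    show "\<forall>i\<in>bez_index - {0, e + 2}. sys_root (e, i) * bez e i p = 0" by (simp add: sys_root_def)
  qed (use assms in \<open>auto simp: bez_index_def\<close>)
  thus ?thesis by (simp add: sys_root_def bez_def)
qed

lemma dehomogenize:
  "lin_sys K (\<lambda>e i y. bez e i (y(N := 1))) a e y = lin_sys K bez a e (y(N := 1))"
  by (simp add: lin_sys_def)

lemma hom_poly_dehomogenize:
  assumes "e < N"
  shows "hom_poly e (y(N := 1)) = main_poly \<epsilon> e (pow_wt y)"
proof -
  have "pow_wt (y(N := 1)) = pow_wt y" by (auto simp: pow_wt_def)
  thus ?thesis using assms by (simp add: hom_poly_def main_poly_def pow_wt_def)
qed

lemma affine_sys_poly:
  assumes "e < N"
  shows "lin_sys (\<lambda>_. bez_index) (\<lambda>e i y. bez e i (y(N := 1))) (sys_poly c) e y = main_poly \<epsilon> e (pow_wt y) - c e"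
  using assms by (simp add: dehomogenize lin_sys_poly hom_poly_dehomogenize)

lemma affine_sys_root:
  assumes "e < N"
  shows "lin_sys (\<lambda>_. bez_index) (\<lambda>e i y. bez e i (y(N := 1))) sys_root e y = y e ^ (2 * e + 2) - 1"
  using assms by (simp add: dehomogenize lin_sys_root del: power_Suc)

lemma sphere_nonzero: "c \<in> sphere_pts \<Longrightarrow> c N = 0 \<Longrightarrow> \<exists>u<N. c u \<noteq> 0"
proof -
  assume "c \<in> sphere_pts" "c N = 0"
  then obtain u where u: "u \<le> N" "cmod (c u) = 1" by (auto simp: sphere_pts_def)
  hence "u \<noteq> N" "c u \<noteq> 0" using \<open>c N = 0\<close> by auto
  thus ?thesis using u(1) by (intro exI[of _ u]) simp
qed

text \<open>At infinity the right hand sides and, by \<open>wt_le\<close>, the terms with \<epsilon>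
  drop out. The remaining top forms have only the origin as a common zero, which is not a point of
  projective space.\<close>

lemma admissible_sys_poly: "B.admissible (sys_poly c)"
  unfolding B.admissible_def
proof (intro ballI impI)
  fix p assume p: "p \<in> sphere_pts" "p N = 0"
  show "\<exists>e<N. lin_sys (\<lambda>_. bez_index) bez (sys_poly c) e p \<noteq> 0"
  proof (rule ccontr)
    assume "\<not> ?thesis"
    hence zero: "hom_poly e p = 0" if "e < N" for e
      using that p(2) by (auto simp: lin_sys_poly)
    have "top_form e (chart {} (pow_wt p)) = 0" if e: "e < N" for e
    proof (cases "e < n")
      case True
      thus ?thesis using zero[OF e] by (simp add: hom_poly_def)
    next
      case False
      hence pN: "p N ^ (2 * e + 2 - wt e) = 0" using wt_le[OF e False] p(2) by (simp only: zero_power zero_less_diff)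
      show ?thesis using zero[OF e] unfolding hom_poly_def pN by (cases "e < n") simp_all
    qed
    hence pw: "pow_wt p u = 0" if "u < N" for u using that by (intro top_forms_vanish_at_origin[of "pow_wt p"])
    have "p u = 0" if "u < N" for u using pw[OF that] that by (simp add: pow_wt_def)
    thus False using sphere_nonzero[OF p] by auto
  qed
qed

lemma admissible_sys_root: "B.admissible sys_root"
  unfolding B.admissible_def
proof (intro ballI impI)
  fix p assume p: "p \<in> sphere_pts" "p N = 0"
  from sphere_nonzero[OF p] obtain e where "e < N" "p e \<noteq> 0" by (elim exE conjE) (rule that)
  thus "\<exists>e<N. lin_sys (\<lambda>_. bez_index) bez sys_root e p \<noteq> 0"
    by (intro exI[of _ e]) (simp add: lin_sys_root p(2))
qed

lemma pow_wt_upd: "u < N \<Longrightarrow> pow_wt (y(u := t)) = (pow_wt y)(u := t ^ wt u)"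
  by (auto simp: pow_wt_def)

lemma pd_affine_sys_poly:
  assumes e: "e < N" and u: "u < N"
  shows "pd u (lin_sys (\<lambda>_. bez_index) (\<lambda>e i y. bez e i (y(N := 1))) (sys_poly c) e) y =
    pd u (main_poly \<epsilon> e) (pow_wt y) * (of_nat (wt u) * y u ^ (wt u - 1))"
proof (rule pd_eqI)
  have 1: "((\<lambda>s. main_poly \<epsilon> e ((pow_wt y)(u := s))) has_field_derivative pd u (main_poly \<epsilon> e) (pow_wt y)) (at (y u ^ wt u))"
    using PF_has_deriv[of "{..<N}" u "main_poly \<epsilon> e" "pow_wt y"] main_poly_PF[OF e] u by (simp add: pow_wt_def[of y u])
  have 2: "((\<lambda>t. t ^ wt u) has_field_derivative of_nat (wt u) * y u ^ (wt u - 1)) (at (y u))"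
    using power_has_deriv[of "wt u"] by simp
  have "((\<lambda>t. main_poly \<epsilon> e ((pow_wt y)(u := t ^ wt u)) - c e) has_field_derivative
    pd u (main_poly \<epsilon> e) (pow_wt y) * (of_nat (wt u) * y u ^ (wt u - 1)) - 0) (at (y u))"
    by (intro DERIV_diff DERIV_const DERIV_chain2[OF 1 2])
  thus "((\<lambda>t. lin_sys (\<lambda>_. bez_index) (\<lambda>e i y. bez e i (y(N := 1))) (sys_poly c) e (y(u := t))) has_field_derivative
    pd u (main_poly \<epsilon> e) (pow_wt y) * (of_nat (wt u) * y u ^ (wt u - 1))) (at (y u))"
    by (simp only: affine_sys_poly[OF e] pow_wt_upd[OF u] diff_zero)
qed

lemma zeros_sys_poly:
  "B.zeros (sys_poly c) = {y. (\<forall>u\<ge>N. y u = 0) \<and> pow_wt y \<in> LG.zeros (special \<epsilon> c)}"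
  unfolding B.zeros_def zeros_special by (auto simp: affine_sys_poly pow_wt_def)

text \<open>By the chain rule the Jacobian matrix is that of \<open>main_poly\<close> with its
  columns multiplied by the derivatives of the powers, which do not vanish since the coordinates do
  not.\<close>

lemma regular_sys_poly:
  assumes "\<And>x. \<forall>e<N. main_poly \<epsilon> e x = c e \<Longrightarrow> main_jacobian \<epsilon> x \<noteq> 0 \<and> (\<forall>u<N. x u \<noteq> 0)"
  shows "B.regular (sys_poly c)"
  unfolding B.regular_def
proof
  fix y assume y: "y \<in> B.zeros (sys_poly c)"
  hence "\<forall>e<N. main_poly \<epsilon> e (pow_wt y) = c e" by (simp add: zeros_sys_poly zeros_special)
  from assms[OF this] have J: "main_jacobian \<epsilon> (pow_wt y) \<noteq> 0" and nz: "\<And>u. u < N \<Longrightarrow> pow_wt y u \<noteq> 0" by auto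
  have y_nz: "of_nat (wt u) * y u ^ (wt u - 1) \<noteq> (0::complex)" if "u < N" for u
    using nz[OF that] wt_pos[of u] that by (auto simp: pow_wt_def)
  show "B.jacobian (sys_poly c) y \<noteq> 0"
    unfolding B.jacobian_def
  proof (rule det_nonzero_if_injective)
    fix v assume v: "\<And>e. e < N \<Longrightarrow> (\<Sum>u<N. pd u (lin_sys (\<lambda>_. bez_index) (\<lambda>e i y. bez e i (y(N := 1))) (sys_poly c) e) y * v u) = 0"
    show "\<forall>u<N. v u = 0"
    proof (intro allI impI)
      fix u assume u: "u < N"
      have "(of_nat (wt u) * y u ^ (wt u - 1)) * v u = 0"
      proof (rule det_nonzero_injective[OF J[unfolded main_jacobian_def] _ u])
        fix e assume e: "e < N"
        have "(\<Sum>u<N. pd u (main_poly \<epsilon> e) (pow_wt y) * ((of_nat (wt u) * y u ^ (wt u - 1)) * v u)) =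
          (\<Sum>u<N. pd u (lin_sys (\<lambda>_. bez_index) (\<lambda>e i y. bez e i (y(N := 1))) (sys_poly c) e) y * v u)"
          by (intro sum.cong refl) (simp only: pd_affine_sys_poly[OF e] lessThan_iff mult.assoc)
        thus "(\<Sum>u<N. pd u (main_poly \<epsilon> e) (pow_wt y) * ((of_nat (wt u) * y u ^ (wt u - 1)) * v u)) = 0"
          using v[OF e] by simp
      qed
      thus "v u = 0" using y_nz[OF u] mult_eq_0_iff by blast
    qed
  qed
qed

lemma zeros_sys_root:
  "B.zeros sys_root = {y. (\<forall>u\<ge>N. y u = 0) \<and> (\<forall>u<N. y u ^ (2 * u + 2) = (\<lambda>_. 1) u)}"
  unfolding B.zeros_def by (auto simp: affine_sys_root simp del: power_Suc)

lemma jacobian_sys_root: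
  assumes y: "y \<in> B.zeros sys_root"
  shows "B.jacobian sys_root y \<noteq> 0"
  unfolding B.jacobian_def
proof (rule det_nonzero_if_injective)
  have pd: "pd u (lin_sys (\<lambda>_. bez_index) (\<lambda>e i y. bez e i (y(N := 1))) sys_root e) y =
    (if u = e then of_nat (2 * e + 2) * y e ^ (2 * e + 1) else 0)" if e: "e < N" and u: "u < N" for e u
  proof (rule pd_eqI)
    have "((\<lambda>t. t ^ (2 * e + 2) - 1) has_field_derivative of_nat (2 * e + 2) * y e ^ (2 * e + 2 - Suc 0) - 0) (at (y e))"
      by (intro DERIV_diff DERIV_const power_has_deriv)
    hence "((\<lambda>t. t ^ (2 * e + 2) - 1) has_field_derivative of_nat (2 * e + 2) * y e ^ (2 * e + 1)) (at (y e))"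
      by simp
    thus "((\<lambda>t. lin_sys (\<lambda>_. bez_index) (\<lambda>e i y. bez e i (y(N := 1))) sys_root e (y(u := t))) has_field_derivative
       (if u = e then of_nat (2 * e + 2) * y e ^ (2 * e + 1) else 0)) (at (y u))"
      unfolding affine_sys_root[OF e] by (cases "u = e") (simp_all only: fun_upd_same fun_upd_other if_True if_False DERIV_const refl not_sym)
  qed
  fix v assume v: "\<And>e. e < N \<Longrightarrow> (\<Sum>u<N. pd u (lin_sys (\<lambda>_. bez_index) (\<lambda>e i y. bez e i (y(N := 1))) sys_root e) y * v u) = 0"
  show "\<forall>e<N. v e = 0"
  proof (intro allI impI)
    fix e assume e: "e < N"
    have "(\<Sum>u<N. pd u (lin_sys (\<lambda>_. bez_index) (\<lambda>e i y. bez e i (y(N := 1))) sys_root e) y * v u) =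
      (\<Sum>u<N. if u = e then of_nat (2 * e + 2) * y e ^ (2 * e + 1) * v u else 0)"
      using pd[OF e] by (intro sum.cong) auto
    also have "\<dots> = of_nat (2 * e + 2) * y e ^ (2 * e + 1) * v e" using e by simp
    finally have "of_nat (2 * e + 2) * y e ^ (2 * e + 1) * v e = 0" using v[OF e] by simp
    moreover have "y e \<noteq> 0"
    proof
      assume "y e = 0"
      moreover have "y e ^ (2 * e + 2) = 1" using y e by (simp add: zeros_sys_root del: power_Suc)
      ultimately show False by simp
    qed
    moreover have "of_nat (2 * e + 2) \<noteq> (0::complex)" by (simp only: of_nat_eq_0_iff)
    ultimately show "v e = 0" by (metis mult_eq_0_iff power_not_zero)
  qed
qed

text \<open>\<open>sys_poly c\<close> and \<open>sys_root\<close> are both admissible and regular,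
  hence have equally many zeros; for \<open>sys_root\<close> this is a product of numbers of roots
  of unity. The zeros of \<open>sys_poly c\<close> lie over those of the special section, and every
  fibre of \<open>pow_wt\<close> has \<open>\<Prod>u<N. wt u\<close> points because no coordinate
  vanishes below.\<close>

lemma card_zeros_special:
  assumes c: "\<And>x. \<forall>e<N. main_poly \<epsilon> e x = c e \<Longrightarrow> main_jacobian \<epsilon> x \<noteq> 0 \<and> (\<forall>u<N. x u \<noteq> 0)"
    and fin: "finite (LG.zeros (special \<epsilon> c))"
  shows "card (LG.zeros (special \<epsilon> c)) * (\<Prod>u<N. wt u) = (\<Prod>e<N. 2 * e + 2)"
proof -
  define z1 :: "nat \<Rightarrow> complex" where "z1 = (\<lambda>u. if u < N then 1 else 0)"
  have z1: "z1 \<in> B.zeros sys_root" by (simp add: zeros_sys_root z1_def)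
  from B.generic_count[OF z1 jacobian_sys_root[OF z1]]
  obtain F where F: "F \<in> polynomial_functions B.params" "\<exists>a. F a \<noteq> 0"
    "\<forall>a. F a \<noteq> 0 \<longrightarrow> B.admissible a \<and> B.regular a \<and> finite (B.zeros a)"
    "\<forall>a0 a. B.admissible a0 \<longrightarrow> B.regular a0 \<longrightarrow> F a \<noteq> 0 \<longrightarrow> card (B.zeros a) = card (B.zeros a0)"
    by (elim bexE conjE) (rule that)
  obtain a where a: "F a \<noteq> 0" using F(2) ..
  have "B.regular sys_root" by (simp add: B.regular_def jacobian_sys_root)
  hence "card (B.zeros a) = card (B.zeros sys_root)" using F(4) a admissible_sys_root by blast
  moreover have "card (B.zeros a) = card (B.zeros (sys_poly c))"
    using F(4) a admissible_sys_poly regular_sys_poly[OF c] by blast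
  moreover have "card (B.zeros sys_root) = (\<Prod>e<N. 2 * e + 2)"
    unfolding zeros_sys_root by (rule card_coordinatewise_roots) auto
  ultimately have count: "card (B.zeros (sys_poly c)) = (\<Prod>e<N. 2 * e + 2)" by simp
  let ?Z = "LG.zeros (special \<epsilon> c)"
  let ?fib = "\<lambda>x. {y. (\<forall>u\<ge>N. y u = 0) \<and> (\<forall>u<N. y u ^ wt u = x u)}"
  have eq: "B.zeros (sys_poly c) = (\<Union>x\<in>?Z. ?fib x)"
  proof (intro equalityI subsetI)
    fix y assume "y \<in> B.zeros (sys_poly c)"
    hence 1: "pow_wt y \<in> ?Z" and 2: "y \<in> ?fib (pow_wt y)" by (simp_all add: zeros_sys_poly pow_wt_def)
    show "y \<in> (\<Union>x\<in>?Z. ?fib x)" unfolding UN_iff by (rule bexI[OF _ 1]) (rule 2)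
  next
    fix y assume "y \<in> (\<Union>x\<in>?Z. ?fib x)"
    then obtain x where x: "x \<in> ?Z" "y \<in> ?fib x" by (elim UN_E)
    have "pow_wt y = x"
    proof
      fix u show "pow_wt y u = x u" using x by (cases "u < N") (simp_all add: pow_wt_def zeros_special)
    qed
    thus "y \<in> B.zeros (sys_poly c)" using x by (simp add: zeros_sys_poly)
  qed
  have nz: "x u \<noteq> 0" if "x \<in> ?Z" "u < N" for x u using c[of x] that by (simp add: zeros_special)
  have "card (\<Union>x\<in>?Z. ?fib x) = (\<Sum>x\<in>?Z. card (?fib x))"
  proof (rule card_UN_disjoint[OF fin])
    show "\<forall>x\<in>?Z. finite (?fib x)"
      by (intro ballI card_coordinatewise_roots(2)) (use nz wt_pos in auto)
    show "\<forall>x\<in>?Z. \<forall>x'\<in>?Z. x \<noteq> x' \<longrightarrow> ?fib x \<inter> ?fib x' = {}"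
    proof (intro ballI impI)
      fix x x' assume x: "x \<in> ?Z" "x' \<in> ?Z" "x \<noteq> x'"
      show "?fib x \<inter> ?fib x' = {}"
      proof (rule ccontr)
        assume "?fib x \<inter> ?fib x' \<noteq> {}"
        then obtain y where y: "\<forall>u<N. y u ^ wt u = x u" "\<forall>u<N. y u ^ wt u = x' u" by auto
        have "x = x'"
        proof
          fix u show "x u = x' u" using y x(1,2) by (cases "u < N") (simp_all add: zeros_special)
        qed
        thus False using x(3) by simp
      qed
    qed
  qed
  also have "\<dots> = (\<Sum>x\<in>?Z. \<Prod>u<N. wt u)"
    by (intro sum.cong refl card_coordinatewise_roots(1)) (use nz wt_pos in auto)
  also have "\<dots> = card ?Z * (\<Prod>u<N. wt u)" by simp
  finally show ?thesis using count eq by simp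
qed

end

context symmetric_coordinates
begin

theorem generic_zero_count:
  "\<exists>F\<in>polynomial_functions LG.params. (\<exists>a. F a \<noteq> 0) \<and>
    (\<forall>a. F a \<noteq> 0 \<longrightarrow> LG.admissible a \<and> LG.regular a \<and> finite (LG.zeros a) \<and>
      card (LG.zeros a) * (\<Prod>u<N. fst (\<sigma> u) + snd (\<sigma> u) + 2) = (\<Prod>e<N. 2 * e + 2))"
proof -
  obtain \<epsilon> where \<epsilon>: "\<epsilon> \<noteq> 0" "\<forall>c. LG.admissible (special \<epsilon> c)"
    using ex_admissible_special by (elim exE conjE) (rule that)
  obtain c where c: "\<forall>x. (\<forall>e<N. main_poly \<epsilon> e x = c e) \<longrightarrow> main_jacobian \<epsilon> x \<noteq> 0 \<and> (\<forall>u<N. x u \<noteq> 0)"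
    using ex_regular_special[OF \<epsilon>(1)] ..
  interpret weighted_system n N \<sigma> \<epsilon> ..
  \<comment> \<open>With right hand sides \<open>0\<close> the origin is a nondegenerate zero, which
    is what genericity of regularity requires. The counting itself uses the section with right hand
    sides \<open>c\<close>, where all zeros are nondegenerate.\<close>
  have z0: "(\<lambda>_. 0) \<in> LG.zeros (special \<epsilon> (\<lambda>_. 0))"
    by (simp add: zeros_special main_poly_zero)
  have "LG.jacobian (special \<epsilon> (\<lambda>_. 0)) (\<lambda>_. 0) \<noteq> 0"
    using main_jacobian_zero[OF \<epsilon>(1)] by (simp only: jacobian_special main_jacobian_def not_False_eq_True)
  from LG.generic_count[OF z0 this] obtain F where F: "F \<in> polynomial_functions LG.params" "\<exists>a. F a \<noteq> 0"
    "\<forall>a. F a \<noteq> 0 \<longrightarrow> LG.admissible a \<and> LG.regular a \<and> finite (LG.zeros a)"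
    "\<forall>a0 a. LG.admissible a0 \<longrightarrow> LG.regular a0 \<longrightarrow> F a \<noteq> 0 \<longrightarrow> card (LG.zeros a) = card (LG.zeros a0)"
    by (elim bexE conjE) (rule that)
  have adm: "LG.admissible (special \<epsilon> c)" using \<epsilon>(2) by simp
  have reg: "LG.regular (special \<epsilon> c)"
    unfolding LG.regular_def
  proof
    fix x assume "x \<in> LG.zeros (special \<epsilon> c)"
    hence "main_jacobian \<epsilon> x \<noteq> 0" using c by (simp add: zeros_special)
    thus "LG.jacobian (special \<epsilon> c) x \<noteq> 0" by (simp only: jacobian_special main_jacobian_def not_False_eq_True)
  qed
  have fin: "finite (LG.zeros (special \<epsilon> c))"
    by (rule LG.card_zeros_locally_constant(1)[OF LG.admissible_near(2)[OF adm] reg])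
  have count: "card (LG.zeros (special \<epsilon> c)) * (\<Prod>u<N. wt u) = (\<Prod>e<N. 2 * e + 2)"
    by (rule card_zeros_special[OF _ fin]) (use c in blast)
  show ?thesis
  proof (intro bexI[OF _ F(1)] conjI allI impI F(2))
    fix a assume a: "F a \<noteq> 0"
    show "LG.admissible a" "LG.regular a" "finite (LG.zeros a)" using F(3) a by simp_all
    have "card (LG.zeros a) = card (LG.zeros (special \<epsilon> c))" using F(4) adm reg a by blast
    thus "card (LG.zeros a) * (\<Prod>u<N. fst (\<sigma> u) + snd (\<sigma> u) + 2) = (\<Prod>e<N. 2 * e + 2)"
      using count by (simp only: wt_def)
  qed
qed

end

subsection \<open>Subspaces as column spaces\<close>

context vec_space
begin

text \<open>An independent subset of \<open>L\<close> of greatest size spans \<open>L\<close>. Its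
  existence follows from the dimension of the ambient space, without any finiteness assumption on
  \<open>L\<close>.\<close>

lemma subspace_eq_span:
  assumes L: "subspace class_ring L V"
  shows "\<exists>A. finite A \<and> A \<subseteq> carrier_vec n \<and> lin_indpt A \<and> span A = L"
proof -
  have L_sub: "L \<subseteq> carrier_vec n" using L by (simp add: subspace_def submodule_def)
  define P where "P = (\<lambda>k. \<exists>A. A \<subseteq> L \<and> lin_indpt A \<and> finite A \<and> card A = k)"
  have bound: "k \<le> n" if Pk: "P k" for k
  proof -
    from Pk[unfolded P_def] obtain A where A: "A \<subseteq> L" "lin_indpt A" "card A = k" by (elim exE conjE) (rule that)
    have "card A \<le> dim" using li_le_dim(2)[OF fin_dim _ A(2)] A(1) L_sub by simp
    thus ?thesis using A(3) dim_is_n by simp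
  qed
  have "P 0" unfolding P_def by (intro exI[of _ "{}"]) (auto simp: lin_dep_def)
  hence "P (GREATEST k. P k)" and greatest: "\<And>k. P k \<Longrightarrow> k \<le> (GREATEST k. P k)"
    using bound by (auto intro: GreatestI_nat Greatest_le_nat)
  define top where "top = (GREATEST k. P k)"
  have "P top" using \<open>P (GREATEST k. P k)\<close> by (simp add: top_def)
  then obtain A where A: "A \<subseteq> L" "lin_indpt A" "finite A" "card A = top"
    unfolding P_def by (elim exE conjE) (rule that)
  have A_car: "A \<subseteq> carrier_vec n" using A(1) L_sub by blast
  have "span A \<subseteq> L"
    using span_is_subset[OF A(1)] L by (simp add: subspace_def)
  moreover have "L \<subseteq> span A"
  proof
    fix v assume v: "v \<in> L"
    show "v \<in> span A"
    proof (rule ccontr)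
      assume nspan: "v \<notin> span A"
      have v_car: "v \<in> carrier_vec n" using v L_sub by blast
      have "v \<notin> A" using nspan in_own_span[of A] A_car by auto
      hence "lin_indpt (A \<union> {v})"
        using lin_dep_iff_in_span[OF _ A(2), of v] A_car v_car nspan by simp
      moreover have "A \<union> {v} \<subseteq> L" "finite (A \<union> {v})" "card (A \<union> {v}) = card A + 1"
        using A v \<open>v \<notin> A\<close> by auto
      ultimately have "P (card A + 1)" unfolding P_def by (intro exI[of _ "A \<union> {v}"]) simp
      from greatest[OF this] A(4) show False by (simp add: top_def)
    qed
  qed
  ultimately show ?thesis using A A_car by (intro exI[of _ A]) auto
qed

lemma span_cols: 
  assumes "B \<in> carrier_mat n k"
  shows "span (set (cols B)) = {B *\<^sub>v x | x. x \<in> carrier_vec k}"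
  using col_space_eq[OF assms] assms unfolding col_space_def by (auto simp: carrier_matD)

text \<open>Independence is a property of the set of columns, which forgets repetitions; equal
  columns are excluded by the difference of two unit vectors.\<close>

lemma injective_distinct_cols:
  fixes B :: "'a mat"
  assumes B: "B \<in> carrier_mat n k" and inj: "\<forall>x\<in>carrier_vec k. B *\<^sub>v x = 0\<^sub>v n \<longrightarrow> x = 0\<^sub>v k"
  shows "distinct (cols B)"
proof (rule ccontr)
  assume "\<not> distinct (cols B)"
  then obtain i j where ij: "i < k" "j < k" "i \<noteq> j" "col B i = col B j"
    using B by (auto simp: distinct_conv_nth)
  define w :: "'a Matrix.vec" where "w = unit_vec k i - unit_vec k j"
  have w: "w \<in> carrier_vec k" by (simp add: w_def)
  have entry: "B $$ (r, i) = B $$ (r, j)" if "r < n" for r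
  proof -
    have "vec_index (col B i) r = vec_index (col B j) r" using ij(4) by simp
    thus ?thesis using B ij that by (simp add: col_def)
  qed
  have "B *\<^sub>v w = B *\<^sub>v unit_vec k i - B *\<^sub>v unit_vec k j"
    unfolding w_def by (rule mult_minus_distrib_mat_vec[OF B]) simp_all
  also have "\<dots> = 0\<^sub>v n"
  proof (rule eq_vecI)
    fix r assume "r < dim_vec (0\<^sub>v n :: 'a Matrix.vec)"
    hence r: "r < n" by simp
    have "vec_index (B *\<^sub>v unit_vec k l) r = B $$ (r, l)" if "l < k" for l
      using B r that by (simp add: scalar_prod_right_unit)
    thus "vec_index (B *\<^sub>v unit_vec k i - B *\<^sub>v unit_vec k j) r = vec_index (0\<^sub>v n) r"
      using B r ij entry[OF r] by simp
  qed (use B in simp)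
  finally have "w = 0\<^sub>v k" using inj w by blast
  hence "vec_index w i = 0" using ij by simp
  thus False using ij by (simp add: w_def unit_vec_def)
qed

text \<open>Replaces the dimension of a vector space structure on a changed carrier by an injective
  matrix with \<open>k\<close> columns: the rank of a matrix is by definition the dimension of the
  span of its columns.\<close>

lemma subspace_dim_iff:
  "subspace class_ring L V \<and> vectorspace.dim class_ring (V\<lparr>carrier := L\<rparr>) = k \<longleftrightarrow>
    (\<exists>B\<in>carrier_mat n k. (\<forall>x\<in>carrier_vec k. B *\<^sub>v x = 0\<^sub>v n \<longrightarrow> x = 0\<^sub>v k) \<and> L = {B *\<^sub>v x | x. x \<in> carrier_vec k})"
proof
  assume "subspace class_ring L V \<and> vectorspace.dim class_ring (V\<lparr>carrier := L\<rparr>) = k"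
  hence L: "subspace class_ring L V" "vectorspace.dim class_ring (V\<lparr>carrier := L\<rparr>) = k" by simp_all
  from subspace_eq_span[OF L(1)] obtain A where A: "finite A" "A \<subseteq> carrier_vec n" "lin_indpt A" "span A = L"
    by (elim exE conjE) (rule that)
  from finite_distinct_list[OF A(1)] obtain as where as: "set as = A" "distinct as" by (elim exE conjE) (rule that)
  define B where "B = mat_of_cols n as"
  have cols: "cols B = as" unfolding B_def by (rule cols_mat_of_cols) (use as A in simp)
  have B: "B \<in> carrier_mat n (length as)" by (simp add: B_def)
  have "rank B = length as" by (rule lin_indpt_full_rank[OF B]) (use cols as A in simp_all)
  moreover have "rank B = k" unfolding rank_def cols as A(4) using L(2) by simp
  ultimately have B: "B \<in> carrier_mat n k" using B by simp
  show "\<exists>B\<in>carrier_mat n k. (\<forall>x\<in>carrier_vec k. B *\<^sub>v x = 0\<^sub>v n \<longrightarrow> x = 0\<^sub>v k) \<and> L = {B *\<^sub>v x | x. x \<in> carrier_vec k}"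
  proof (intro bexI[OF _ B] conjI ballI impI)
    show "x = 0\<^sub>v k" if "x \<in> carrier_vec k" "B *\<^sub>v x = 0\<^sub>v n" for x
      using lin_depI[OF B that(1) _ that(2)] cols as A(3) by auto
    show "L = {B *\<^sub>v x | x. x \<in> carrier_vec k}" using span_cols[OF B] cols as A(4) by simp
  qed
next
  assume "\<exists>B\<in>carrier_mat n k. (\<forall>x\<in>carrier_vec k. B *\<^sub>v x = 0\<^sub>v n \<longrightarrow> x = 0\<^sub>v k) \<and> L = {B *\<^sub>v x | x. x \<in> carrier_vec k}"
  then obtain B where B: "B \<in> carrier_mat n k" "\<forall>x\<in>carrier_vec k. B *\<^sub>v x = 0\<^sub>v n \<longrightarrow> x = 0\<^sub>v k"
    "L = {B *\<^sub>v x | x. x \<in> carrier_vec k}" by (elim bexE conjE) (rule that)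
  have L: "L = span (set (cols B))" using span_cols[OF B(1)] B(3) by simp
  have cols_car: "set (cols B) \<subseteq> carrier_vec n" using cols_dim[of B] B(1) by simp
  note dist = injective_distinct_cols[OF B(1,2)]
  have "lin_indpt (set (cols B))"
  proof
    assume "lin_dep (set (cols B))"
    from lin_depE[OF B(1) this dist] B(2) show False by metis
  qed
  from lin_indpt_full_rank[OF B(1) dist this]
  show "subspace class_ring L V \<and> vectorspace.dim class_ring (V\<lparr>carrier := L\<rparr>) = k"
    using span_is_subspace[OF cols_car] unfolding rank_def L by simp
qed

end

subsection \<open>Symplectic bases\<close>

definition bil :: "nat \<Rightarrow> (nat \<Rightarrow> nat \<Rightarrow> complex) \<Rightarrow> (nat \<Rightarrow> complex) \<Rightarrow> (nat \<Rightarrow> complex) \<Rightarrow> complex" where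
  "bil m G x y = (\<Sum>a<m. \<Sum>b<m. x a * G a b * y b)"

lemma bil_add_left: "bil m G (\<lambda>a. x a + x' a) y = bil m G x y + bil m G x' y"
  by (simp add: bil_def distrib_right sum.distrib)

lemma bil_add_right: "bil m G x (\<lambda>a. y a + y' a) = bil m G x y + bil m G x y'"
  by (simp add: bil_def distrib_left sum.distrib)

lemma bil_cmult_right: "bil m G x (\<lambda>a. c * y a) = c * bil m G x y"
  unfolding bil_def sum_distrib_left by (intro sum.cong refl) (simp only: mult_ac)

lemma bil_cmult_left: "bil m G (\<lambda>a. c * x a) y = c * bil m G x y"
  unfolding bil_def sum_distrib_left by (intro sum.cong refl) (simp only: mult_ac)

lemma bil_zero_right: "bil m G x (\<lambda>a. 0) = 0" and bil_zero_left: "bil m G (\<lambda>a. 0) y = 0"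
  by (simp_all add: bil_def)

lemma bil_sum_right: "bil m G x (\<lambda>a. \<Sum>i\<in>I. y i a) = (\<Sum>i\<in>I. bil m G x (y i))"
  by (induction I rule: infinite_finite_induct) (simp_all add: bil_zero_right bil_add_right)

lemma bil_sum_left: "bil m G (\<lambda>a. \<Sum>i\<in>I. x i a) y = (\<Sum>i\<in>I. bil m G (x i) y)"
  by (induction I rule: infinite_finite_induct) (simp_all add: bil_zero_left bil_add_left)

lemma bil_cong:
  assumes "\<And>a. a < m \<Longrightarrow> x a = x' a" "\<And>a. a < m \<Longrightarrow> y a = y' a"
  shows "bil m G x y = bil m G x' y'"
  unfolding bil_def by (intro sum.cong refl) (simp add: assms)

lemma bil_skew:
  assumes "\<And>x. bil m G x x = 0"
  shows "bil m G x y = - bil m G y x"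
proof -
  have "bil m G (\<lambda>a. x a + y a) (\<lambda>a. x a + y a) = bil m G x x + bil m G y x + (bil m G x y + bil m G y y)"
    unfolding bil_add_right bil_add_left ..
  hence "bil m G y x + bil m G x y = 0" by (simp add: assms)
  thus ?thesis by (simp add: eq_neg_iff_add_eq_0 add.commute)
qed

lemma linear_functional_expand:
  fixes \<alpha> :: "complex Matrix.vec \<Rightarrow> complex"
  assumes add: "\<And>u v. u \<in> carrier_vec m \<Longrightarrow> v \<in> carrier_vec m \<Longrightarrow> \<alpha> (u + v) = \<alpha> u + \<alpha> v"
    and smult: "\<And>c u. u \<in> carrier_vec m \<Longrightarrow> \<alpha> (c \<cdot>\<^sub>v u) = c * \<alpha> u"
  shows "\<alpha> (Matrix.vec m x) = (\<Sum>a<m. x a * \<alpha> (unit_vec m a))"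
proof -
  have "k \<le> m \<Longrightarrow> \<alpha> (Matrix.vec m (\<lambda>i. if i < k then x i else 0)) = (\<Sum>a<k. x a * \<alpha> (unit_vec m a))" for k
  proof (induction k)
    case 0
    have "Matrix.vec m (\<lambda>i. 0) = 0 \<cdot>\<^sub>v (0\<^sub>v m :: complex Matrix.vec)" by (intro eq_vecI) simp_all
    thus ?case using smult[of "0\<^sub>v m" 0] by simp
  next
    case (Suc k)
    have "Matrix.vec m (\<lambda>i. if i < Suc k then x i else 0) =
      Matrix.vec m (\<lambda>i. if i < k then x i else 0) + x k \<cdot>\<^sub>v unit_vec m k"
      using Suc.prems by (intro eq_vecI) (auto simp: unit_vec_def less_Suc_eq)
    thus ?case using Suc by (simp add: add smult)
  qed
  from this[of m] have "\<alpha> (Matrix.vec m (\<lambda>i. if i < m then x i else 0)) = (\<Sum>a<m. x a * \<alpha> (unit_vec m a))"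
    by simp
  moreover have "Matrix.vec m (\<lambda>i. if i < m then x i else 0) = Matrix.vec m x" by (intro eq_vecI) simp_all
  ultimately show ?thesis by simp
qed

lemma symplectic_form_bil:
  assumes "symplectic_form m \<omega>"
  shows "\<exists>G. (\<forall>x y. \<omega> (Matrix.vec m x) (Matrix.vec m y) = bil m G x y) \<and>
    (\<forall>x. bil m G x x = 0) \<and> (\<forall>x. (\<forall>y. bil m G x y = 0) \<longrightarrow> (\<forall>a<m. x a = 0))"
proof -
  note \<omega> = assms[unfolded symplectic_form_def]
  define G where "G = (\<lambda>a b. \<omega> (unit_vec m a) (unit_vec m b))"
  have eq: "\<omega> (Matrix.vec m x) (Matrix.vec m y) = bil m G x y" for x y
  proof -
    have "\<omega> (Matrix.vec m x) (Matrix.vec m y) = (\<Sum>a<m. x a * \<omega> (unit_vec m a) (Matrix.vec m y))"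
      by (rule linear_functional_expand) (use \<omega> in simp_all)
    also have "\<dots> = (\<Sum>a<m. x a * (\<Sum>b<m. y b * G a b))"
      unfolding G_def
      by (intro sum.cong refl arg_cong[of _ _ "\<lambda>t. _ * t"] linear_functional_expand) (use \<omega> in simp_all)
    also have "\<dots> = bil m G x y" unfolding bil_def sum_distrib_left by (intro sum.cong refl) (simp only: mult_ac)
    finally show ?thesis .
  qed
  have "bil m G x x = 0" for x using \<omega> eq[of x x] by simp
  moreover have "x a = 0" if x: "\<forall>y. bil m G x y = 0" and a: "a < m" for x a
  proof -
    have "\<omega> (Matrix.vec m x) w = 0" if w: "w \<in> carrier_vec m" for w
    proof -
      have "w = Matrix.vec m (vec_index w)" using w by (intro eq_vecI) simp_all
      thus ?thesis using eq[of x "vec_index w"] x by simp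
    qed
    hence "Matrix.vec m x = 0\<^sub>v m" using \<omega> by simp
    hence "vec_index (Matrix.vec m x) a = vec_index (0\<^sub>v m) a" by simp
    thus "x a = 0" using a by simp
  qed
  ultimately show ?thesis using eq by (intro exI[of _ G]) simp
qed

text \<open>Symplectic Gram-Schmidt. As \<open>2 * k < 2 * n\<close>, some nonzero \<open>v\<close>
  is orthogonal to all previous vectors, and nondegeneracy gives a partner \<open>w\<close>, which
  is then corrected. The induction stays in the full space and never restricts the form to a
  complement.\<close>

lemma partial_symplectic_basis:
  assumes alt: "\<And>x. bil (2 * n) G x x = 0"
    and nondeg: "\<And>x. (\<And>y. bil (2 * n) G x y = 0) \<Longrightarrow> (\<forall>a<2 * n. x a = 0)"
    and "k \<le> n"
  shows "\<exists>e f. \<forall>i<k. \<forall>j<k. bil (2 * n) G (e i) (e j) = 0 \<and> bil (2 * n) G (f i) (f j) = 0 \<and>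
    bil (2 * n) G (e i) (f j) = (if i = j then 1 else 0)"
  using \<open>k \<le> n\<close>
proof (induction k)
  case (Suc k)
  let ?B = "bil (2 * n) G"
  obtain e f where ef: "\<forall>i<k. \<forall>j<k. ?B (e i) (e j) = 0 \<and> ?B (f i) (f j) = 0 \<and>
    ?B (e i) (f j) = (if i = j then 1 else 0)" using Suc by auto
  have ee: "?B (e i) (e j) = 0" and ff: "?B (f i) (f j) = 0"
    and ef: "?B (e i) (f j) = (if i = j then 1 else 0)" if "i < k" "j < k" for i j using ef that by auto
  have fe: "?B (f i) (e j) = (if i = j then - 1 else 0)" if "i < k" "j < k" for i j
    using bil_skew[OF alt, of "f i" "e j"] ef[OF that(2,1)] by simp
  have rows: "?B y x = (\<Sum>u<2 * n. (\<Sum>a<2 * n. y a * G a u) * x u)" for x y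
    unfolding bil_def sum_distrib_right by (rule sum.swap)
  define r where "r = (\<lambda>i. if i < k then e i else f (i - k))"
  have "card {..<2 * k} < card {..<2 * n}" using Suc.prems by simp
  from exists_nonzero_kernel[OF finite_lessThan finite_lessThan this, of "\<lambda>i u. \<Sum>a<2 * n. r i a * G a u"]
  obtain v where v0: "\<exists>u\<in>{..<2 * n}. v u \<noteq> 0"
    "\<forall>i\<in>{..<2 * k}. (\<Sum>u<2 * n. (\<Sum>a<2 * n. r i a * G a u) * v u) = 0"
    by (elim exE conjE) (rule that)
  have v: "\<exists>u\<in>{..<2 * n}. v u \<noteq> 0" "\<forall>i\<in>{..<2 * k}. ?B (r i) v = 0"
    unfolding rows by (rule v0)+
  have ev: "?B (e i) v = 0" if "i < k" for i using v(2)[rule_format, of i] that by (simp add: r_def)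
  have fv: "?B (f i) v = 0" if "i < k" for i using v(2)[rule_format, of "k + i"] that by (simp add: r_def)
  have "\<exists>w. ?B v w \<noteq> 0" using nondeg[of v] v(1) by auto
  then obtain w0 where w0: "?B v w0 \<noteq> 0" ..
  define w where "w = (\<lambda>a. (1 / ?B v w0) * w0 a)"
  have vw: "?B v w = 1" unfolding w_def bil_cmult_right using w0 by simp
  \<comment> \<open>The correction makes the partner orthogonal to the previous vectors. It leaves
    the pairing with \<open>v\<close> unchanged, since \<open>v\<close> is orthogonal to all terms
    added.\<close>
  define w' where "w' = (\<lambda>a. w a + ((\<Sum>i<k. (- ?B (e i) w) * f i a) + (\<Sum>i<k. ?B (f i) w * e i a)))"
  have w': "?B x w' = ?B x w + ((\<Sum>i<k. (- ?B (e i) w) * ?B x (f i)) + (\<Sum>i<k. ?B (f i) w * ?B x (e i)))" for x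
    unfolding w'_def bil_add_right bil_sum_right bil_cmult_right ..
  have ve: "?B v (e i) = 0" "?B v (f i) = 0" if "i < k" for i
    using bil_skew[OF alt, of v "e i"] bil_skew[OF alt, of v "f i"] ev[OF that] fv[OF that] by simp_all
  have vw': "?B v w' = 1" unfolding w' using vw by (simp add: ve)
  have ew': "?B (e j) w' = 0" if j: "j < k" for j
  proof -
    have "(\<Sum>i<k. (- ?B (e i) w) * ?B (e j) (f i)) = (\<Sum>i<k. if j = i then - ?B (e i) w else 0)"
      using ef[OF j] by (intro sum.cong) auto
    also have "\<dots> = - ?B (e j) w" using j by simp
    finally show ?thesis unfolding w' using ee[OF j] by simp
  qed
  have fw': "?B (f j) w' = 0" if j: "j < k" for j
  proof -
    have "(\<Sum>i<k. ?B (f i) w * ?B (f j) (e i)) = (\<Sum>i<k. if j = i then - ?B (f i) w else 0)"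
      using fe[OF j] by (intro sum.cong) auto
    also have "\<dots> = - ?B (f j) w" using j by simp
    finally show ?thesis unfolding w' using ff[OF j] by simp
  qed
  have w'f: "?B w' (f j) = 0" and w'e: "?B w' (e j) = 0" if "j < k" for j
    using bil_skew[OF alt, of w' "f j"] bil_skew[OF alt, of w' "e j"] fw'[OF that] ew'[OF that] by simp_all
  show ?case
  proof (rule exI[of _ "e(k := v)"], rule exI[of _ "f(k := w')"], intro allI impI)
    fix i j assume ij: "i < Suc k" "j < Suc k"
    show "?B ((e(k := v)) i) ((e(k := v)) j) = 0 \<and> ?B ((f(k := w')) i) ((f(k := w')) j) = 0 \<and>
      ?B ((e(k := v)) i) ((f(k := w')) j) = (if i = j then 1 else 0)"
    proof (cases "i = k"; cases "j = k")
      assume "i \<noteq> k" "j \<noteq> k"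
      hence "i < k" "j < k" using ij by auto
      thus ?thesis using ee ff ef by simp
    next
      assume "i = k" "j = k"
      thus ?thesis using alt vw' by simp
    next
      assume "i = k" "j \<noteq> k"
      hence "i = k" "j < k" "j \<noteq> k" using ij by auto
      thus ?thesis using ve w'f by simp
    next
      assume "i \<noteq> k" "j = k"
      hence "i < k" "j = k" "i \<noteq> k" using ij by auto
      thus ?thesis using ev fw' ew' by simp
    qed
  qed
qed auto

lemma sum_lessThan_double: "(\<Sum>k<2 * n. f k) = (\<Sum>k<n. f k) + (\<Sum>k<n. f (n + k))"
  for f :: "nat \<Rightarrow> 'a::comm_monoid_add"
proof -
  have "(\<Sum>k<n + m. f k) = (\<Sum>k<n. f k) + (\<Sum>k<m. f (n + k))" for m
    by (induction m) (simp_all add: add.assoc)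
  thus ?thesis by (simp add: mult_2)
qed

lemma symplectic_basis:
  assumes alt: "\<And>x. bil (2 * n) G x x = 0"
    and nondeg: "\<And>x. (\<And>y. bil (2 * n) G x y = 0) \<Longrightarrow> (\<forall>a<2 * n. x a = 0)"
  shows "\<exists>g. (\<forall>x y. bil (2 * n) G (\<lambda>i. \<Sum>k<2 * n. g i k * x k) (\<lambda>i. \<Sum>k<2 * n. g i k * y k) =
      (\<Sum>i<n. x i * y (n + i) - x (n + i) * y i)) \<and>
    det (mat (2 * n) (2 * n) (\<lambda>(i, j). g i j)) \<noteq> 0"
proof -
  let ?B = "bil (2 * n) G"
  obtain e f where "\<forall>i<n. \<forall>j<n. ?B (e i) (e j) = 0 \<and> ?B (f i) (f j) = 0 \<and>
    ?B (e i) (f j) = (if i = j then 1 else 0)" using partial_symplectic_basis[OF alt nondeg order_refl] by blast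
  hence ee: "?B (e i) (e j) = 0" and ff: "?B (f i) (f j) = 0"
    and ef: "?B (e i) (f j) = (if i = j then 1 else 0)" if "i < n" "j < n" for i j using that by auto
  have fe: "?B (f i) (e j) = (if i = j then - 1 else 0)" if "i < n" "j < n" for i j
    using bil_skew[OF alt, of "f i" "e j"] ef[OF that(2,1)] by simp
  define g where "g = (\<lambda>i k. if k < n then e k i else f (k - n) i)"
  have comb: "(\<lambda>i. \<Sum>k<2 * n. g i k * x k) = (\<lambda>i. (\<Sum>k<n. x k * e k i) + (\<Sum>k<n. x (n + k) * f k i))" for x
    unfolding sum_lessThan_double by (simp add: g_def mult.commute)
  have main: "?B (\<lambda>i. \<Sum>k<2 * n. g i k * x k) (\<lambda>i. \<Sum>k<2 * n. g i k * y k) =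
      (\<Sum>i<n. x i * y (n + i) - x (n + i) * y i)" for x y
  proof -
    have 1: "?B (\<lambda>i. (\<Sum>k<n. x k * e k i) + (\<Sum>k<n. x (n + k) * f k i)) (e l) = - x (n + l)" if l: "l < n" for l
    proof -
      have "?B (\<lambda>i. (\<Sum>k<n. x k * e k i) + (\<Sum>k<n. x (n + k) * f k i)) (e l) =
        (\<Sum>k<n. x k * ?B (e k) (e l)) + (\<Sum>k<n. x (n + k) * ?B (f k) (e l))"
        unfolding bil_add_left bil_sum_left bil_cmult_left ..
      also have "\<dots> = (\<Sum>k<n. 0) + (\<Sum>k<n. if k = l then - x (n + k) else 0)"
        using ee fe l by (intro arg_cong2[of _ _ _ _ "(+)"] sum.cong) auto
      finally show ?thesis using l by simp
    qed
    have 2: "?B (\<lambda>i. (\<Sum>k<n. x k * e k i) + (\<Sum>k<n. x (n + k) * f k i)) (f l) = x l" if l: "l < n" for l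
    proof -
      have "?B (\<lambda>i. (\<Sum>k<n. x k * e k i) + (\<Sum>k<n. x (n + k) * f k i)) (f l) =
        (\<Sum>k<n. x k * ?B (e k) (f l)) + (\<Sum>k<n. x (n + k) * ?B (f k) (f l))"
        unfolding bil_add_left bil_sum_left bil_cmult_left ..
      also have "\<dots> = (\<Sum>k<n. if k = l then x k else 0) + (\<Sum>k<n. 0)"
        using ef ff l by (intro arg_cong2[of _ _ _ _ "(+)"] sum.cong) auto
      finally show ?thesis using l by simp
    qed
    have "?B (\<lambda>i. \<Sum>k<2 * n. g i k * x k) (\<lambda>i. \<Sum>k<2 * n. g i k * y k) =
      (\<Sum>l<n. y l * - x (n + l)) + (\<Sum>l<n. y (n + l) * x l)"
      unfolding comb bil_add_right bil_sum_right bil_cmult_right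
      by (intro arg_cong2[of _ _ _ _ "(+)"] sum.cong refl arg_cong[of _ _ "\<lambda>t. _ * t"])
        (simp_all only: lessThan_iff 1 2)
    also have "\<dots> = (\<Sum>l<n. x l * y (n + l) - x (n + l) * y l)"
      by (simp add: sum_subtractf sum_negf mult.commute)
    finally show ?thesis .
  qed
  have "det (mat (2 * n) (2 * n) (\<lambda>(i, j). g i j)) \<noteq> 0"
  proof (rule det_nonzero_if_injective)
    fix x assume x: "\<And>i. i < 2 * n \<Longrightarrow> (\<Sum>j<2 * n. g i j * x j) = 0"
    have zero: "(\<Sum>i<n. x i * y (n + i) - x (n + i) * y i) = 0" for y
    proof -
      have "?B (\<lambda>i. \<Sum>k<2 * n. g i k * x k) (\<lambda>i. \<Sum>k<2 * n. g i k * y k) = ?B (\<lambda>_. 0) (\<lambda>i. \<Sum>k<2 * n. g i k * y k)"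
        by (rule bil_cong) (simp_all only: x)
      thus ?thesis unfolding main bil_zero_left .
    qed
    have low: "x i = 0" if i: "i < n" for i
    proof -
      have "(\<Sum>l<n. x l * (if n + l = n + i then 1 else 0) - x (n + l) * (if l = n + i then 1 else 0)) =
        (\<Sum>l<n. if l = i then x l else 0)"
        by (intro sum.cong) auto
      thus ?thesis using zero[of "\<lambda>j. if j = n + i then 1 else 0"] i by simp
    qed
    have up: "x (n + i) = 0" if i: "i < n" for i
    proof -
      have "(\<Sum>l<n. x l * (if n + l = i then 1 else 0) - x (n + l) * (if l = i then 1 else 0)) =
        (\<Sum>l<n. if l = i then - x (n + l) else 0)"
        using i by (intro sum.cong) auto
      thus ?thesis using zero[of "\<lambda>j. if j = i then 1 else 0"] i by simp
    qed
    show "\<forall>j<2 * n. x j = 0"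
    proof (intro allI impI)
      fix j assume j: "j < 2 * n"
      show "x j = 0" using low[of j] up[of "j - n"] j by (cases "j < n") simp_all
    qed
  qed
  thus ?thesis using main by (intro exI[of _ g]) simp
qed

subsection \<open>The cone over the Lagrangian Grassmannian\<close>

definition pluecker_vec :: "nat \<Rightarrow> (nat \<Rightarrow> nat \<Rightarrow> complex) \<Rightarrow> nat set \<Rightarrow> complex" where
  "pluecker_vec n b I = (if I \<in> pluecker_index n (2 * n) then rows_minor n (pick I) b else 0)"

lemma pluecker_vec_cong:
  assumes "\<And>i j. i < 2 * n \<Longrightarrow> j < n \<Longrightarrow> b i j = b' i j"
  shows "pluecker_vec n b = pluecker_vec n b'"
proof
  fix I
  have "rows_minor n (pick I) b = rows_minor n (pick I) b'" if "I \<in> pluecker_index n (2 * n)"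
    by (rule rows_minor_cong) (use assms pick_bij(2)[OF that] in simp)
  thus "pluecker_vec n b I = pluecker_vec n b' I" by (simp add: pluecker_vec_def)
qed

lemma pluecker_coords_eq: "B \<in> carrier_mat (2 * n) n \<Longrightarrow> pluecker_coords n (2 * n) B = pluecker_vec n (\<lambda>i j. B $$ (i, j))"
proof
  fix I assume B: "B \<in> carrier_mat (2 * n) n"
  have "mat (2 * n) n (\<lambda>(i, j). B $$ (i, j)) = B" using B by (intro eq_matI) simp_all
  thus "pluecker_coords n (2 * n) B I = pluecker_vec n (\<lambda>i j. B $$ (i, j)) I"
    using pluecker_coords_rows_minor[of I n "2 * n" "\<lambda>i j. B $$ (i, j)"]
    by (cases "I \<in> pluecker_index n (2 * n)") (simp_all add: pluecker_vec_def pluecker_coords_def)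
qed

text \<open>A matrix with columns in the column space of \<open>B\<close> is \<open>B\<close> times
  a square matrix, whose determinant is a common factor of all maximal minors. So the union in
  \<open>pluecker\<close> is the single line given by \<open>B\<close>.\<close>

lemma pluecker_column_space:
  assumes B: "B \<in> carrier_mat (2 * n) n"
  shows "pluecker n (2 * n) {B *\<^sub>v x | x. x \<in> carrier_vec n} = line_through (pluecker_vec n (\<lambda>i j. B $$ (i, j)))"
proof -
  let ?L = "{B *\<^sub>v x | x. x \<in> carrier_vec n}" and ?b = "\<lambda>i j. B $$ (i, j)"
  have "set (cols B) \<subseteq> ?L"
  proof
    fix v assume "v \<in> set (cols B)"
    then obtain j where j: "j < n" "v = col B j" using B by (auto simp: in_set_conv_nth)
    have "B *\<^sub>v unit_vec n j = v"
      using B j by (intro eq_vecI) (simp_all add: scalar_prod_right_unit)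
    thus "v \<in> ?L" by (intro CollectI exI[of _ "unit_vec n j"]) simp
  qed
  hence 1: "line_through (pluecker_vec n ?b) \<subseteq> pluecker n (2 * n) ?L"
    unfolding pluecker_def using B pluecker_coords_eq[OF B] by (intro Union_upper CollectI exI[of _ B]) simp
  have 2: "line_through (pluecker_coords n (2 * n) B') \<subseteq> line_through (pluecker_vec n ?b)"
    if B': "B' \<in> carrier_mat (2 * n) n" "set (cols B') \<subseteq> ?L" for B'
  proof -
    have "\<forall>j\<in>{..<n}. \<exists>x. x \<in> carrier_vec n \<and> col B' j = B *\<^sub>v x"
    proof
      fix j assume "j \<in> {..<n}"
      hence "col B' j \<in> set (cols B')" using B'(1) by (auto simp: in_set_conv_nth intro!: exI[of _ j])
      thus "\<exists>x. x \<in> carrier_vec n \<and> col B' j = B *\<^sub>v x" using B'(2) by auto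
    qed
    from bchoice[OF this] obtain X where X: "\<forall>j\<in>{..<n}. X j \<in> carrier_vec n \<and> col B' j = B *\<^sub>v X j" ..
    define c where "c = (\<lambda>k j. vec_index (X j) k)"
    have entry: "B' $$ (i, j) = mat_mul n ?b c i j" if "i < 2 * n" "j < n" for i j
    proof -
      have "B' $$ (i, j) = vec_index (col B' j) i" using B'(1) that by simp
      also have "col B' j = B *\<^sub>v X j" using X that by simp
      also have "vec_index (B *\<^sub>v X j) i = mat_mul n ?b c i j"
        using B that bspec[OF X, of j] by (auto simp: mat_mul_def c_def scalar_prod_def atLeast0LessThan intro!: sum.cong)
      finally show ?thesis .
    qed
    have "pluecker_coords n (2 * n) B' = pluecker_vec n (mat_mul n ?b c)"
      unfolding pluecker_coords_eq[OF B'(1)] by (rule pluecker_vec_cong) (rule entry)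
    also have "\<dots> = (\<lambda>I. det (mat n n (\<lambda>(i, j). c i j)) * pluecker_vec n ?b I)"
      by (auto simp: pluecker_vec_def rows_minor_mul)
    finally have "pluecker_coords n (2 * n) B' = (\<lambda>I. det (mat n n (\<lambda>(i, j). c i j)) * pluecker_vec n ?b I)" .
    thus ?thesis unfolding line_through_def by (auto simp: mult.assoc[symmetric])
  qed
  show ?thesis
  proof (rule equalityI[OF _ 1])
    show "pluecker n (2 * n) ?L \<subseteq> line_through (pluecker_vec n ?b)"
      unfolding pluecker_def using 2 by (intro Union_least) auto
  qed
qed

lemma row_act_row_val: "row_val n (row_act m g b) i x = (\<Sum>k<m. g i k * row_val n b k x)"
proof -
  have "row_val n (row_act m g b) i x = (\<Sum>j<n. \<Sum>k<m. g i k * (b k j * x j))"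
    unfolding row_val_def row_act_def sum_distrib_right mult.assoc ..
  also have "\<dots> = (\<Sum>k<m. \<Sum>j<n. g i k * (b k j * x j))" by (rule sum.swap)
  finally show ?thesis unfolding row_val_def sum_distrib_left .
qed

lemma row_act_inverse:
  assumes "\<forall>i<m. \<forall>j<m. (\<Sum>k<m. g i k * g' k j) = (if i = j then 1 else 0)" "i < m"
  shows "row_act m g (row_act m g' b) i j = b i j"
proof -
  have "row_act m g (row_act m g' b) i j = (\<Sum>k<m. \<Sum>l<m. g i k * (g' k l * b l j))"
    unfolding row_act_def sum_distrib_left ..
  also have "\<dots> = (\<Sum>l<m. \<Sum>k<m. g i k * (g' k l * b l j))" by (rule sum.swap)
  also have "\<dots> = (\<Sum>l<m. (\<Sum>k<m. g i k * g' k l) * b l j)" by (simp only: sum_distrib_right mult.assoc)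
  also have "\<dots> = (\<Sum>l<m. if i = l then b l j else 0)"
    using assms by (intro sum.cong refl) auto
  finally show ?thesis using assms(2) by simp
qed

lemma mult_mat_vec_row_val:
  assumes "B \<in> carrier_mat m n"
  shows "B *\<^sub>v Matrix.vec n x = Matrix.vec m (\<lambda>i. row_val n (\<lambda>i j. B $$ (i, j)) i x)"
  by (rule eq_vecI) (use assms in \<open>auto simp: row_val_def scalar_prod_def atLeast0LessThan intro!: sum.cong\<close>)

lemma vec_vec_index: "v \<in> carrier_vec n \<Longrightarrow> Matrix.vec n (vec_index v) = v"
  by (intro eq_vecI) auto

text \<open>A symplectic basis \<open>g\<close> carries the standard Lagrangian subspaces to those
  of \<open>\<omega>\<close>. The section is therefore studied for standard isotropic
  \<open>b\<close>, while \<open>g\<close> stays visible in the Pluecker coordinates and its inverse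
  \<open>g'\<close> is kept to undo it.\<close>

lemma lagrangian_points:
  assumes \<omega>: "symplectic_form (2 * n) \<omega>"
  shows "\<exists>g g'. (\<forall>i<2 * n. \<forall>j<2 * n. (\<Sum>k<2 * n. g' i k * g k j) = (if i = j then 1 else 0)) \<and>
    pluecker n (2 * n) ` lagrangian_grassmannian n \<omega> =
    {line_through (pluecker_vec n (row_act (2 * n) g b)) | b. isotropic n b \<and> full_rank n b}"
proof -
  from symplectic_form_bil[OF \<omega>] obtain G where G: "\<forall>x y. \<omega> (Matrix.vec (2 * n) x) (Matrix.vec (2 * n) y) = bil (2 * n) G x y"
    "\<forall>x. bil (2 * n) G x x = 0" "\<forall>x. (\<forall>y. bil (2 * n) G x y = 0) \<longrightarrow> (\<forall>a<2 * n. x a = 0)"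
    by (elim exE conjE) (rule that)
  have "\<exists>g. (\<forall>x y. bil (2 * n) G (\<lambda>i. \<Sum>k<2 * n. g i k * x k) (\<lambda>i. \<Sum>k<2 * n. g i k * y k) =
      (\<Sum>i<n. x i * y (n + i) - x (n + i) * y i)) \<and>
    det (mat (2 * n) (2 * n) (\<lambda>(i, j). g i j)) \<noteq> 0"
    by (rule symplectic_basis) (use G(2,3) in auto)
  then obtain g where g: "\<forall>x y. bil (2 * n) G (\<lambda>i. \<Sum>k<2 * n. g i k * x k) (\<lambda>i. \<Sum>k<2 * n. g i k * y k) =
      (\<Sum>i<n. x i * y (n + i) - x (n + i) * y i)" "det (mat (2 * n) (2 * n) (\<lambda>(i, j). g i j)) \<noteq> 0"
    by (elim exE conjE) (rule that)
  from det_nonzero_inverse_fun[OF g(2)] obtain g' where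
    g'g: "\<forall>i<2 * n. \<forall>j<2 * n. (\<Sum>k<2 * n. g' i k * g k j) = (if i = j then 1 else 0)" and
    gg': "\<forall>i<2 * n. \<forall>j<2 * n. (\<Sum>k<2 * n. g i k * g' k j) = (if i = j then 1 else 0)"
    by (elim exE conjE) (rule that)
  have G_lagr: "bil (2 * n) G (\<lambda>i. row_val n (row_act (2 * n) g b) i x) (\<lambda>i. row_val n (row_act (2 * n) g b) i y) =
      (\<Sum>i<n. row_val n b i x * row_val n b (n + i) y - row_val n b (n + i) x * row_val n b i y)" for b x y
    unfolding row_act_row_val g(1)[rule_format] ..
  define col_sp where "col_sp = (\<lambda>B :: complex mat. {B *\<^sub>v x | x. x \<in> carrier_vec n})"
  have in_LG: "L \<in> lagrangian_grassmannian n \<omega> \<longleftrightarrow> (\<exists>B\<in>carrier_mat (2 * n) n.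
      (\<forall>x\<in>carrier_vec n. B *\<^sub>v x = 0\<^sub>v (2 * n) \<longrightarrow> x = 0\<^sub>v n) \<and> L = col_sp B) \<and> (\<forall>u\<in>L. \<forall>v\<in>L. \<omega> u v = 0)" for L
    unfolding lagrangian_grassmannian_def grassmannian_def mem_Collect_eq vec_space.subspace_dim_iff col_sp_def ..
  have full: "(\<forall>x\<in>carrier_vec n. B *\<^sub>v x = 0\<^sub>v (2 * n) \<longrightarrow> x = 0\<^sub>v n) \<longleftrightarrow> full_rank n (\<lambda>i j. B $$ (i, j))"
    if B: "B \<in> carrier_mat (2 * n) n" for B :: "complex mat"
  proof
    assume *: "\<forall>x\<in>carrier_vec n. B *\<^sub>v x = 0\<^sub>v (2 * n) \<longrightarrow> x = 0\<^sub>v n"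
    show "full_rank n (\<lambda>i j. B $$ (i, j))"
      unfolding full_rank_def
    proof (intro allI impI)
      fix x j assume x: "\<forall>i<2 * n. row_val n (\<lambda>i j. B $$ (i, j)) i x = 0" and j: "j < n"
      have "B *\<^sub>v Matrix.vec n x = 0\<^sub>v (2 * n)"
        unfolding mult_mat_vec_row_val[OF B] by (rule eq_vecI) (use x in simp_all)
      hence "Matrix.vec n x = 0\<^sub>v n" using * by simp
      hence "vec_index (Matrix.vec n x) j = vec_index (0\<^sub>v n) j" by simp
      thus "x j = 0" using j by simp
    qed
  next
    assume *: "full_rank n (\<lambda>i j. B $$ (i, j))"
    show "\<forall>x\<in>carrier_vec n. B *\<^sub>v x = 0\<^sub>v (2 * n) \<longrightarrow> x = 0\<^sub>v n"
    proof (intro ballI impI)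
      fix v :: "complex Matrix.vec" assume v: "v \<in> carrier_vec n" "B *\<^sub>v v = 0\<^sub>v (2 * n)"
      have "Matrix.vec (2 * n) (\<lambda>i. row_val n (\<lambda>i j. B $$ (i, j)) i (vec_index v)) = 0\<^sub>v (2 * n)"
        using mult_mat_vec_row_val[OF B, of "vec_index v"] v by (simp add: vec_vec_index)
      hence "vec_index (Matrix.vec (2 * n) (\<lambda>i. row_val n (\<lambda>i j. B $$ (i, j)) i (vec_index v))) i = vec_index (0\<^sub>v (2 * n)) i" for i
        by simp
      hence "row_val n (\<lambda>i j. B $$ (i, j)) i (vec_index v) = 0" if "i < 2 * n" for i
        using that by (metis (lifting) index_vec index_zero_vec(1))
      hence "\<forall>j<n. vec_index v j = 0" using * by (simp add: full_rank_def)
      thus "v = 0\<^sub>v n" using v(1) by (intro eq_vecI) simp_all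
    qed
  qed
  have iso: "(\<forall>u\<in>col_sp B. \<forall>v\<in>col_sp B. \<omega> u v = 0) \<longleftrightarrow> isotropic n b"
    if B: "B \<in> carrier_mat (2 * n) n" and b: "\<And>i j. i < 2 * n \<Longrightarrow> j < n \<Longrightarrow> B $$ (i, j) = row_act (2 * n) g b i j" for B b
  proof -
    have val: "\<omega> (B *\<^sub>v Matrix.vec n x) (B *\<^sub>v Matrix.vec n y) =
      (\<Sum>i<n. row_val n b i x * row_val n b (n + i) y - row_val n b (n + i) x * row_val n b i y)" for x y
    proof -
      have "row_val n (\<lambda>i j. B $$ (i, j)) i x = row_val n (row_act (2 * n) g b) i x" if "i < 2 * n" for i x
        unfolding row_val_def by (intro sum.cong refl) (use b that in simp)
      hence "bil (2 * n) G (\<lambda>i. row_val n (\<lambda>i j. B $$ (i, j)) i x) (\<lambda>i. row_val n (\<lambda>i j. B $$ (i, j)) i y) =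
        bil (2 * n) G (\<lambda>i. row_val n (row_act (2 * n) g b) i x) (\<lambda>i. row_val n (row_act (2 * n) g b) i y)"
        by (intro bil_cong)
      thus ?thesis unfolding mult_mat_vec_row_val[OF B] G(1)[rule_format] G_lagr .
    qed
    show ?thesis
    proof
      assume *: "\<forall>u\<in>col_sp B. \<forall>v\<in>col_sp B. \<omega> u v = 0"
      show "isotropic n b"
        unfolding isotropic_def
      proof (intro allI impI)
        fix j k assume jk: "j < n" "k < n"
        have unit: "row_val n b i (\<lambda>l. if l = j then 1 else 0) = b i j" if "j < n" for i j
          using that by (simp add: row_val_def if_distrib[of "\<lambda>t. _ * t"] cong: if_cong)
        have "B *\<^sub>v Matrix.vec n x \<in> col_sp B" for x unfolding col_sp_def by (intro CollectI exI[of _ "Matrix.vec n x"]) simp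
        hence "\<omega> (B *\<^sub>v Matrix.vec n (\<lambda>l. if l = j then 1 else 0)) (B *\<^sub>v Matrix.vec n (\<lambda>l. if l = k then 1 else 0)) = 0"
          using * by blast
        thus "(\<Sum>i<n. b i j * b (n + i) k - b (n + i) j * b i k) = 0" unfolding val unit[OF jk(1)] unit[OF jk(2)] .
      qed
    next
      assume iso: "isotropic n b"
      show "\<forall>u\<in>col_sp B. \<forall>v\<in>col_sp B. \<omega> u v = 0"
      proof (intro ballI)
        fix u v assume "u \<in> col_sp B" "v \<in> col_sp B"
        then obtain x y where xy: "x \<in> carrier_vec n" "u = B *\<^sub>v x" "y \<in> carrier_vec n" "v = B *\<^sub>v y"
          unfolding col_sp_def by auto
        have "\<omega> (B *\<^sub>v Matrix.vec n (vec_index x)) (B *\<^sub>v Matrix.vec n (vec_index y)) = 0"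
          unfolding val by (rule isotropic_row_val[OF iso])
        thus "\<omega> u v = 0" using xy by (simp add: vec_vec_index)
      qed
    qed
  qed
  have full_g: "full_rank n (row_act (2 * n) g b) \<longleftrightarrow> full_rank n b" for b
  proof
    assume *: "full_rank n (row_act (2 * n) g b)"
    show "full_rank n b" unfolding full_rank_def
    proof (intro allI impI)
      fix x j assume "\<forall>i<2 * n. row_val n b i x = 0" "j < n"
      thus "x j = 0" using * unfolding full_rank_def by (simp add: row_act_row_val)
    qed
  next
    assume *: "full_rank n b"
    show "full_rank n (row_act (2 * n) g b)" unfolding full_rank_def
    proof (intro allI impI)
      fix x j assume x: "\<forall>i<2 * n. row_val n (row_act (2 * n) g b) i x = 0" and j: "j < n"
      have "row_val n b i x = 0" if i: "i < 2 * n" for i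
      proof -
        have "row_val n b i x = row_val n (row_act (2 * n) g' (row_act (2 * n) g b)) i x"
          unfolding row_val_def using row_act_inverse[OF g'g i] by simp
        also have "\<dots> = 0" unfolding row_act_row_val[of n "2 * n" g'] using x by simp
        finally show ?thesis .
      qed
      thus "x j = 0" using * j by (simp add: full_rank_def)
    qed
  qed
  have full_cong: "full_rank n b \<longleftrightarrow> full_rank n b'" if "\<And>i j. i < 2 * n \<Longrightarrow> j < n \<Longrightarrow> b i j = b' i j" for b b'
  proof -
    have "row_val n b i x = row_val n b' i x" if "i < 2 * n" for i x
      unfolding row_val_def by (intro sum.cong refl) (use \<open>\<And>i j. i < 2 * n \<Longrightarrow> j < n \<Longrightarrow> b i j = b' i j\<close> that in simp)
    thus ?thesis unfolding full_rank_def by simp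
  qed
  have "pluecker n (2 * n) ` lagrangian_grassmannian n \<omega> =
    {line_through (pluecker_vec n (row_act (2 * n) g b)) | b. isotropic n b \<and> full_rank n b}"
  proof (intro equalityI subsetI)
    fix p assume "p \<in> pluecker n (2 * n) ` lagrangian_grassmannian n \<omega>"
    then obtain L where L: "L \<in> lagrangian_grassmannian n \<omega>" "p = pluecker n (2 * n) L" by (elim imageE)
    from L(1)[unfolded in_LG] obtain B where B: "B \<in> carrier_mat (2 * n) n"
      "\<forall>x\<in>carrier_vec n. B *\<^sub>v x = 0\<^sub>v (2 * n) \<longrightarrow> x = 0\<^sub>v n" "L = col_sp B" "\<forall>u\<in>L. \<forall>v\<in>L. \<omega> u v = 0"
      by (elim bexE conjE) (rule that)
    define b where "b = row_act (2 * n) g' (\<lambda>i j. B $$ (i, j))"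
    have b: "row_act (2 * n) g b i j = B $$ (i, j)" if "i < 2 * n" for i j
      unfolding b_def by (rule row_act_inverse[OF gg' that])
    have "isotropic n b" using iso[OF B(1), of b] b B(3,4) by simp
    moreover have "full_rank n b"
      using full[OF B(1)] B(2) full_cong[of "row_act (2 * n) g b" "\<lambda>i j. B $$ (i, j)"] b full_g[of b] by simp
    moreover have "p = line_through (pluecker_vec n (row_act (2 * n) g b))"
    proof -
      have "pluecker_vec n (\<lambda>i j. B $$ (i, j)) = pluecker_vec n (row_act (2 * n) g b)"
        by (rule pluecker_vec_cong) (simp add: b)
      thus ?thesis using pluecker_column_space[OF B(1)] L(2) B(3) by (simp add: col_sp_def)
    qed
    ultimately show "p \<in> {line_through (pluecker_vec n (row_act (2 * n) g b)) | b. isotropic n b \<and> full_rank n b}"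
      by (intro CollectI exI[of _ b] conjI)
  next
    fix p assume "p \<in> {line_through (pluecker_vec n (row_act (2 * n) g b)) | b. isotropic n b \<and> full_rank n b}"
    then obtain b where b: "isotropic n b" "full_rank n b" "p = line_through (pluecker_vec n (row_act (2 * n) g b))"
      by (elim CollectE exE conjE) (rule that)
    define B where "B = mat (2 * n) n (\<lambda>(i, j). row_act (2 * n) g b i j)"
    have B: "B \<in> carrier_mat (2 * n) n" by (simp add: B_def)
    have Bb: "B $$ (i, j) = row_act (2 * n) g b i j" if "i < 2 * n" "j < n" for i j using that by (simp add: B_def)
    have "full_rank n (\<lambda>i j. B $$ (i, j))" using full_cong[of "\<lambda>i j. B $$ (i, j)" "row_act (2 * n) g b"] Bb full_g b(2) by simp
    hence "\<forall>x\<in>carrier_vec n. B *\<^sub>v x = 0\<^sub>v (2 * n) \<longrightarrow> x = 0\<^sub>v n" using full[OF B] by simp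
    moreover have "\<forall>u\<in>col_sp B. \<forall>v\<in>col_sp B. \<omega> u v = 0" using iso[OF B Bb] b(1) by simp
    ultimately have "col_sp B \<in> lagrangian_grassmannian n \<omega>"
      unfolding in_LG using B by (intro conjI bexI[of _ B] refl)
    moreover have "p = pluecker n (2 * n) (col_sp B)"
    proof -
      have "pluecker_vec n (\<lambda>i j. B $$ (i, j)) = pluecker_vec n (row_act (2 * n) g b)"
        by (rule pluecker_vec_cong) (rule Bb)
      thus ?thesis using pluecker_column_space[OF B] b(3) by (simp add: col_sp_def)
    qed
    ultimately show "p \<in> pluecker n (2 * n) ` lagrangian_grassmannian n \<omega>" by (rule rev_image_eqI)
  qed
  thus ?thesis using g'g by (intro exI[of _ g] exI[of _ g'] conjI)
qed

subsection \<open>Degree and dimension from generic sections\<close>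

lemma line_through_eqD: "line_through v = line_through w \<Longrightarrow> \<exists>c. v = (\<lambda>i. c * w i)"
proof -
  assume "line_through v = line_through w"
  moreover have "v \<in> line_through v" unfolding line_through_def by (rule range_eqI[of _ _ 1]) simp
  ultimately show ?thesis unfolding line_through_def by auto
qed

lemma line_through_cmult:
  assumes "c \<noteq> 0"
  shows "line_through (\<lambda>i. c * w i) = line_through w"
  unfolding line_through_def
proof (intro equalityI subsetI)
  fix x assume "x \<in> range (\<lambda>a i. a * (c * w i))"
  then obtain a where "x = (\<lambda>i. a * (c * w i))" ..
  thus "x \<in> range (\<lambda>a i. a * w i)" by (intro range_eqI[of _ _ "a * c"]) (simp add: mult.assoc)
next
  fix x assume "x \<in> range (\<lambda>a i. a * w i)"
  then obtain a where "x = (\<lambda>i. a * w i)" ..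
  thus "x \<in> range (\<lambda>a i. a * (c * w i))" using assms by (intro range_eqI[of _ _ "a / c"]) simp
qed

lemma line_in_linear_zeros:
  assumes "\<And>i. i \<notin> K \<Longrightarrow> v i = 0" "v \<noteq> (\<lambda>i. 0)"
  shows "line_through v \<in> linear_zeros K r A \<longleftrightarrow> (\<forall>j<r. (\<Sum>i\<in>K. A (j, i) * v i) = 0)"
proof
  assume "line_through v \<in> linear_zeros K r A"
  moreover have "v \<in> line_through v" unfolding line_through_def by (rule range_eqI[of _ _ 1]) simp
  ultimately show "\<forall>j<r. (\<Sum>i\<in>K. A (j, i) * v i) = 0" by (auto simp: linear_zeros_def)
next
  assume *: "\<forall>j<r. (\<Sum>i\<in>K. A (j, i) * v i) = 0"
  have "line_through v \<in> proj_space K" unfolding proj_space_def using assms by (intro imageI) simp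
  moreover have "(\<Sum>i\<in>K. A (j, i) * x i) = 0" if x: "x \<in> line_through v" and "j < r" for x j
  proof -
    obtain c where "x = (\<lambda>i. c * v i)" using x unfolding line_through_def ..
    hence "(\<Sum>i\<in>K. A (j, i) * x i) = c * (\<Sum>i\<in>K. A (j, i) * v i)"
      by (simp add: sum_distrib_left mult.left_commute)
    thus ?thesis using * that(2) by simp
  qed
  ultimately show "line_through v \<in> linear_zeros K r A" by (simp add: linear_zeros_def)
qed

text \<open>If \<open>r < s\<close>, the next form can be chosen to miss the finitely many points of a section of codimension \<open>r\<close>.\<close>

lemma generic_section_codim_less:
  assumes finK: "finite K"
    and r: "for_generic_linear K r (\<lambda>L. finite (X \<inter> L))"
    and s: "for_generic_linear K s (\<lambda>L. X \<inter> L \<noteq> {})"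
  shows "s \<le> r"
proof (rule ccontr)
  assume "\<not> s \<le> r"
  hence rs: "r < s" by simp
  obtain F where F: "F \<in> polynomial_functions ({..<r} \<times> K)" "\<exists>A. F A \<noteq> 0"
    "\<forall>A. F A \<noteq> 0 \<longrightarrow> finite (X \<inter> linear_zeros K r A)"
    using r unfolding for_generic_linear_def by auto
  obtain G where G: "G \<in> polynomial_functions ({..<s} \<times> K)" "\<exists>A. G A \<noteq> 0"
    "\<forall>A. G A \<noteq> 0 \<longrightarrow> X \<inter> linear_zeros K s A \<noteq> {}"
    using s unfolding for_generic_linear_def by auto
  obtain A1 A2 where "F A1 \<noteq> 0" "G A2 \<noteq> 0" using F(2) G(2) by (elim exE) (rule that)
  from PF_domain[where F=F and G=G, OF F(1) this(1) G(1) this(2)] obtain A where A: "F A \<noteq> 0" "G A \<noteq> 0" by (elim exE conjE) (rule that)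
  let ?S = "X \<inter> linear_zeros K r A"
  have finS: "finite ?S" using F(3) A(1) by simp
  have "\<forall>p\<in>?S. \<exists>x. x \<in> p \<and> (\<forall>i. i \<notin> K \<longrightarrow> x i = 0) \<and> x \<noteq> (\<lambda>i. 0)"
  proof
    fix p assume "p \<in> ?S"
    then obtain x where "p = line_through x" "\<forall>i. i \<notin> K \<longrightarrow> x i = 0" "x \<noteq> (\<lambda>i. 0)"
      unfolding linear_zeros_def proj_space_def by (elim IntE CollectE conjE imageE) (rule that)
    moreover have "x \<in> line_through x" unfolding line_through_def by (rule range_eqI[of _ _ 1]) simp
    ultimately show "\<exists>x. x \<in> p \<and> (\<forall>i. i \<notin> K \<longrightarrow> x i = 0) \<and> x \<noteq> (\<lambda>i. 0)"
      by (intro exI[of _ x]) simp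
  qed
  from bchoice[OF this] obtain v where v: "\<forall>p\<in>?S. v p \<in> p \<and> (\<forall>i. i \<notin> K \<longrightarrow> v p i = 0) \<and> v p \<noteq> (\<lambda>i. 0)" ..
  \<comment> \<open>The first \<open>r\<close> forms are frozen at \<open>A\<close>. There
    \<open>F A \<noteq> 0\<close> makes their section finite, and \<open>G A \<noteq> 0\<close>
    shows that \<open>G\<close> stays a nonzero polynomial in the other coefficients.
    \<open>H\<close> is nonzero when form number \<open>r\<close> misses all chosen
    representatives.\<close>
  define new where "new = (\<lambda>a (j, i). if j < r then A (j, i) else a (j, i))"
  define H where "H = (\<lambda>a. \<Prod>p\<in>?S. \<Sum>i\<in>K. v p i * a (r, i))"
  have G'_PF: "(\<lambda>a. G (\<lambda>q. new a q)) \<in> polynomial_functions ({..<s} \<times> K)"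
  proof (rule PF_subst[OF G(1)])
    fix q assume q: "q \<in> {..<s} \<times> K"
    show "(\<lambda>a. new a q) \<in> polynomial_functions ({..<s} \<times> K)"
    proof (cases q)
      case (Pair j i)
      thus ?thesis using q by (cases "j < r") (simp_all add: new_def const coord)
    qed
  qed
  have "new A q = A q" for q by (cases q) (simp add: new_def)
  hence G'_nz: "G (\<lambda>q. new A q) \<noteq> 0" using A(2) by simp
  have H_factor: "(\<lambda>a. \<Sum>i\<in>K. v p i * a (r, i)) \<in> polynomial_functions ({..<s} \<times> K)" for p
    by (intro PF_sum PF_cmult coord) (use rs in simp)
  have H_PF: "H \<in> polynomial_functions ({..<s} \<times> K)" unfolding H_def by (intro PF_prod H_factor)
  have "\<exists>a. H a \<noteq> 0"
    unfolding H_def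
  proof (rule PF_prod_nonzero[OF finS, where V="{..<s} \<times> K"])
    fix p assume p: "p \<in> ?S"
    have "v p \<noteq> (\<lambda>i. 0)" "\<forall>i. i \<notin> K \<longrightarrow> v p i = 0" using v p by simp_all
    then obtain i where "v p i \<noteq> 0" by (meson ext)
    moreover from this have "i \<in> K" using \<open>\<forall>i. i \<notin> K \<longrightarrow> v p i = 0\<close> by metis
    ultimately have i: "i \<in> K" "v p i \<noteq> 0" by simp_all
    show "\<exists>a. (\<Sum>i\<in>K. v p i * a (r, i)) \<noteq> 0"
    proof -
      have "(\<Sum>i'\<in>K. v p i' * (if i' = i then 1 else 0)) = v p i"
        using finK i(1) by (simp add: if_distrib[of "\<lambda>t. _ * t"] cong: if_cong)
      thus ?thesis using i(2) by (intro exI[of _ "\<lambda>(j, i'). if i' = i then 1 else 0"]) simp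
    qed
  qed (rule H_factor)
  then obtain a0 where "H a0 \<noteq> 0" ..
  from PF_domain[OF G'_PF G'_nz H_PF this] obtain a where a: "G (\<lambda>q. new a q) \<noteq> 0" "H a \<noteq> 0" by (elim exE conjE) (rule that)
  have "X \<inter> linear_zeros K s (new a) \<noteq> {}" using G(3) a(1) by simp
  then obtain p where p: "p \<in> X" "p \<in> linear_zeros K s (new a)" by auto
  have p_zero: "(\<Sum>i\<in>K. new a (j, i) * x i) = 0" if "x \<in> p" "j < s" for x j
    using p(2) that unfolding linear_zeros_def by blast
  have "(\<Sum>i\<in>K. A (j, i) * x i) = 0" if "x \<in> p" "j < r" for x j
  proof -
    have "new a (j, i) = A (j, i)" for i using that(2) by (simp add: new_def)
    thus ?thesis using p_zero[OF that(1), of j] that(2) rs by simp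
  qed
  moreover have "p \<in> proj_space K" using p(2) by (simp add: linear_zeros_def)
  ultimately have "p \<in> linear_zeros K r A" by (simp add: linear_zeros_def)
  hence pS: "p \<in> ?S" using p(1) by simp
  hence "v p \<in> p" using v by simp
  hence "(\<Sum>i\<in>K. new a (r, i) * v p i) = 0" using p_zero rs by simp
  hence "(\<Sum>i\<in>K. v p i * a (r, i)) = 0" by (simp add: new_def mult.commute)
  hence "H a = 0" unfolding H_def using finS pS by (intro prod_zero) auto
  thus False using a(2) by simp
qed

text \<open>The matrix of the map induced by \<open>g\<close> on the \<open>n\<close>-th exterior
  power.\<close>

definition pluecker_trans :: "nat \<Rightarrow> (nat \<Rightarrow> nat \<Rightarrow> complex) \<Rightarrow> nat set \<Rightarrow> nat set \<Rightarrow> complex" where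
  "pluecker_trans n g I = form_coeff n (\<lambda>b. rows_minor n (pick I) (row_act (2 * n) g b))"

lemma pluecker_vec_row_act:
  assumes "I \<in> pluecker_index n (2 * n)"
  shows "pluecker_vec n (row_act (2 * n) g b) I =
    (\<Sum>J\<in>pluecker_index n (2 * n). pluecker_trans n g I J * pluecker_vec n b J)"
proof -
  have "pluecker_vec n (row_act (2 * n) g b) I = rows_minor n (pick I) (row_act (2 * n) g b)"
    using assms by (simp add: pluecker_vec_def)
  also have "\<dots> = (\<Sum>J\<in>pluecker_index n (2 * n). pluecker_trans n g I J * rows_minor n (pick J) b)"
    unfolding pluecker_trans_def
    by (rule form_coeff[where G="\<lambda>b. rows_minor n (pick I) (row_act (2 * n) g b)", OF pluecker_form_row_act, symmetric])
  also have "\<dots> = (\<Sum>J\<in>pluecker_index n (2 * n). pluecker_trans n g I J * pluecker_vec n b J)"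
    by (intro sum.cong refl) (simp add: pluecker_vec_def)
  finally show ?thesis .
qed

text \<open>These matrices have unit vectors as columns and represent the basis of the exterior
  power; they serve to read off the entries of \<open>pluecker_trans\<close>.\<close>

lemma pluecker_vec_unit:
  assumes I: "I \<in> pluecker_index n (2 * n)" and J: "J \<in> pluecker_index n (2 * n)"
  shows "pluecker_vec n (\<lambda>i j. if i = pick J j then 1 else 0) I = (if I = J then 1 else 0)"
proof (cases "I = J")
  case True
  have "inj_on (pick J) {..<n}" using pick_bij(1)[OF J] by (rule bij_betw_imp_inj_on)
  hence "mat n n (\<lambda>(i, j). if pick J i = pick J j then 1 else 0 :: complex) = 1\<^sub>m n"
    by (intro eq_matI) (auto dest: inj_onD)
  thus ?thesis using I True by (simp add: pluecker_vec_def rows_minor_def)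
next
  case False
  let ?b = "\<lambda>i j. if i = pick J j then 1 else 0 :: complex"
  have fin: "finite I" "card I = card J"
    using I J finite_subset[of I "{..<2 * n}"] by (auto simp: pluecker_index_def)
  have "\<not> J \<subseteq> I" using card_subset_eq[OF fin(1), of J] fin(2) False by auto
  then obtain m where m: "m \<in> J" "m \<notin> I" by auto
  have "m \<in> pick J ` {..<n}" using bij_betw_imp_surj_on[OF pick_bij(1)[OF J]] m(1) by simp
  then obtain j where j: "j < n" "pick J j = m" by (elim imageE) (rule that, simp_all)
  have "row_val n ?b (pick I i) (\<lambda>k. if k = j then 1 else 0) = 0" if "i < n" for i
  proof -
    have "pick I i \<in> pick I ` {..<n}" using that by simp
    hence "pick I i \<in> I" unfolding bij_betw_imp_surj_on[OF pick_bij(1)[OF I]] .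
    have "pick I i \<noteq> m"
    proof
      assume "pick I i = m"
      with \<open>pick I i \<in> I\<close> m(2) show False by simp
    qed
    hence "?b (pick I i) k * (if k = j then 1 else 0) = 0" for k using j(2) by (cases "k = j") simp_all
    thus ?thesis unfolding row_val_def by simp
  qed
  hence *: "\<forall>i<n. row_val n ?b (pick I i) (\<lambda>k. if k = j then 1 else 0) = 0" by simp
  have "rows_minor n (pick I) ?b = 0"
  proof (rule ccontr)
    assume "rows_minor n (pick I) ?b \<noteq> 0"
    from this[unfolded rows_minor_nonzero_iff, rule_format, OF _ j(1), of "\<lambda>k. if k = j then 1 else 0"]
    show False using * by simp
  qed
  thus ?thesis using False by (simp add: pluecker_vec_def)
qed

lemma pluecker_vec_inverse:
  assumes "\<forall>i<2 * n. \<forall>j<2 * n. (\<Sum>k<2 * n. g' i k * g k j) = (if i = j then 1 else 0)"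
  shows "pluecker_vec n (row_act (2 * n) g' (row_act (2 * n) g b)) = pluecker_vec n b"
  by (rule pluecker_vec_cong) (rule row_act_inverse[OF assms])

lemma pluecker_trans_inverse:
  assumes inv: "\<forall>i<2 * n. \<forall>j<2 * n. (\<Sum>k<2 * n. g' i k * g k j) = (if i = j then 1 else 0)"
    and I: "I \<in> pluecker_index n (2 * n)" and J: "J \<in> pluecker_index n (2 * n)"
  shows "(\<Sum>M\<in>pluecker_index n (2 * n). pluecker_trans n g' I M * pluecker_trans n g M J) = (if I = J then 1 else 0)"
proof -
  let ?P = "pluecker_index n (2 * n)" and ?b = "\<lambda>i j. if i = pick J j then 1 else 0 :: complex"
  have "pluecker_vec n (row_act (2 * n) g ?b) M = pluecker_trans n g M J" if M: "M \<in> ?P" for M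
  proof -
    have "pluecker_vec n (row_act (2 * n) g ?b) M = (\<Sum>L\<in>?P. pluecker_trans n g M L * (if L = J then 1 else 0))"
      unfolding pluecker_vec_row_act[OF M] using pluecker_vec_unit[OF _ J] by (intro sum.cong refl) simp
    also have "\<dots> = pluecker_trans n g M J"
      using J pluecker_index_finite[of n "2 * n"] by (simp add: if_distrib[of "\<lambda>t. _ * t"] cong: if_cong)
    finally show ?thesis .
  qed
  hence "(\<Sum>M\<in>?P. pluecker_trans n g' I M * pluecker_trans n g M J) =
    (\<Sum>M\<in>?P. pluecker_trans n g' I M * pluecker_vec n (row_act (2 * n) g ?b) M)"
    by (intro sum.cong refl) simp
  also have "\<dots> = pluecker_vec n ?b I"
    unfolding pluecker_vec_row_act[OF I, symmetric] pluecker_vec_inverse[OF inv] ..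
  finally show ?thesis unfolding pluecker_vec_unit[OF I J] .
qed

lemma pluecker_form_vec:
  assumes "pluecker_form n G"
  shows "G b = (\<Sum>I\<in>pluecker_index n (2 * n). form_coeff n G I * pluecker_vec n b I)"
proof -
  have "G b = (\<Sum>I\<in>pluecker_index n (2 * n). form_coeff n G I * rows_minor n (pick I) b)"
    by (rule form_coeff[OF assms, symmetric])
  thus ?thesis unfolding pluecker_vec_def by simp
qed

lemma pluecker_vec_proportional:
  assumes inv: "\<forall>i<2 * n. \<forall>j<2 * n. (\<Sum>k<2 * n. g' i k * g k j) = (if i = j then 1 else 0)"
    and eq: "\<And>I. I \<in> pluecker_index n (2 * n) \<Longrightarrow>
      pluecker_vec n (row_act (2 * n) g b) I = c * pluecker_vec n (row_act (2 * n) g b') I"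
    and f: "\<And>i. i < n \<Longrightarrow> f i < 2 * n"
  shows "rows_minor n f b = c * rows_minor n f b'"
proof -
  let ?P = "pluecker_index n (2 * n)"
  have "pluecker_vec n b I = c * pluecker_vec n b' I" if I: "I \<in> ?P" for I
  proof -
    have "pluecker_vec n b I = (\<Sum>M\<in>?P. pluecker_trans n g' I M * (c * pluecker_vec n (row_act (2 * n) g b') M))"
      unfolding pluecker_vec_inverse[OF inv, of b, symmetric] pluecker_vec_row_act[OF I, of g']
      by (intro sum.cong refl) (simp add: eq)
    also have "\<dots> = c * (\<Sum>M\<in>?P. pluecker_trans n g' I M * pluecker_vec n (row_act (2 * n) g b') M)"
      by (simp add: sum_distrib_left mult.left_commute)
    also have "\<dots> = c * pluecker_vec n b' I"
      unfolding pluecker_vec_row_act[OF I, symmetric] pluecker_vec_inverse[OF inv] ..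
    finally show ?thesis .
  qed
  moreover have "rows_minor n f b = (\<Sum>I\<in>?P. form_coeff n (rows_minor n f) I * pluecker_vec n b I)" for b
    by (rule pluecker_form_vec[OF pluecker_form_rows_minor[OF f]])
  ultimately show ?thesis by (simp add: sum_distrib_left mult.left_commute)
qed

text \<open>The equations of a linear section, in the coordinates before the linear change \<open>g\<close>.\<close>

definition pull_forms :: "nat \<Rightarrow> (nat \<Rightarrow> nat \<Rightarrow> complex) \<Rightarrow> (nat \<times> nat set \<Rightarrow> complex) \<Rightarrow> nat \<times> nat set \<Rightarrow> complex" where
  "pull_forms n g A p = (\<Sum>I\<in>pluecker_index n (2 * n). A (fst p, I) * pluecker_trans n g I (snd p))"

lemma pull_forms:
  "(\<Sum>I\<in>pluecker_index n (2 * n). A (j, I) * pluecker_vec n (row_act (2 * n) g b) I) =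
   (\<Sum>J\<in>pluecker_index n (2 * n). pull_forms n g A (j, J) * pluecker_vec n b J)"
proof -
  let ?P = "pluecker_index n (2 * n)"
  have "(\<Sum>I\<in>?P. A (j, I) * pluecker_vec n (row_act (2 * n) g b) I) =
    (\<Sum>I\<in>?P. \<Sum>J\<in>?P. A (j, I) * (pluecker_trans n g I J * pluecker_vec n b J))"
    by (intro sum.cong refl) (simp add: pluecker_vec_row_act sum_distrib_left)
  also have "\<dots> = (\<Sum>J\<in>?P. \<Sum>I\<in>?P. A (j, I) * (pluecker_trans n g I J * pluecker_vec n b J))"
    by (rule sum.swap)
  also have "\<dots> = (\<Sum>J\<in>?P. pull_forms n g A (j, J) * pluecker_vec n b J)"
    by (simp only: pull_forms_def sum_distrib_right fst_conv snd_conv mult.assoc)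
  finally show ?thesis .
qed

text \<open>Every system of forms is pulled back from another one, so a nonzero polynomial condition
  on the pulled back forms is a nonzero polynomial condition on the original forms.\<close>

lemma pull_forms_surj:
  assumes inv: "\<forall>i<2 * n. \<forall>j<2 * n. (\<Sum>k<2 * n. g' i k * g k j) = (if i = j then 1 else 0)"
    and J: "J \<in> pluecker_index n (2 * n)"
  shows "pull_forms n g (pull_forms n g' a) (j, J) = a (j, J)"
proof -
  let ?P = "pluecker_index n (2 * n)"
  have "pull_forms n g (pull_forms n g' a) (j, J) =
    (\<Sum>I\<in>?P. \<Sum>M\<in>?P. a (j, M) * (pluecker_trans n g' M I * pluecker_trans n g I J))"
    unfolding pull_forms_def by (simp add: sum_distrib_right mult.assoc)
  also have "\<dots> = (\<Sum>M\<in>?P. \<Sum>I\<in>?P. a (j, M) * (pluecker_trans n g' M I * pluecker_trans n g I J))"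
    by (rule sum.swap)
  also have "\<dots> = (\<Sum>M\<in>?P. a (j, M) * (if M = J then 1 else 0))"
    by (intro sum.cong refl) (simp add: sum_distrib_left[symmetric] pluecker_trans_inverse[OF inv _ J])
  also have "\<dots> = a (j, J)"
    using J pluecker_index_finite[of n "2 * n"] by (simp add: if_distrib[of "\<lambda>t. _ * t"] cong: if_cong)
  finally show ?thesis .
qed

lemma independent_pull_forms:
  assumes "independent_forms (pluecker_index n (2 * n)) r (pull_forms n g A)"
  shows "independent_forms (pluecker_index n (2 * n)) r A"
  unfolding independent_forms_def
proof (rule allI, rule impI)
  fix c :: "nat \<Rightarrow> complex" let ?P = "pluecker_index n (2 * n)"
  assume c: "\<forall>I\<in>?P. (\<Sum>j<r. c j * A (j, I)) = 0"
  have "(\<Sum>j<r. c j * pull_forms n g A (j, J)) = 0" for J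
  proof -
    have "(\<Sum>j<r. c j * pull_forms n g A (j, J)) = (\<Sum>j<r. \<Sum>I\<in>?P. c j * (A (j, I) * pluecker_trans n g I J))"
      by (simp add: pull_forms_def sum_distrib_left)
    also have "\<dots> = (\<Sum>I\<in>?P. \<Sum>j<r. c j * (A (j, I) * pluecker_trans n g I J))" by (rule sum.swap)
    also have "\<dots> = (\<Sum>I\<in>?P. (\<Sum>j<r. c j * A (j, I)) * pluecker_trans n g I J)"
      by (simp only: sum_distrib_right mult.assoc)
    finally show ?thesis using c by simp
  qed
  thus "\<forall>j<r. c j = 0" using assms unfolding independent_forms_def by simp
qed

section \<open>Linear sections of the Lagrangian Grassmannian\<close>

context symmetric_coordinates
begin

lemma lin_sys_pluecker_vec:
  "lin_sys (\<lambda>_. pluecker_index n (2 * n)) (\<lambda>e I. rows_minor n (pick I)) a e b =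
    (\<Sum>J\<in>pluecker_index n (2 * n). a (e, J) * pluecker_vec n b J)"
  "lin_sys (\<lambda>_. pluecker_index n (2 * n)) (\<lambda>e I x. rows_minor n (pick I) (chart {} x)) a e x =
    (\<Sum>J\<in>pluecker_index n (2 * n). a (e, J) * pluecker_vec n (chart {} x) J)"
  unfolding lin_sys_def by (intro sum.cong refl; simp add: pluecker_vec_def)+

lemma LG_zeros_iff:
  "x \<in> LG.zeros a \<longleftrightarrow> (\<forall>u\<ge>N. x u = 0) \<and>
    (\<forall>e<N. (\<Sum>J\<in>pluecker_index n (2 * n). a (e, J) * pluecker_vec n (chart {} x) J) = 0)"
  unfolding LG.zeros_def lin_sys_pluecker_vec by simp

text \<open>A linear relation among the forms is also a relation among the rows of the Jacobian
  matrix at \<open>z\<close>, which is invertible.\<close>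

lemma regular_zero_independent:
  assumes "z \<in> LG.zeros a" "LG.regular a"
  shows "independent_forms (pluecker_index n (2 * n)) N a"
  unfolding independent_forms_def
proof (rule allI, rule impI)
  fix c :: "nat \<Rightarrow> complex" let ?P = "pluecker_index n (2 * n)"
  assume c: "\<forall>I\<in>?P. (\<Sum>j<N. c j * a (j, I)) = 0"
  let ?s = "lin_sys (\<lambda>_. ?P) (\<lambda>e I x. rows_minor n (pick I) (chart {} x))"
  let ?J = "\<lambda>e u. pd u (?s a e) z"
  have "LG.jacobian a z \<noteq> 0" using assms unfolding LG.regular_def by blast
  hence "det (mat N N (\<lambda>(e, u). ?J e u)) \<noteq> 0" unfolding LG.jacobian_def .
  from det_nonzero_inverse_fun[OF this] obtain M where
    M: "\<forall>i<N. \<forall>j<N. (\<Sum>k<N. ?J i k * M k j) = (if i = j then 1 else 0)"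
    by (elim exE conjE) (rule that)
  have J0: "(\<Sum>e<N. c e * ?J e u) = 0" if u: "u < N" for u
  proof -
    have "(\<Sum>e<N. c e * ?J e u) =
      (\<Sum>e<N. \<Sum>I\<in>?P. c e * (a (e, I) * pd u (\<lambda>x. rows_minor n (pick I) (chart {} x)) z))"
      by (intro sum.cong refl) (simp add: LG.pd_lin_sys[OF _ u] sum_distrib_left)
    also have "\<dots> = (\<Sum>I\<in>?P. \<Sum>e<N. c e * (a (e, I) * pd u (\<lambda>x. rows_minor n (pick I) (chart {} x)) z))"
      by (rule sum.swap)
    also have "\<dots> = (\<Sum>I\<in>?P. (\<Sum>e<N. c e * a (e, I)) * pd u (\<lambda>x. rows_minor n (pick I) (chart {} x)) z)"
      by (simp only: sum_distrib_right mult.assoc)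
    finally show ?thesis using c by simp
  qed
  show "\<forall>j<N. c j = 0"
  proof (intro allI impI)
    fix j assume j: "j < N"
    have "c j = (\<Sum>e<N. c e * (if e = j then 1 else 0))"
      using j by (simp add: if_distrib[of "\<lambda>t. _ * t"] cong: if_cong)
    also have "\<dots> = (\<Sum>e<N. \<Sum>u<N. c e * (?J e u * M u j))"
      by (intro sum.cong refl) (use M j in \<open>simp add: sum_distrib_left[symmetric]\<close>)
    also have "\<dots> = (\<Sum>u<N. \<Sum>e<N. c e * (?J e u * M u j))" by (rule sum.swap)
    also have "\<dots> = (\<Sum>u<N. (\<Sum>e<N. c e * ?J e u) * M u j)"
      by (simp only: sum_distrib_right mult.assoc)
    also have "\<dots> = 0" using J0 by simp
    finally show "c j = 0" .
  qed
qed

lemma full_rank_chart: "full_rank n (chart {} x)"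
  by (rule rows_minor_full_rank[of n "\<lambda>i. i"])
    (use rows_minor_chart_self[of "{}" x] in \<open>simp_all add: mixed_rows_empty\<close>)

lemma pluecker_vec_nonzero:
  assumes inv: "\<forall>i<2 * n. \<forall>j<2 * n. (\<Sum>k<2 * n. g' i k * g k j) = (if i = j then 1 else 0)"
    and b: "isotropic n b" "full_rank n b"
  shows "pluecker_vec n (row_act (2 * n) g b) \<noteq> (\<lambda>I. 0)"
proof
  assume 0: "pluecker_vec n (row_act (2 * n) g b) = (\<lambda>I. 0)"
  from isotropic_mixed_minor[OF b] obtain I where I: "I \<subseteq> {..<n}" "rows_minor n (mixed_rows n I) b \<noteq> 0"
    by (elim exE conjE) (rule that)
  have "rows_minor n (mixed_rows n I) b = 0 * rows_minor n (mixed_rows n I) b"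
    by (rule pluecker_vec_proportional[OF inv]) (simp_all add: 0 mixed_rows_def)
  thus False using I(2) by simp
qed

text \<open>Admissibility confines the section to the main chart. There the map is injective: the
  minor of the first \<open>n\<close> rows equals \<open>1\<close> and fixes the scalar between two
  representatives, and the coordinates are themselves minors.\<close>

lemma section_bij:
  assumes inv: "\<forall>i<2 * n. \<forall>j<2 * n. (\<Sum>k<2 * n. g' i k * g k j) = (if i = j then 1 else 0)"
    and adm: "LG.admissible (pull_forms n g A)"
  shows "bij_betw (\<lambda>x. line_through (pluecker_vec n (row_act (2 * n) g (chart {} x)))) (LG.zeros (pull_forms n g A))
    ({line_through (pluecker_vec n (row_act (2 * n) g b)) | b. isotropic n b \<and> full_rank n b} \<inter>
      linear_zeros (pluecker_index n (2 * n)) N A)"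
    (is "bij_betw ?f ?Z (?X \<inter> ?L)")
proof -
  let ?P = "pluecker_index n (2 * n)"
  have in_L: "line_through (pluecker_vec n (row_act (2 * n) g b)) \<in> ?L \<longleftrightarrow>
    (\<forall>j<N. (\<Sum>J\<in>?P. pull_forms n g A (j, J) * pluecker_vec n b J) = 0)"
    if "isotropic n b" "full_rank n b" for b
    unfolding pull_forms[symmetric]
    by (rule line_in_linear_zeros) (use pluecker_vec_nonzero[OF inv that] in \<open>simp_all add: pluecker_vec_def\<close>)
  have minor1: "rows_minor n (\<lambda>i. i) (chart {} x) = 1" for x
    using rows_minor_chart_self[of "{}" x] by (simp add: mixed_rows_empty)
  have inj: "inj_on ?f ?Z"
  proof (rule inj_onI)
    fix x y assume xy: "x \<in> ?Z" "y \<in> ?Z" "?f x = ?f y"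
    from line_through_eqD[OF xy(3)] obtain c where
      c: "pluecker_vec n (row_act (2 * n) g (chart {} x)) = (\<lambda>I. c * pluecker_vec n (row_act (2 * n) g (chart {} y)) I)" ..
    have scaled: "rows_minor n f (chart {} x) = c * rows_minor n f (chart {} y)" if "\<And>i. i < n \<Longrightarrow> f i < 2 * n" for f
      by (rule pluecker_vec_proportional[OF inv _ that]) (simp_all add: c)
    have "c = 1" using scaled[of "\<lambda>i. i"] by (simp add: minor1)
    show "x = y"
    proof
      fix u
      show "x u = y u"
      proof (cases "u < N")
        case True
        have "rows_minor n ((\<lambda>i. i)(fst (\<sigma> u) := n + snd (\<sigma> u))) (chart {} x) =
          c * rows_minor n ((\<lambda>i. i)(fst (\<sigma> u) := n + snd (\<sigma> u))) (chart {} y)"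
          by (rule scaled) (use \<sigma>_props[OF True] in simp)
        thus ?thesis unfolding coordinate_minor[OF True] using \<open>c = 1\<close> by simp
      next
        case False
        thus ?thesis using xy(1,2) unfolding LG_zeros_iff by simp
      qed
    qed
  qed
  have "?f ` ?Z = ?X \<inter> ?L"
  proof (intro equalityI subsetI)
    fix p assume "p \<in> ?f ` ?Z"
    then obtain x where x: "x \<in> ?Z" "p = ?f x" by (elim imageE)
    have "p \<in> ?X" unfolding x(2)
      by (intro CollectI exI[of _ "chart {} x"] conjI refl isotropic_chart full_rank_chart)
    moreover have "p \<in> ?L"
      unfolding x(2) in_L[OF isotropic_chart full_rank_chart] using x(1) unfolding LG_zeros_iff by simp
    ultimately show "p \<in> ?X \<inter> ?L" by simp
  next
    fix p assume "p \<in> ?X \<inter> ?L"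
    then obtain b where b: "isotropic n b" "full_rank n b" "p = line_through (pluecker_vec n (row_act (2 * n) g b))" and pL: "p \<in> ?L"
      by (elim IntE CollectE exE conjE) (rule that)
    have b_eqs: "(\<Sum>J\<in>?P. pull_forms n g A (e, J) * pluecker_vec n b J) = 0" if "e < N" for e
      using pL that unfolding b(3) in_L[OF b(1,2)] by simp
    from isotropic_mixed_minor[OF b(1,2)] obtain I where I: "I \<subseteq> {..<n}" "rows_minor n (mixed_rows n I) b \<noteq> 0"
      by (elim exE conjE) (rule that)
    have "\<exists>b'\<in>reduced_isotropic n. \<exists>s. s \<noteq> 0 \<and> (\<forall>f. (\<forall>i<n. f i < 2 * n) \<longrightarrow>
        rows_minor n f b' = s * rows_minor n f b \<and> cmod (rows_minor n f b') \<le> 1)"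
      by (rule isotropic_reduce[OF b(1) _ I(2)]) (simp add: mixed_rows_def)
    then obtain b' s where b': "b' \<in> reduced_isotropic n" "s \<noteq> 0" "\<forall>f. (\<forall>i<n. f i < 2 * n) \<longrightarrow>
        rows_minor n f b' = s * rows_minor n f b \<and> cmod (rows_minor n f b') \<le> 1"
      by (elim bexE exE conjE) (rule that)
    have b'_vec: "pluecker_vec n b' J = s * pluecker_vec n b J" for J
      using b'(3)[rule_format, of "pick J"] pick_bij(2)[of J n "2 * n"] by (simp add: pluecker_vec_def)
    have "(\<Sum>J\<in>?P. pull_forms n g A (e, J) * pluecker_vec n b' J) = s * (\<Sum>J\<in>?P. pull_forms n g A (e, J) * pluecker_vec n b J)" for e
      by (simp add: b'_vec sum_distrib_left mult.left_commute)
    hence "\<not> (\<exists>e<N. lin_sys (\<lambda>_. ?P) (\<lambda>e I. rows_minor n (pick I)) (pull_forms n g A) e b' \<noteq> 0)"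
      unfolding lin_sys_pluecker_vec using b_eqs by simp
    hence "rows_minor n (\<lambda>i. i) b' \<noteq> 0" using adm b'(1) unfolding LG.admissible_def by blast
    hence "rows_minor n (mixed_rows n {}) b \<noteq> 0" using b'(3)[rule_format, of "\<lambda>i. i"] by (simp add: mixed_rows_empty)
    from isotropic_to_chart[OF b(1) this] obtain x where x: "\<forall>u\<ge>N. x u = 0"
      "\<forall>f. (\<forall>i<n. f i < 2 * n) \<longrightarrow> rows_minor n f b = rows_minor n (mixed_rows n {}) b * rows_minor n f (chart {} x)"
      by auto
    define r where "r = rows_minor n (mixed_rows n {}) b"
    have r: "r \<noteq> 0" using \<open>rows_minor n (mixed_rows n {}) b \<noteq> 0\<close> by (simp add: r_def)
    have b_vec: "pluecker_vec n b J = r * pluecker_vec n (chart {} x) J" for J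
      using x(2)[rule_format, of "pick J"] pick_bij(2)[of J n "2 * n"] by (simp add: pluecker_vec_def r_def)
    have "pluecker_vec n (row_act (2 * n) g b) J = r * pluecker_vec n (row_act (2 * n) g (chart {} x)) J" for J
    proof (cases "J \<in> ?P")
      case True
      thus ?thesis by (simp add: pluecker_vec_row_act b_vec sum_distrib_left mult.left_commute)
    next
      case False
      thus ?thesis by (simp add: pluecker_vec_def)
    qed
    hence "pluecker_vec n (row_act (2 * n) g b) = (\<lambda>J. r * pluecker_vec n (row_act (2 * n) g (chart {} x)) J)" by (rule ext)
    hence p: "p = ?f x" unfolding b(3) by (simp add: line_through_cmult[OF r])
    have "x \<in> ?Z"
      unfolding LG_zeros_iff using x(1) pL unfolding p in_L[OF isotropic_chart full_rank_chart] by simp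
    thus "p \<in> ?f ` ?Z" using p by (intro image_eqI)
  qed
  thus ?thesis using inj by (simp add: bij_betw_def)
qed

lemma generic_section:
  assumes inv: "\<forall>i<2 * n. \<forall>j<2 * n. (\<Sum>k<2 * n. g' i k * g k j) = (if i = j then 1 else 0)"
    and X: "X = {line_through (pluecker_vec n (row_act (2 * n) g b)) | b. isotropic n b \<and> full_rank n b}"
  shows "\<exists>d. d * (\<Prod>u<N. fst (\<sigma> u) + snd (\<sigma> u) + 2) = (\<Prod>e<N. 2 * e + 2) \<and>
    for_generic_linear (pluecker_index n (2 * n)) N (\<lambda>L. finite (X \<inter> L) \<and> card (X \<inter> L) = d)"
proof -
  let ?P = "pluecker_index n (2 * n)" and ?w = "\<Prod>u<N. fst (\<sigma> u) + snd (\<sigma> u) + 2"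
  obtain F where F: "F \<in> polynomial_functions ({..<N} \<times> ?P)" "\<exists>a. F a \<noteq> 0"
    "\<forall>a. F a \<noteq> 0 \<longrightarrow> LG.admissible a \<and> LG.regular a \<and> finite (LG.zeros a) \<and>
      card (LG.zeros a) * ?w = (\<Prod>e<N. 2 * e + 2)"
    using generic_zero_count by (elim bexE conjE) (rule that)
  obtain a0 where a0: "F a0 \<noteq> 0" using F(2) ..
  define d where "d = card (LG.zeros a0)"
  have d: "d * ?w = (\<Prod>e<N. 2 * e + 2)" unfolding d_def using F(3) a0 by simp
  have "(\<Prod>e<N. 2 * e + 2) > (0::nat)" by (intro prod_pos) simp
  hence "0 < d * ?w" unfolding d .
  hence pos: "d > 0" "?w > 0" by simp_all
  show ?thesis
    unfolding for_generic_linear_def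
  proof (intro exI[of _ d] conjI d bexI[of _ "\<lambda>A. F (\<lambda>p. pull_forms n g A p)"] allI impI)
    show "(\<lambda>A. F (\<lambda>p. pull_forms n g A p)) \<in> polynomial_functions ({..<N} \<times> ?P)"
    proof (rule PF_subst[OF F(1)])
      fix p assume "p \<in> {..<N} \<times> ?P"
      thus "(\<lambda>A. pull_forms n g A p) \<in> polynomial_functions ({..<N} \<times> ?P)"
        unfolding pull_forms_def
        by (intro PF_sum polynomial_functions.mult polynomial_functions.const polynomial_functions.coord) auto
    qed
    have "F (pull_forms n g (pull_forms n g' a0)) = F a0"
      by (rule PF_cong[OF F(1)]) (use pull_forms_surj[OF inv] in auto)
    thus "\<exists>A. F (\<lambda>p. pull_forms n g A p) \<noteq> 0"
      by (intro exI[of _ "pull_forms n g' a0"]) (use a0 in simp)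
  next
    fix A assume "F (\<lambda>p. pull_forms n g A p) \<noteq> 0"
    hence A: "LG.admissible (pull_forms n g A)" "LG.regular (pull_forms n g A)" "finite (LG.zeros (pull_forms n g A))"
      "card (LG.zeros (pull_forms n g A)) * ?w = (\<Prod>e<N. 2 * e + 2)" using F(3) by simp_all
    have "card (LG.zeros (pull_forms n g A)) * ?w = d * ?w" unfolding A(4) d ..
    hence card: "card (LG.zeros (pull_forms n g A)) = d" using pos(2) by simp
    note bij = section_bij[OF inv A(1), folded X]
    show "finite (X \<inter> linear_zeros ?P N A)" using bij_betw_finite[OF bij] A(3) by simp
    show "card (X \<inter> linear_zeros ?P N A) = d" using bij_betw_same_card[OF bij] card by simp
    \<comment> \<open>The independence of the forms is drawn from the Jacobian at a zero, which
      exists because the count is positive.\<close>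
    have "LG.zeros (pull_forms n g A) \<noteq> {}" using card pos(1) by auto
    then obtain z where "z \<in> LG.zeros (pull_forms n g A)" by (elim ex_in_conv[THEN iffD2, THEN exE])
    thus "independent_forms ?P N A"
      by (rule independent_pull_forms[OF regular_zero_independent[OF _ A(2)]])
  qed
qed

end

lemma for_generic_linear_mono:
  assumes "for_generic_linear K r P" "\<And>L. P L \<Longrightarrow> Q L"
  shows "for_generic_linear K r Q"
proof -
  obtain F where "F \<in> polynomial_functions ({..<r} \<times> K)" "\<exists>A. F A \<noteq> 0"
    "\<forall>A. F A \<noteq> 0 \<longrightarrow> independent_forms K r A \<and> P (linear_zeros K r A)"
    using assms(1) unfolding for_generic_linear_def by (elim bexE conjE) (rule that)
  thus ?thesis unfolding for_generic_linear_def using assms(2) by (intro bexI[of _ F] conjI) simp_all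
qed

text \<open>As \<open>d > 0\<close>, generic sections of codimension \<open>r\<close> are finite and
  nonempty; comparing codimensions in both directions identifies \<open>r\<close> as the dimension.
  The degree is unique because two nonempty Zariski-open sets of coefficients intersect.\<close>

lemma proj_degree_eqI:
  assumes finK: "finite K" and d: "d > 0"
    and gen: "for_generic_linear K r (\<lambda>L. finite (X \<inter> L) \<and> card (X \<inter> L) = d)"
  shows "proj_degree K X = d"
proof -
  have dim: "proj_dim K X = r"
    unfolding proj_dim_def
  proof (rule the_equality)
    show *: "for_generic_linear K r (\<lambda>L. finite (X \<inter> L) \<and> X \<inter> L \<noteq> {})"
    proof (rule for_generic_linear_mono[OF gen])
      fix L assume "finite (X \<inter> L) \<and> card (X \<inter> L) = d"
      thus "finite (X \<inter> L) \<and> X \<inter> L \<noteq> {}" using d by (cases "X \<inter> L = {}") simp_all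
    qed
    fix s assume **: "for_generic_linear K s (\<lambda>L. finite (X \<inter> L) \<and> X \<inter> L \<noteq> {})"
    have "s \<le> r"
      by (rule generic_section_codim_less[OF finK, of r X s]; rule for_generic_linear_mono[OF *] for_generic_linear_mono[OF **]; simp)
    moreover have "r \<le> s"
      by (rule generic_section_codim_less[OF finK, of s X r]; rule for_generic_linear_mono[OF **] for_generic_linear_mono[OF *]; simp)
    ultimately show "s = r" by simp
  qed
  show ?thesis
    unfolding proj_degree_def dim
  proof (rule the_equality)
    show "for_generic_linear K r (\<lambda>L. finite (X \<inter> L) \<and> card (X \<inter> L) = d)" by (rule gen)
    fix d' assume gen': "for_generic_linear K r (\<lambda>L. finite (X \<inter> L) \<and> card (X \<inter> L) = d')"
    obtain F A where F: "F \<in> polynomial_functions ({..<r} \<times> K)" "F A \<noteq> 0"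
      "\<forall>A. F A \<noteq> 0 \<longrightarrow> independent_forms K r A \<and> finite (X \<inter> linear_zeros K r A) \<and> card (X \<inter> linear_zeros K r A) = d"
      using gen unfolding for_generic_linear_def by (elim bexE conjE exE) (rule that)
    obtain F' A' where F': "F' \<in> polynomial_functions ({..<r} \<times> K)" "F' A' \<noteq> 0"
      "\<forall>A. F' A \<noteq> 0 \<longrightarrow> independent_forms K r A \<and> finite (X \<inter> linear_zeros K r A) \<and> card (X \<inter> linear_zeros K r A) = d'"
      using gen' unfolding for_generic_linear_def by (elim bexE conjE exE) (rule that)
    from PF_domain[OF F(1,2) F'(1,2)] obtain C where "F C \<noteq> 0" "F' C \<noteq> 0" by (elim exE conjE) (rule that)
    hence "card (X \<inter> linear_zeros K r C) = d" and *: "card (X \<inter> linear_zeros K r C) = d'"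
      using F(3)[rule_format, of C] F'(3)[rule_format, of C] by simp_all
    thus "d' = d" using * by metis
  qed
qed

subsection \<open>The product formula\<close>

lemma triangular_index_set: "{(i, k). i \<le> k \<and> k < n} = prod.swap ` (SIGMA k:{..<n}. {..k :: nat})"
  by (auto simp: image_iff)

lemma card_triangular: "card {(i, k). i \<le> k \<and> k < n} = n * (n + 1) div 2" for n :: nat
proof -
  have "card {(i, k). i \<le> k \<and> k < n} = card (SIGMA k:{..<n}. {..k :: nat})"
    unfolding triangular_index_set by (intro card_image) (simp add: inj_on_def)
  also have "\<dots> = (\<Sum>k<n. k + 1)" by simp
  also have "\<dots> = n * (n + 1) div 2" by (induction n) auto
  finally show ?thesis .
qed

lemma ex_triangular_enumeration:
  fixes n :: nat
  assumes "N = n * (n + 1) div 2"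
  shows "\<exists>\<sigma>. bij_betw \<sigma> {..<N} {(i, k). i \<le> k \<and> k < n} \<and> (\<forall>e<n. \<sigma> e = (e, e))"
proof -
  let ?T = "{(i, k). i \<le> k \<and> k < n}" and ?D = "(\<lambda>e :: nat. (e, e)) ` {..<n}"
  have fin: "finite ?T" unfolding triangular_index_set by (intro finite_imageI finite_SigmaI) auto
  have sub: "?D \<subseteq> ?T" by auto
  have D: "bij_betw (\<lambda>e :: nat. (e, e)) {..<n} ?D" by (auto simp: bij_betw_def inj_on_def)
  have card_D: "card ?D = n" using bij_betw_same_card[OF D] by simp
  have "card (?T - ?D) = N - n"
    using card_Diff_subset[OF finite_subset[OF sub fin] sub] card_triangular[of n] card_D assms by simp
  hence "card {n..<N} = card (?T - ?D)" by simp
  from finite_same_card_bij[OF _ _ this] obtain h where h: "bij_betw h {n..<N} (?T - ?D)" using fin by auto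
  have "n \<le> N" using card_mono[OF fin sub] card_triangular[of n] card_D assms by simp
  hence dom: "{..<N} = {..<n} \<union> {n..<N}" by auto
  define \<sigma> where "\<sigma> = (\<lambda>e. if e < n then (e, e) else h e)"
  have "bij_betw \<sigma> {..<n} ?D" using D by (rule bij_betw_cong[THEN iffD1, rotated]) (simp add: \<sigma>_def)
  moreover have "bij_betw \<sigma> {n..<N} (?T - ?D)" using h by (rule bij_betw_cong[THEN iffD1, rotated]) (simp add: \<sigma>_def)
  ultimately have "bij_betw \<sigma> {..<N} (?D \<union> (?T - ?D))" unfolding dom by (rule bij_betw_combine) auto
  moreover have "?D \<union> (?T - ?D) = ?T" using sub by auto
  ultimately show ?thesis by (intro exI[of _ \<sigma>]) (simp add: \<sigma>_def)
qed

lemma prod_triangular: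
  fixes n :: nat and f :: "nat \<Rightarrow> nat \<Rightarrow> 'a :: comm_monoid_mult"
  assumes "bij_betw \<sigma> {..<N} {(i, k). i \<le> k \<and> k < n}"
  shows "(\<Prod>u<N. f (fst (\<sigma> u)) (snd (\<sigma> u))) = (\<Prod>k<n. \<Prod>i\<le>k. f i k)"
proof -
  have "(\<Prod>u<N. f (fst (\<sigma> u)) (snd (\<sigma> u))) = (\<Prod>p\<in>{(i, k). i \<le> k \<and> k < n}. f (fst p) (snd p))"
    by (rule prod.reindex_bij_betw[OF assms])
  also have "\<dots> = (\<Prod>p\<in>(SIGMA k:{..<n}. {..k}). f (snd p) (fst p))"
    unfolding triangular_index_set by (subst prod.reindex) (simp_all add: inj_on_def)
  also have "\<dots> = (\<Prod>k<n. \<Prod>i\<le>k. f i k)"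
    by (subst prod.Sigma) (simp_all add: case_prod_unfold)
  finally show ?thesis .
qed

lemma fact_mult_prod: "fact m * (\<Prod>i<k. real (i + m + 1)) = fact (m + k)"
proof (induction k)
  case (Suc k)
  have "fact m * (\<Prod>i<Suc k. real (i + m + 1)) = (fact m * (\<Prod>i<k. real (i + m + 1))) * real (m + k + 1)"
    by (simp add: mult.assoc add.commute)
  also have "\<dots> = fact (m + Suc k)" unfolding Suc.IH by (simp add: mult.commute)
  finally show ?case .
qed simp

lemma prod_strict_pairs_Suc:
  "(\<Prod>(i, j) \<in> {(i, j). 1 \<le> i \<and> i < j \<and> j \<le> Suc n}. 2 * real j - 2 * real i) =
   (\<Prod>(i, j) \<in> {(i, j). 1 \<le> i \<and> i < j \<and> j \<le> n}. 2 * real j - 2 * real i) * (2 ^ n * fact n)"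
proof -
  let ?P = "\<lambda>n. {(i, j). 1 \<le> i \<and> i < j \<and> j \<le> n}" and ?f = "\<lambda>(i, j). 2 * real j - 2 * real i"
  have "?P n \<subseteq> {..n} \<times> {..n}" by auto
  hence fin: "finite (?P n)" by (rule finite_subset) simp
  have "?P (Suc n) = ?P n \<union> (\<lambda>i. (i, Suc n)) ` {1..n}" by auto
  hence "prod ?f (?P (Suc n)) = prod ?f (?P n) * prod ?f ((\<lambda>i. (i, Suc n)) ` {1..n})"
    using fin by (simp only:) (rule prod.union_disjoint; auto)
  also have "prod ?f ((\<lambda>i. (i, Suc n)) ` {1..n}) = (\<Prod>i=1..n. 2 * real (Suc n - i))"
    by (subst prod.reindex) (auto simp: inj_on_def intro!: prod.cong)
  also have "\<dots> = (\<Prod>i=1..n. 2 * real i)"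
    by (rule prod.reindex_bij_witness[of _ "\<lambda>i. Suc n - i" "\<lambda>i. Suc n - i"]) auto
  also have "\<dots> = 2 ^ n * fact n"
    by (induction n) (simp_all add: algebra_simps)
  finally show ?thesis .
qed

text \<open>From \<open>n\<close> to \<open>n + 1\<close> the product of the new weights is
  \<open>fact (2 * n + 2) / fact (n + 1)\<close> and that of the new differences is
  \<open>2 ^ n * fact n\<close>. Together they give \<open>2 ^ (n + 1) * fact (2 * n + 1)\<close>,
  the factor gained on the left.\<close>

lemma triangular_product_identity:
  "2 ^ (n * (n + 1) div 2) * (\<Prod>i=1..n. fact (2 * i - 1)) =
   (\<Prod>k<n. \<Prod>i\<le>k. real (i + k + 2)) *
   (\<Prod>(i, j) \<in> {(i, j). 1 \<le> i \<and> i < j \<and> j \<le> n}. 2 * real j - 2 * real i)"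
proof (induction n)
  case 0
  have "{(i, j). 1 \<le> i \<and> i < j \<and> j \<le> (0 :: nat)} = {}" by auto
  thus ?case by (simp only:) simp
next
  case (Suc n)
  let ?W = "\<Prod>k<n. \<Prod>i\<le>k. real (i + k + 2)" and ?w = "\<Prod>i\<le>n. real (i + n + 2)"
  let ?V = "\<lambda>n. \<Prod>(i, j) \<in> {(i, j). 1 \<le> i \<and> i < j \<and> j \<le> n}. 2 * real j - 2 * real i"
  let ?F = "\<Prod>i=1..n. fact (2 * i - 1) :: real"
  have "fact (n + 1) * (\<Prod>i<n + 1. real (i + (n + 1) + 1)) = fact ((n + 1) + (n + 1))" by (rule fact_mult_prod)
  moreover have "(\<Prod>i<n + 1. real (i + (n + 1) + 1)) = ?w"
    by (rule prod.cong) (auto simp: lessThan_Suc_atMost)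
  moreover have "(n + 1) + (n + 1) = Suc (2 * n + 1)" by simp
  ultimately have "fact (n + 1) * ?w = fact (Suc (2 * n + 1))" by (simp only:)
  moreover have "fact (Suc (2 * n + 1)) = real (n + 1) * (2 * fact (2 * n + 1))"
    unfolding fact_Suc by (simp only: of_nat_Suc of_nat_add of_nat_mult) (simp only: mult.assoc[symmetric], simp)
  moreover have "fact (n + 1) = real (n + 1) * fact n" by simp
  ultimately have "real (n + 1) * (fact n * ?w) = real (n + 1) * (2 * fact (2 * n + 1))"
    by (simp only: mult.assoc)
  moreover have "real (n + 1) \<noteq> 0" by simp
  ultimately have step: "fact n * ?w = 2 * fact (2 * n + 1)" by (rule mult_left_cancel[THEN iffD1, rotated])
  have "Suc n * (Suc n + 1) div 2 = n * (n + 1) div 2 + (n + 1)" by simp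
  hence "2 ^ (Suc n * (Suc n + 1) div 2) * (\<Prod>i=1..Suc n. fact (2 * i - 1)) =
    2 ^ (n * (n + 1) div 2 + (n + 1)) * (?F * fact (2 * Suc n - 1) :: real)"
    by (simp only: prod.nat_ivl_Suc') (simp only: mult_ac)
  also have "2 * Suc n - 1 = 2 * n + 1" by simp
  also have "2 ^ (n * (n + 1) div 2 + (n + 1)) * (?F * fact (2 * n + 1) :: real) =
    (2 ^ (n * (n + 1) div 2) * ?F) * (2 ^ n * (2 * fact (2 * n + 1)))"
    unfolding power_add power_one_right by (simp only: mult_ac)
  also have "\<dots> = (?W * ?V n) * (2 ^ n * (fact n * ?w))" unfolding Suc.IH step ..
  also have "\<dots> = (?W * ?w) * ?V (Suc n)" unfolding prod_strict_pairs_Suc by (simp only: mult_ac)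
  also have "?W * ?w = (\<Prod>k<Suc n. \<Prod>i\<le>k. real (i + k + 2))" by simp
  finally show ?case .
qed

theorem proposition2:
  fixes n :: nat and \<omega> :: "complex vec \<Rightarrow> complex vec \<Rightarrow> complex"
  assumes "n \<ge> 1" and "symplectic_form (2 * n) \<omega>"
  shows "real (proj_degree (pluecker_index n (2 * n))
                 (pluecker n (2 * n) ` lagrangian_grassmannian n \<omega>)) =
         fact (n * (n + 1) div 2) / (\<Prod>i=1..n. fact (2 * i - 1)) *
         (\<Prod>(i, j) \<in> {(i, j). 1 \<le> i \<and> i < j \<and> j \<le> n}. 2 * real j - 2 * real i)"
proof -
  define N where "N = n * (n + 1) div 2"
  let ?X = "pluecker n (2 * n) ` lagrangian_grassmannian n \<omega>"
  let ?W = "\<Prod>k<n. \<Prod>i\<le>k. i + k + 2" and ?F = "\<Prod>i=1..n. fact (2 * i - 1) :: real"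
  let ?V = "\<Prod>(i, j) \<in> {(i, j). 1 \<le> i \<and> i < j \<and> j \<le> n}. 2 * real j - 2 * real i"
  from lagrangian_points[OF assms(2)] obtain g g' where
    inv: "\<forall>i<2 * n. \<forall>j<2 * n. (\<Sum>k<2 * n. g' i k * g k j) = (if i = j then 1 else 0)" and
    X: "?X = {line_through (pluecker_vec n (row_act (2 * n) g b)) | b. isotropic n b \<and> full_rank n b}"
    by (elim exE conjE) (rule that)
  from ex_triangular_enumeration[OF N_def] obtain \<sigma> where
    \<sigma>: "bij_betw \<sigma> {..<N} {(i, k). i \<le> k \<and> k < n}" "\<forall>e<n. \<sigma> e = (e, e)"
    by (elim exE conjE) (rule that)
  interpret symmetric_coordinates n N \<sigma>
    by unfold_locales (use assms(1) N_def \<sigma> in auto)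
  from generic_section[OF inv X] obtain d where
    d: "d * (\<Prod>u<N. fst (\<sigma> u) + snd (\<sigma> u) + 2) = (\<Prod>e<N. 2 * e + 2)"
    "for_generic_linear (pluecker_index n (2 * n)) N (\<lambda>L. finite (?X \<inter> L) \<and> card (?X \<inter> L) = d)"
    by (elim exE conjE) (rule that)
  have dW: "d * ?W = (\<Prod>e<N. 2 * e + 2)"
    using d(1) unfolding prod_triangular[OF \<sigma>(1), of "\<lambda>i k. i + k + 2"] .
  have "(\<Prod>e<N. 2 * e + 2) > (0 :: nat)" by (intro prod_pos) simp
  hence "0 < d * ?W" unfolding dW .
  hence "d > 0" by simp
  hence deg: "proj_degree (pluecker_index n (2 * n)) ?X = d"
    by (rule proj_degree_eqI[OF pluecker_index_finite _ d(2)])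
  \<comment> \<open>The factorial of the dimension comes from the degrees \<open>2 * e + 2\<close>
    of the Bezout system; the remaining power of \<open>2\<close> cancels against the one in
    \<open>triangular_product_identity\<close>.\<close>
  have "real (\<Prod>e<M. 2 * e + 2) = 2 ^ M * fact M" for M
    by (induction M) (simp_all add: algebra_simps)
  hence "real d * real ?W = 2 ^ N * fact N" unfolding of_nat_mult[symmetric] dW .
  moreover have "real ?W = (\<Prod>k<n. \<Prod>i\<le>k. real (i + k + 2))" by simp
  ultimately have "real d * (2 ^ N * ?F) = 2 ^ N * fact N * ?V"
    unfolding N_def triangular_product_identity by (simp only: mult.assoc[symmetric])
  hence "real d * ?F = fact N * ?V" by simp
  moreover have "?F \<noteq> 0" by simp
  ultimately have "real d = fact N * ?V / ?F" by (simp only: eq_divide_eq) simp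
  thus ?thesis unfolding deg N_def by simp
qed

end
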